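(* Let $G$ be a finite, simple, connected graph on $n$ vertices such that $\mathrm{EV}(G)$ is a subgraph of a graph in $\mathcal{G}$. Then $\mathrm{pn}(G)\le \lceil n/2\rceil$.
   Context: All graphs are finite and simple. A path decomposition of a graph $G$ is a collection of edge-disjoint paths of $G$ whose union covers $E(G)$; $\mathrm{pn}(G)$ (the path number) is the minimum cardinality of a path decomposition of $G$. The E-subgraph $\mathrm{EV}(G)$ is the subgraph of $G$ induced by the vertices of even degree in $G$. A block of a graph is a maximal 2-connected subgraph. $\mathcal{G}$ denotes the family of graphs $H$ such that (i) each block of $H$ has maximum degree at most $3$, and (ii) each connected component of $H$ either has maximum degree at most $3$ or has at most one block that contains a triangle. *)

theory Defs
  imports Complex_Main
begin

record 'a sgraph =
  verts :: "'a set"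
  edges :: "'a set set"

text \<open>The graph with no vertices is admitted, since it occurs as an induced subgraph.\<close>

definition simple_graph :: "'a sgraph \<Rightarrow> bool" where
  "simple_graph G \<longleftrightarrow>
     finite (verts G) \<and> (\<forall>e\<in>edges G. e \<subseteq> verts G \<and> card e = 2)"

definition subgraph :: "'a sgraph \<Rightarrow> 'a sgraph \<Rightarrow> bool" where
  "subgraph H G \<longleftrightarrow> simple_graph H \<and> verts H \<subseteq> verts G \<and> edges H \<subseteq> edges G"

definition induced :: "'a sgraph \<Rightarrow> 'a set \<Rightarrow> 'a sgraph" where
  "induced G W = \<lparr>verts = verts G \<inter> W, edges = {e \<in> edges G. e \<subseteq> W}\<rparr>"

definition degree :: "'a sgraph \<Rightarrow> 'a \<Rightarrow> nat" where
  "degree G v = card {e \<in> edges G. v \<in> e}"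

definition max_degree_le :: "'a sgraph \<Rightarrow> nat \<Rightarrow> bool" where
  "max_degree_le G k \<longleftrightarrow> (\<forall>v\<in>verts G. degree G v \<le> k)"

definition connected_graph :: "'a sgraph \<Rightarrow> bool" where
  "connected_graph G \<longleftrightarrow>
     verts G \<noteq> {} \<and>
     (\<forall>u\<in>verts G. \<forall>v\<in>verts G. (\<lambda>x y. {x, y} \<in> edges G)\<^sup>*\<^sup>* u v)"

definition component :: "'a sgraph \<Rightarrow> 'a sgraph \<Rightarrow> bool" where
  "component G C \<longleftrightarrow>
     subgraph C G \<and> connected_graph C \<and>
     (\<forall>D. subgraph D G \<and> connected_graph D \<and> subgraph C D \<longrightarrow> D = C)"

definition two_connected :: "'a sgraph \<Rightarrow> bool" where
  "two_connected G \<longleftrightarrow>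
     3 \<le> card (verts G) \<and> connected_graph G \<and>
     (\<forall>v\<in>verts G. connected_graph (induced G (verts G - {v})))"

text \<open>With this notion of 2-connectedness a bridge or an isolated vertex is not a block.
  Counting these as blocks would not affect the class defined below: they have maximum
  degree at most 1 and contain no triangle.\<close>

definition block :: "'a sgraph \<Rightarrow> 'a sgraph \<Rightarrow> bool" where
  "block G B \<longleftrightarrow>
     subgraph B G \<and> two_connected B \<and>
     (\<forall>D. subgraph D G \<and> two_connected D \<and> subgraph B D \<longrightarrow> D = B)"

definition has_triangle :: "'a sgraph \<Rightarrow> bool" where
  "has_triangle G \<longleftrightarrow>
     (\<exists>x y z. distinct [x, y, z] \<and> {{x, y}, {y, z}, {x, z}} \<subseteq> edges G)"

definition graph_family :: "'a sgraph set" ("\<G>") where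
  "\<G> = {H. simple_graph H \<and>
     (\<forall>B. block H B \<longrightarrow> max_degree_le B 3) \<and>
     (\<forall>C. component H C \<longrightarrow>
        max_degree_le C 3 \<or>
        (\<forall>B B'. block C B \<and> has_triangle B \<and> block C B' \<and> has_triangle B' \<longrightarrow> B = B'))}"

definition EV :: "'a sgraph \<Rightarrow> 'a sgraph" where
  "EV G = induced G {v \<in> verts G. even (degree G v)}"

definition is_path :: "'a sgraph \<Rightarrow> bool" where
  "is_path P \<longleftrightarrow>
     (\<exists>xs. xs \<noteq> [] \<and> distinct xs \<and> verts P = set xs \<and>
           edges P = {{xs ! i, xs ! Suc i} | i. Suc i < length xs})"

definition path_decomposition :: "'a sgraph \<Rightarrow> 'a sgraph set \<Rightarrow> bool" where
  "path_decomposition G D \<longleftrightarrow>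
     finite D \<and> (\<forall>P\<in>D. is_path P \<and> subgraph P G) \<and>
     pairwise (\<lambda>P Q. edges P \<inter> edges Q = {}) D \<and>
     (\<Union>P\<in>D. edges P) = edges G"

definition pn :: "'a sgraph \<Rightarrow> nat" where
  "pn G = (LEAST k. \<exists>D. path_decomposition G D \<and> card D = k)"

text \<open>The minimum is attained, so the use of \<open>LEAST\<close> is meaningful.\<close>

lemma path_decomposition_exists:
  assumes "simple_graph G"
  shows "\<exists>D. path_decomposition G D"
proof -
  define f where "f e = \<lparr>verts = e, edges = {e}\<rparr>" for e :: "'a set"
  have "edges G \<subseteq> Pow (verts G)" "finite (verts G)"
    using assms by (auto simp: simple_graph_def)
  then have fin: "finite (edges G)"
    by (meson finite_Pow_iff finite_subset)
  have p: "is_path (f e) \<and> subgraph (f e) G" if e: "e \<in> edges G" for e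
  proof
    have "card e = 2" using e assms by (auto simp: simple_graph_def)
    then obtain x y where xy: "e = {x, y}" "x \<noteq> y" by (meson card_2_iff)
    have "{{[x, y] ! i, [x, y] ! Suc i} | i. Suc i < length [x, y]} = {e}"
      using xy by auto
    then show "is_path (f e)"
      unfolding is_path_def f_def using xy by (intro exI[of _ "[x, y]"]) auto
    show "subgraph (f e) G"
      using e assms by (auto simp: subgraph_def simple_graph_def f_def intro: finite_subset)
  qed
  have "path_decomposition G (f ` edges G)"
    unfolding path_decomposition_def
    using fin p by (auto simp: f_def pairwise_def)
  then show ?thesis by blast
qed

lemma pn_attained:
  assumes "simple_graph G"
  shows "\<exists>D. path_decomposition G D \<and> card D = pn G"
  unfolding pn_def
  by (rule LeastI_ex) (use path_decomposition_exists[OF assms] in blast)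

end

theory Submission
  imports Defs "HOL-Library.Multiset"
begin

text \<open>
  Fix a decomposition into paths and let \<open>t v\<close> be the number of path ends at \<open>v\<close>; it has the
  parity of the degree of \<open>v\<close>, so it is positive at vertices of odd degree. Rerouting paths
  through a vertex \<open>a\<close> (Lovasz) inserts a missing edge \<open>ab\<close> without changing the number of
  paths as soon as \<open>t b\<close> exceeds the number of neighbours of \<open>a\<close> at which no path ends; one
  end then moves from \<open>b\<close> to \<open>a\<close>. Hence one deletes edges so that enough even vertices become
  odd, decomposes the smaller graph by induction, and inserts the deleted edges again.

  Inside the even subgraph this removes leaves, adjacent vertices of degree 2 without common
  neighbour, and stars at vertices of degree 3. A leaf-block argument shows that for the given
  family only isolated vertices and isolated triangles remain. Those are removed by stars at
  odd vertices, except when a component consists of an even triangle and odd vertices each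
  joined to at least two vertices of the triangle. The reductions never create such a
  component, so it can only be the whole graph; then the order is odd, and deleting one edge of
  the triangle leaves a single even vertex, which costs one additional path.
\<close>

section \<open>Path systems and path ends\<close>

text \<open>Deleting edges destroys connectedness, and a bound rounded up would lose a half in every
  odd component. The induction therefore proves the rounded down bound \<open>card V div 2\<close>
  for a fixed vertex set, without connectedness, for all graphs in which no component is an
  \<open>obstruction\<close>. The price is that every reduction must be shown not to create an
  obstruction; this takes as much care as inserting the edges again. \<open>\<G>\<close> is not
  closed under subgraphs, because a block with two triangles may fall apart while a vertex of large
  degree survives. So the hypothesis carried along is that all edges between even vertices lie in
  one fixed \<open>H\<close>, and blocks are taken in \<open>H\<close>. The degree bound 3 comes
  from the star with three edges: when its centre becomes odd, one end lies there, inserting two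
  edges brings two more, and the last edge needs 1 end to move and up to 2 more against the end-free
  neighbours of its outer vertex.\<close>

fun path_edges :: "'v list \<Rightarrow> 'v set multiset" where
  "path_edges (x # y # r) = add_mset {x, y} (path_edges (y # r))"
| "path_edges _ = {#}"

definition end_count :: "'v list \<Rightarrow> 'v \<Rightarrow> int" where
  "end_count P v = of_bool (hd P = v) + of_bool (last P = v)"

text \<open>A one-vertex path is admitted; both of its ends lie at its vertex, so it contributes 2.\<close>

definition end_mult :: "'v list multiset \<Rightarrow> 'v \<Rightarrow> int" where
  "end_mult M v = (\<Sum>P\<in>#M. end_count P v)"

text \<open>Equating multisets expresses disjointness and covering at once, since every edge has
  multiplicity 1 in \<open>mset_set E\<close>. No vertex set is prescribed, so one-vertex paths may
  lie anywhere.\<close>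

definition decomposes :: "'v set set \<Rightarrow> 'v list multiset \<Rightarrow> bool" where
  "decomposes E M \<longleftrightarrow> (\<forall>P\<in>#M. P \<noteq> [] \<and> distinct P) \<and> (\<Sum>P\<in>#M. path_edges P) = mset_set E"

text \<open>Only the number of paths and the distribution of their ends are remembered; inserting
  edges depends on nothing else.\<close>

definition decomp :: "'v set set \<Rightarrow> nat \<Rightarrow> ('v \<Rightarrow> int) \<Rightarrow> bool" where
  "decomp E n t \<longleftrightarrow> finite E \<and> (\<exists>M. decomposes E M \<and> size M = n \<and> end_mult M = t)"

definition deg :: "'v set set \<Rightarrow> 'v \<Rightarrow> nat" where
  "deg E v = card {e \<in> E. v \<in> e}"

lemma path_edges_append:
  "xs \<noteq> [] \<Longrightarrow> ys \<noteq> [] \<Longrightarrow>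
    path_edges (xs @ ys) = path_edges xs + path_edges ys + {#{last xs, hd ys}#}"
proof (induction xs rule: path_edges.induct)
  case (1 x y r)
  then show ?case by simp
next
  case ("2_2" v)
  then show ?case by (cases ys) auto
qed auto

lemma path_edges_Cons: "xs \<noteq> [] \<Longrightarrow> path_edges (x # xs) = add_mset {x, hd xs} (path_edges xs)"
  by (cases xs) auto

lemma path_edges_subset: "e \<in># path_edges P \<Longrightarrow> e \<subseteq> set P"
  by (induction P rule: path_edges.induct) auto

lemma path_edges_rev [simp]: "path_edges (rev xs) = path_edges xs"
proof (induction xs rule: path_edges.induct)
  case (1 x y r)
  have "path_edges (rev (y # r) @ [x]) = path_edges (rev (y # r)) + {#{last (rev (y # r)), x}#}"
    by (subst path_edges_append) auto
  also have "\<dots> = add_mset {x, y} (path_edges (y # r))"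
    using 1 by (simp add: insert_commute)
  finally show ?case by simp
qed auto

lemma end_count_rev [simp]: "P \<noteq> [] \<Longrightarrow> end_count (rev P) v = end_count P v"
  by (simp add: end_count_def hd_rev last_rev)

lemma end_mult_simps [simp]:
  "end_mult {#} v = 0"
  "end_mult (add_mset P M) v = end_count P v + end_mult M v"
  "end_mult (M + N) v = end_mult M v + end_mult N v"
  by (simp_all add: end_mult_def)

lemma end_count_nonneg: "0 \<le> end_count P v"
  by (simp add: end_count_def)

lemma end_mult_nonneg: "0 \<le> end_mult M v"
  by (induction M) (auto intro: add_nonneg_nonneg simp: end_count_nonneg)

text \<open>An inner vertex meets two edges of the path and no end, an end vertex of a longer path
  meets one of each, and a one-vertex path has no edge but two ends.\<close>

lemma path_parity:
  assumes "distinct P" "P \<noteq> []"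
  shows "int (size {#e \<in># path_edges P. v \<in> e#}) + end_count P v = 2 * of_bool (v \<in> set P)"
  using assms
proof (induction P rule: path_edges.induct)
  case (1 x y r)
  then show ?case
    by (auto simp: end_count_def split: if_splits)
qed (auto simp: end_count_def)

lemma decomposes_parity:
  assumes "decomposes E M" "finite E"
  shows "even (int (deg E v) + end_mult M v)"
proof -
  have "\<forall>P\<in>#M. P \<noteq> [] \<and> distinct P" using assms by (simp add: decomposes_def)
  then have "even (int (size {#e \<in># (\<Sum>P\<in>#M. path_edges P). v \<in> e#}) + end_mult M v)"
  proof (induction M)
    case (add P M)
    have "int (size {#e \<in># path_edges P. v \<in> e#}) + end_count P v = 2 * of_bool (v \<in> set P)"
      by (rule path_parity) (use add in auto)
    then have "even (int (size {#e \<in># path_edges P. v \<in> e#}) + end_count P v)" by simp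
    moreover have "even (int (size {#e \<in># (\<Sum>P\<in>#M. path_edges P). v \<in> e#}) + end_mult M v)"
      using add by auto
    ultimately show ?case by simp
  qed simp
  moreover have "size {#e \<in># mset_set E. v \<in> e#} = deg E v"
    using assms by (simp add: deg_def filter_mset_mset_set)
  ultimately show ?thesis using assms by (simp add: decomposes_def)
qed

lemma decomp_nonneg: "decomp E n t \<Longrightarrow> 0 \<le> t v"
  unfolding decomp_def using end_mult_nonneg by auto

lemma decomp_parity: "decomp E n t \<Longrightarrow> even (t v) \<longleftrightarrow> even (deg E v)"
  unfolding decomp_def using decomposes_parity[of E _ v] by auto

lemma decomp_odd_pos: "decomp E n t \<Longrightarrow> odd (deg E v) \<Longrightarrow> 1 \<le> t v"
  using decomp_parity[of E n t v] decomp_nonneg[of E n t v]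
  by (cases "t v = 0") auto

lemma decomposes_extend:
  assumes "decomposes E (add_mset P M)" "finite E" "last P = b" "a \<notin> set P" "{a, b} \<notin> E"
  shows "decomposes (insert {a, b} E) (add_mset (P @ [a]) M)"
proof -
  have P: "P \<noteq> []" "distinct P" using assms by (auto simp: decomposes_def)
  have "path_edges (P @ [a]) = add_mset {a, b} (path_edges P)"
    using P assms by (simp add: path_edges_append insert_commute)
  then show ?thesis using assms P by (auto simp: decomposes_def)
qed

lemma end_mult_extend:
  assumes "P \<noteq> []" "last P = b" "a \<noteq> b"
  shows "end_mult (add_mset (P @ [a]) M)
    = (end_mult (add_mset P M))(a := end_mult (add_mset P M) a + 1, b := end_mult (add_mset P M) b - 1)"
  using assms by (auto simp: end_count_def fun_eq_iff)

lemma decomposes_flip: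
  assumes "decomposes E (add_mset (L @ a # R) M)" "finite E" "L \<noteq> []" "hd L = b" "last L = x"
    "{a, b} \<notin> E"
  shows "decomposes (insert {a, b} (E - {{a, x}})) (add_mset (rev L @ a # R) M)" "{a, x} \<in> E"
proof -
  have e1: "path_edges (L @ a # R) = path_edges L + path_edges (a # R) + {#{a, x}#}"
    using assms by (simp add: path_edges_append insert_commute)
  have e2: "path_edges (rev L @ a # R) = path_edges L + path_edges (a # R) + {#{a, b}#}"
    using assms by (simp add: path_edges_append insert_commute last_rev)
  have s: "path_edges L + path_edges (a # R) + {#{a, x}#} + (\<Sum>P\<in>#M. path_edges P) = mset_set E"
    using assms e1 by (simp add: decomposes_def)
  then have "{a, x} \<in># mset_set E" by (metis union_iff multi_member_last)
  then show "{a, x} \<in> E" using assms by simp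
  then have "mset_set E = add_mset {a, x} (mset_set (E - {{a, x}}))"
    using assms(2) by (metis mset_set.remove)
  then have "path_edges L + path_edges (a # R) + (\<Sum>P\<in>#M. path_edges P) = mset_set (E - {{a, x}})"
    using s by simp
  then have "(\<Sum>P\<in>#add_mset (rev L @ a # R) M. path_edges P) = mset_set (insert {a, b} (E - {{a, x}}))"
    using assms e2 by simp
  then show "decomposes (insert {a, b} (E - {{a, x}})) (add_mset (rev L @ a # R) M)"
    using assms by (auto simp: decomposes_def)
qed

lemma end_mult_flip:
  assumes "L \<noteq> []" "hd L = b" "last L = x" "x \<noteq> b"
  shows "end_mult (add_mset (rev L @ a # R) M)
    = (end_mult (add_mset (L @ a # R) M))(x := end_mult (add_mset (L @ a # R) M) x + 1,
        b := end_mult (add_mset (L @ a # R) M) b - 1)"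
  using assms by (auto simp: end_count_def fun_eq_iff hd_rev hd_append)

lemma decomposes_rev_path:
  assumes "decomposes E (add_mset P M)"
  shows "decomposes E (add_mset (rev P) M)" "end_mult (add_mset (rev P) M) = end_mult (add_mset P M)"
  using assms by (auto simp: decomposes_def fun_eq_iff)

text \<open>A path \<open>u \<dots> v a \<dots>\<close> can be replaced by \<open>v \<dots> u a \<dots>\<close>, which trades the edge \<open>av\<close> for \<open>au\<close>.\<close>

definition flip_step :: "'v list multiset \<Rightarrow> 'v \<Rightarrow> 'v \<Rightarrow> 'v \<Rightarrow> bool" where
  "flip_step M a u v \<longleftrightarrow> (\<exists>P\<in>#M. \<exists>L R. (P = L @ a # R \<or> rev P = L @ a # R)
      \<and> L \<noteq> [] \<and> hd L = u \<and> last L = v)"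

lemma flip_step_rev_path: "flip_step (add_mset (rev P) M) a u v = flip_step (add_mset P M) a u v"
  unfolding flip_step_def by auto

text \<open>Reversing \<open>L\<close> affects only the flip that leads to \<open>last L\<close>. A
  flip to another neighbour of \<open>a\<close> uses a different path or approaches \<open>a\<close>
  from the other side of this one, where nothing changes.\<close>

lemma flip_step_flip:
  assumes "decomposes E (add_mset (L @ a # R) M)" "flip_step (add_mset (L @ a # R) M) a u v" "L \<noteq> []"
    "v \<noteq> last L"
  shows "flip_step (add_mset (rev L @ a # R) M) a u v"
proof -
  obtain P L' R' where P: "P \<in># add_mset (L @ a # R) M"
    "P = L' @ a # R' \<or> rev P = L' @ a # R'" "L' \<noteq> []" "hd L' = u" "last L' = v"
    using assms(2) unfolding flip_step_def by blast
  show ?thesis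
  proof (cases "P = L @ a # R")
    case True
    have "distinct (L @ a # R)" using assms(1) by (auto simp: decomposes_def)
    then have d: "a \<notin> set L" "a \<notin> set R" by auto
    consider "L @ a # R = L' @ a # R'" | "rev R @ a # rev L = L' @ a # R'"
      using P(2) True by auto
    then show ?thesis
    proof cases
      case 1
      then have "L = L'" using append_Cons_eq_iff[OF d] by blast
      then show ?thesis using assms P by simp
    next
      case 2
      then have "rev R = L'" using append_Cons_eq_iff[of a "rev R" "rev L"] d by simp
      then have "rev (rev L @ a # R) = L' @ a # L" by simp
      then show ?thesis unfolding flip_step_def using P by (metis union_single_eq_member)
    qed
  next
    case False
    then have "P \<in># add_mset (rev L @ a # R) M" using P(1) by simp
    then show ?thesis unfolding flip_step_def using P(2-5)
      by (intro bexI[of _ P] exI[of _ L'] exI[of _ R']) auto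
  qed
qed

section \<open>Chains of flips and the augmentation of a missing edge\<close>

fun chain :: "('v \<Rightarrow> 'v \<Rightarrow> bool) \<Rightarrow> 'v list \<Rightarrow> bool" where
  "chain r (x # y # zs) = (r x y \<and> chain r (y # zs))"
| "chain r _ = True"

lemma chain_mono:
  "chain r (x # zs) \<Longrightarrow> (\<And>u v. v \<in> set zs \<Longrightarrow> r u v \<Longrightarrow> r' u v) \<Longrightarrow> chain r' (x # zs)"
proof (induction zs arbitrary: x)
  case (Cons y zs)
  have "r' x y" using Cons.prems by simp
  moreover have "chain r' (y # zs)" by (rule Cons.IH) (use Cons.prems in auto)
  ultimately show ?case by simp
qed simp

lemma chain_snoc: "xs \<noteq> [] \<Longrightarrow> chain r (xs @ [y]) = (chain r xs \<and> r (last xs) y)"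
proof (induction xs)
  case (Cons a xs)
  then show ?case by (cases xs) auto
qed simp

lemma chain_append1: "chain r (xs @ ys) \<Longrightarrow> chain r xs"
proof (induction xs)
  case (Cons a xs)
  then show ?case by (cases xs) auto
qed simp

text \<open>A chain that returns to a vertex is cut back to it. Distinctness is essential later:
  carrying out a flip may destroy the flips with the same target, so no target may recur.\<close>

lemma rtranclp_chain:
  assumes "r\<^sup>*\<^sup>* x y"
  shows "\<exists>zs. chain r (x # zs) \<and> distinct (x # zs) \<and> last (x # zs) = y"
  using assms
proof (induction)
  case base
  show ?case by (rule exI[of _ "[]"]) simp
next
  case (step y z)
  then obtain zs where zs: "chain r (x # zs)" "distinct (x # zs)" "last (x # zs) = y" by blast
  show ?case
  proof (cases "z \<in> set (x # zs)")
    case True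
    then obtain us vs where uv: "x # zs = us @ z # vs" by (meson split_list)
    have c: "chain r (us @ [z])" "distinct (us @ [z])"
      using zs uv by (auto intro: chain_append1[of r "us @ [z]" vs])
    show ?thesis
    proof (cases us)
      case Nil
      then show ?thesis using uv by (intro exI[of _ "[]"]) auto
    next
      case (Cons b us')
      then show ?thesis using c uv by (intro exI[of _ "us' @ [z]"]) auto
    qed
  next
    case False
    then show ?thesis using zs step
      by (intro exI[of _ "zs @ [z]"]) (use chain_snoc[of "x # zs" r z] in auto)
  qed
qed

text \<open>The first flip inserts \<open>ab\<close> at the expense of \<open>ax\<close>, so that
  \<open>ax\<close> is now the missing edge and the shorter chain from \<open>x\<close> takes over.
  At the end of the chain, \<open>Q\<close> can be prolonged to \<open>a\<close>. The end gained by
  each intermediate vertex is given up in the next step, so only \<open>a\<close> and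
  \<open>b\<close> change.\<close>

lemma chain_augment:
  assumes "decomposes E M" "finite E" "chain (flip_step M a) (b # zs)" "distinct (b # zs)" "a \<notin> set (b # zs)"
    "{a, b} \<notin> E" "Q \<in># M" "a \<notin> set Q" "hd Q = last (b # zs) \<or> last Q = last (b # zs)"
  shows "decomp (insert {a, b} E) (size M) ((end_mult M)(a := end_mult M a + 1, b := end_mult M b - 1))"
  using assms
proof (induction zs arbitrary: M E b)
  case Nil
  obtain M' where M: "M = add_mset Q M'" using Nil by (metis insert_DiffM)
  have Q: "Q \<noteq> []" using Nil by (auto simp: decomposes_def)
  obtain Q' where Q': "Q' = Q \<or> Q' = rev Q" "last Q' = b" "a \<notin> set Q'" "Q' \<noteq> []"
    using Nil Q by (metis last.simps last_rev set_rev rev_is_Nil_conv)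
  have d: "decomposes E (add_mset Q' M')" "end_mult (add_mset Q' M') = end_mult M"
    using decomposes_rev_path[of E Q M'] Nil(1) M Q' by auto
  have "decomposes (insert {a, b} E) (add_mset (Q' @ [a]) M')"
    by (rule decomposes_extend) (use d Q' Nil in auto)
  moreover have "end_mult (add_mset (Q' @ [a]) M') = (end_mult M)(a := end_mult M a + 1, b := end_mult M b - 1)"
    using end_mult_extend[of Q' b a M'] Q' d Nil by auto
  ultimately show ?case using Nil(2) M unfolding decomp_def
    by (intro conjI exI[of _ "add_mset (Q' @ [a]) M'"]) auto
next
  case (Cons x zs)
  have "flip_step M a b x" using Cons by simp
  then obtain P L R where P: "P \<in># M" "P = L @ a # R \<or> rev P = L @ a # R" "L \<noteq> []"
    "hd L = b" "last L = x" unfolding flip_step_def by blast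
  obtain M' where M: "M = add_mset P M'" using P by (metis insert_DiffM)
  define M1 where "M1 = add_mset (L @ a # R) M'"
  have d: "decomposes E M1" "end_mult M1 = end_mult M" "\<And>u v. flip_step M1 a u v = flip_step M a u v" "size M1 = size M"
    using decomposes_rev_path[of E P M'] Cons.prems(1) M P(2) flip_step_rev_path[of P M' a] unfolding M1_def by auto
  have Q: "Q \<in># M'" using M Cons.prems(7,8) P(2) by (auto dest: arg_cong[of "rev _" _ set])
  define M2 where "M2 = add_mset (rev L @ a # R) M'"
  define E2 where "E2 = insert {a, b} (E - {{a, x}})"
  have ne: "x \<noteq> b" "a \<noteq> b" "a \<noteq> x" using Cons.prems by auto
  have d2: "decomposes E2 M2" "{a, x} \<in> E" using decomposes_flip[OF d(1)[unfolded M1_def]] Cons.prems P unfolding E2_def M2_def by auto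
  have t2: "end_mult M2 = (end_mult M)(x := end_mult M x + 1, b := end_mult M b - 1)"
    using end_mult_flip[of L b x a R M'] P ne d unfolding M1_def M2_def by auto
  have ch: "chain (flip_step M2 a) (x # zs)"
  proof (rule chain_mono)
    show "chain (flip_step M a) (x # zs)" using Cons.prems by simp
    fix u v assume "v \<in> set zs" "flip_step M a u v"
    then show "flip_step M2 a u v" using flip_step_flip[of E L a R M' u v] d P Cons.prems unfolding M1_def M2_def by auto
  qed
  have "decomp (insert {a, x} E2) (size M2) ((end_mult M2)(a := end_mult M2 a + 1, x := end_mult M2 x - 1))"
  proof (rule Cons.IH)
    show "decomposes E2 M2" by fact
    show "finite E2" using Cons.prems by (simp add: E2_def)
    show "chain (flip_step M2 a) (x # zs)" by fact
    show "{a, x} \<notin> E2" using ne by (auto simp: E2_def doubleton_eq_iff)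
    show "Q \<in># M2" using Q by (simp add: M2_def)
  qed (use Cons.prems in auto)
  moreover have "insert {a, x} E2 = insert {a, b} E" using d2 by (auto simp: E2_def)
  moreover have "size M2 = size M" by (simp add: M2_def M)
  moreover have "(end_mult M2)(a := end_mult M2 a + 1, x := end_mult M2 x - 1) = (end_mult M)(a := end_mult M a + 1, b := end_mult M b - 1)"
    using t2 ne by (auto simp: fun_eq_iff)
  ultimately show ?case by (simp only:)
qed

text \<open>An end in \<open>R\<close> is matched with the path edge through which its side of the
  path enters \<open>a\<close>; by \<open>cl\<close> the other endpoint of that edge is in
  \<open>R\<close>. The two ends use different edges because \<open>a\<close> occurs only
  once.\<close>

lemma end_count_le_hops:
  assumes "distinct P" "P \<noteq> []" "a \<notin> R" "finite R"
    and cl: "\<And>L Q. P = L @ a # Q \<or> rev P = L @ a # Q \<Longrightarrow> L \<noteq> [] \<Longrightarrow> hd L \<in> R \<Longrightarrow> last L \<in> R"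
    and av: "a \<notin> set P \<Longrightarrow> hd P \<notin> R \<and> last P \<notin> R"
  shows "(\<Sum>u\<in>R. end_count P u) \<le> int (size {#e \<in># path_edges P. \<exists>v\<in>R. e = {a, v}#})"
proof -
  have s: "(\<Sum>u\<in>R. end_count P u) = of_bool (hd P \<in> R) + of_bool (last P \<in> R)"
    using assms(4) by (simp add: end_count_def sum.distrib of_bool_def sum.delta)
  show ?thesis
  proof (cases "a \<in> set P")
    case False
    then show ?thesis using av s by simp
  next
    case True
    then obtain L Q where P: "P = L @ a # Q" by (meson split_list)
    have h: "of_bool (hd P \<in> R) \<le> int (size {#e \<in># (if L = [] then {#} else {#{last L, a}#}). \<exists>v\<in>R. e = {a, v}#})"
      using cl[of L Q] P assms(3) by (auto simp: insert_commute)
    have l: "of_bool (last P \<in> R) \<le> int (size {#e \<in># (if Q = [] then {#} else {#{a, hd Q}#}). \<exists>v\<in>R. e = {a, v}#})"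
      using cl[of "rev Q" "rev L"] P assms(3) by (auto simp: hd_rev last_rev)
    have "path_edges P = path_edges L + (if L = [] then {#} else {#{last L, a}#}) + path_edges Q + (if Q = [] then {#} else {#{a, hd Q}#})"
      using P by (auto simp: path_edges_append path_edges_Cons)
    then show ?thesis using h l s by simp
  qed
qed

text \<open>Different path ends lead by a flip to different neighbours of \<open>a\<close>. So the set \<open>R\<close> reachable from
  \<open>B\<close> by flips would carry more path ends than it contains neighbours of \<open>a\<close>, unless some path
  avoiding \<open>a\<close> ends in \<open>R\<close>; that path can be prolonged to \<open>a\<close>.\<close>

lemma augment:
  assumes decomp: "decomp E n t" and B: "finite B" "a \<notin> B" "\<And>b. b \<in> B \<Longrightarrow> {a, b} \<notin> E"
    and zeros: "int (card {v. {a, v} \<in> E \<and> t v = 0}) < (\<Sum>b\<in>B. t b)"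
  shows "\<exists>b\<in>B. decomp (insert {a, b} E) n (t(a := t a + 1, b := t b - 1))"
proof -
  obtain M where M: "decomposes E M" "size M = n" "end_mult M = t" "finite E" using decomp by (auto simp: decomp_def)
  have paths: "\<And>P. P \<in># M \<Longrightarrow> P \<noteq> [] \<and> distinct P" using M by (auto simp: decomposes_def)
  define N where "N = {v. {a, v} \<in> E}"
  have "(\<lambda>v. {a, v}) ` N \<subseteq> E" by (auto simp: N_def)
  moreover have inj: "inj_on (\<lambda>v. {a, v}) X" for X by (auto simp: inj_on_def doubleton_eq_iff)
  ultimately have finN: "finite N" using M(4) by (metis finite_imageD finite_subset)
  have hopN: "v \<in> N \<and> v \<noteq> a" if "flip_step M a u v" for u v
  proof -
    obtain P L R where P: "P \<in># M" "P = L @ a # R \<or> rev P = L @ a # R" "L \<noteq> []" "last L = v"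
      using \<open>flip_step M a u v\<close> by (auto simp: flip_step_def)
    have "path_edges P = path_edges (L @ a # R)" using P(2) by (metis path_edges_rev)
    then have "{a, v} \<in># path_edges P" using P by (simp add: path_edges_append insert_commute)
    then have "{a, v} \<in># (\<Sum>P\<in>#M. path_edges P)" using P(1) by auto
    then have "{a, v} \<in># mset_set E" using M unfolding decomposes_def by metis
    then have "{a, v} \<in> E" using M by simp
    moreover have "distinct (L @ a # R)" using P(2) paths[OF P(1)] by (metis distinct_rev)
    ultimately show ?thesis using P by (auto simp: N_def)
  qed
  define R where "R = {u. \<exists>b\<in>B. (flip_step M a)\<^sup>*\<^sup>* b u}"
  have BR: "B \<subseteq> R" by (auto simp: R_def)
  have RBN: "u \<in> B \<or> (u \<in> N \<and> u \<noteq> a)" if u: "u \<in> R" for u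
  proof -
    obtain b where "(flip_step M a)\<^sup>*\<^sup>* b u" "b \<in> B" using u by (auto simp: R_def)
    then show ?thesis using B(2) by (induction rule: rtranclp_induct) (auto dest: hopN)
  qed
  have aR: "a \<notin> R" using RBN B by auto
  have finR: "finite R" by (rule finite_subset[of _ "B \<union> N"]) (use RBN B finN in auto)
  have "\<exists>u\<in>R. \<exists>Q\<in>#M. a \<notin> set Q \<and> (hd Q = u \<or> last Q = u)"
  proof (rule ccontr)
    assume none: "\<not> ?thesis"
    have "(\<Sum>u\<in>R. end_count P u) \<le> int (size {#e \<in># path_edges P. \<exists>v\<in>R. e = {a, v}#})" if P: "P \<in># M" for P
    proof (rule end_count_le_hops)
      fix L Q assume L: "P = L @ a # Q \<or> rev P = L @ a # Q" "L \<noteq> []" "hd L \<in> R"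
      then have "flip_step M a (hd L) (last L)" using P unfolding flip_step_def by blast
      then show "last L \<in> R" using L(3) unfolding R_def by (auto intro: rtranclp.rtrancl_into_rtrancl)
    qed (use paths[OF P] aR finR none P in auto)
    then have "(\<Sum>P\<in>#M. \<Sum>u\<in>R. end_count P u) \<le> (\<Sum>P\<in>#M. int (size {#e \<in># path_edges P. \<exists>v\<in>R. e = {a, v}#}))"
      by (rule sum_mset_mono)
    moreover have "(\<Sum>P\<in>#X. \<Sum>u\<in>R. end_count P u) = (\<Sum>u\<in>R. end_mult X u)" for X
      by (induction X) (auto simp: sum.distrib)
    moreover have "(\<Sum>P\<in>#X. int (size {#e \<in># path_edges P. \<exists>v\<in>R. e = {a, v}#}))
        = int (size {#e \<in># (\<Sum>P\<in>#X. path_edges P). \<exists>v\<in>R. e = {a, v}#})" for X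
      by (induction X) auto
    ultimately have "(\<Sum>u\<in>R. t u) \<le> int (size {#e \<in># mset_set E. \<exists>v\<in>R. e = {a, v}#})"
      using M by (simp add: decomposes_def)
    also have "\<dots> = int (card {e \<in> E. \<exists>v\<in>R. e = {a, v}})" using M(4) by (simp add: filter_mset_mset_set)
    also have "{e \<in> E. \<exists>v\<in>R. e = {a, v}} = (\<lambda>v. {a, v}) ` (R \<inter> N)" by (auto simp: N_def)
    also have "card \<dots> = card (R \<inter> N)" using inj by (rule card_image)
    finally have le: "(\<Sum>u\<in>R. t u) \<le> int (card (R \<inter> N))" .
    have "R = B \<union> (R \<inter> N)" "B \<inter> (R \<inter> N) = {}" using BR RBN B by (auto simp: N_def)
    then have "(\<Sum>u\<in>R. t u) = (\<Sum>u\<in>B. t u) + (\<Sum>u\<in>R \<inter> N. t u)"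
      using B finN by (metis finite_Int sum.union_disjoint)
    \<comment> \<open>Each vertex of \<open>R \<inter> N\<close> contributes at least one end unless
      it is one of the neighbours without ends, and there are too few of these to make up for the
      ends on \<open>B\<close>.\<close>
    moreover have "(\<Sum>u\<in>R \<inter> N. t u) \<ge> (\<Sum>u\<in>R \<inter> N. 1 - of_bool (t u = 0))"
      by (rule sum_mono) (use decomp_nonneg[OF decomp] in \<open>smt (verit) of_bool_eq\<close>)
    moreover have "(\<Sum>u\<in>R \<inter> N. 1 - of_bool (t u = 0)) = int (card (R \<inter> N)) - int (card {u \<in> R \<inter> N. t u = 0})"
      using finN by (simp add: sum_subtractf Int_def)
    moreover have "card {u \<in> R \<inter> N. t u = 0} \<le> card {v. {a, v} \<in> E \<and> t v = 0}"
      by (rule card_mono) (use finN in \<open>auto simp: N_def\<close>)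
    ultimately show False using le zeros by linarith
  qed
  then obtain u Q where u: "u \<in> R" "Q \<in># M" "a \<notin> set Q" "hd Q = u \<or> last Q = u" by blast
  then obtain b where b: "b \<in> B" "(flip_step M a)\<^sup>*\<^sup>* b u" by (auto simp: R_def)
  obtain zs where zs: "chain (flip_step M a) (b # zs)" "distinct (b # zs)" "last (b # zs) = u"
    using rtranclp_chain[OF b(2)] by blast
  have "z \<noteq> a" if "z \<in> set zs" for z
  proof -
    have "chain (flip_step M a) (c # ys) \<Longrightarrow> z \<in> set ys \<Longrightarrow> \<exists>w. flip_step M a w z" for c ys
      by (induction ys arbitrary: c) auto
    then show ?thesis using zs that hopN by blast
  qed
  then have "a \<notin> set (b # zs)" using b B by auto
  then have "decomp (insert {a, b} E) (size M) ((end_mult M)(a := end_mult M a + 1, b := end_mult M b - 1))"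
    using chain_augment[of E M a b zs Q] M zs u b B by auto
  then show ?thesis using M b by auto
qed

lemma augment_edge:
  assumes "decomp E n t" "a \<noteq> b" "{a, b} \<notin> E" "int (card {v. {a, v} \<in> E \<and> t v = 0}) < t b"
  shows "decomp (insert {a, b} E) n (t(a := t a + 1, b := t b - 1))"
  using augment[of E n t "{b}" a] assms by auto

lemma augment_edge_no_zeros:
  assumes "decomp E n t" "a \<noteq> b" "{a, b} \<notin> E" "1 \<le> t b" "\<And>v. {a, v} \<in> E \<Longrightarrow> 1 \<le> t v"
  shows "decomp (insert {a, b} E) n (t(a := t a + 1, b := t b - 1))"
proof -
  have "{v. {a, v} \<in> E \<and> t v = 0} = {}" using assms(5) by force
  then have "int (card {v. {a, v} \<in> E \<and> t v = 0}) = 0" by (simp only: card.empty)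
  then show ?thesis using assms(4) by (intro augment_edge[OF assms(1-3)]) linarith
qed

section \<open>Inserting stars and matchings\<close>

definition star :: "'v \<Rightarrow> 'v set \<Rightarrow> 'v set set" where
  "star p S = (\<lambda>s. {p, s}) ` S"

lemma star_insert [simp]: "star p (insert s S) = insert {p, s} (star p S)"
  and star_empty [simp]: "star p {} = {}"
  and star_Un: "star p (S \<union> S') = star p S \<union> star p S'"
  and in_star: "e \<in> star p S \<longleftrightarrow> (\<exists>s\<in>S. e = {p, s})"
  by (auto simp: star_def)

text \<open>Only vertices of \<open>W\<close> can lose all their path ends, so augmentation from \<open>S - W\<close> succeeds while
  \<open>W\<close> is smaller than \<open>S - W\<close>.\<close>

lemma star_half:
  assumes decomp: "decomp E n t" and S: "finite S" "p \<notin> S" "\<And>s. s \<in> S \<Longrightarrow> {p, s} \<notin> E \<and> 1 \<le> t s"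
    and N: "\<And>v. {p, v} \<in> E \<Longrightarrow> 1 \<le> t v" and y: "y \<in> S"
  obtains W where "W \<subseteq> S" "y \<in> W" "card W = (card S + 1) div 2"
    "decomp (E \<union> star p W) n (\<lambda>v. t v + (if v = p then int (card W) else 0) - of_bool (v \<in> W))"
proof -
  \<comment> \<open>The first edge meets no neighbour without ends, so \<open>y\<close> can be
    prescribed. When \<open>k\<close> edges are present there are at most \<open>k\<close> zeros but
    \<open>card S - k\<close> candidates, and one more edge is possible as long as
    \<open>2 * k < card S\<close>.\<close>
  have "\<exists>W\<subseteq>S. y \<in> W \<and> card W = k \<and>
      decomp (E \<union> star p W) n (\<lambda>v. t v + (if v = p then int (card W) else 0) - of_bool (v \<in> W))"
    if "1 \<le> k" "2 * k \<le> card S + 1" for k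
    using that
  proof (induction k rule: nat_induct_at_least)
    case base
    have "decomp (insert {p, y} E) n (t(p := t p + 1, y := t y - 1))"
      by (rule augment_edge_no_zeros) (use assms in auto)
    moreover have "t(p := t p + 1, y := t y - 1)
        = (\<lambda>v. t v + (if v = p then int (card {y}) else 0) - of_bool (v \<in> {y}))"
      using y S by (auto simp: fun_eq_iff)
    ultimately show ?case using y by (intro exI[of _ "{y}"]) auto
  next
    case (Suc k)
    define t' where "t' W = (\<lambda>v. t v + (if v = p then int (card W) else 0) - of_bool (v \<in> W))" for W
    obtain W where W: "W \<subseteq> S" "y \<in> W" "card W = k" "decomp (E \<union> star p W) n (t' W)"
      using Suc unfolding t'_def by auto
    have finW: "finite W" using W S finite_subset by blast
    have "{v. {p, v} \<in> E \<union> star p W \<and> t' W v = 0} \<subseteq> W"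
    proof
      fix v assume "v \<in> {v. {p, v} \<in> E \<union> star p W \<and> t' W v = 0}"
      then have v: "{p, v} \<in> E \<or> v \<in> W" "t' W v = 0" by (auto simp: in_star doubleton_eq_iff)
      show "v \<in> W"
      proof (rule ccontr)
        assume "v \<notin> W"
        then have "1 \<le> t v" "t' W v = t v + (if v = p then int (card W) else 0)"
          using v N by (auto simp: t'_def)
        then show False using v(2) by (cases "v = p") auto
      qed
    qed
    then have "card {v. {p, v} \<in> E \<union> star p W \<and> t' W v = 0} \<le> k" using card_mono finW W(3) by metis
    moreover have "int (card (S - W)) \<le> (\<Sum>b\<in>S - W. t' W b)"
      using sum_bounded_below[of "S - W" 1 "t' W"] S by (force simp: t'_def)
    moreover have "k < card (S - W)" using W finW Suc.prems by (simp add: card_Diff_subset)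
    ultimately have "int (card {v. {p, v} \<in> E \<union> star p W \<and> t' W v = 0}) < (\<Sum>b\<in>S - W. t' W b)"
      by linarith
    then obtain b where b: "b \<in> S - W" "decomp (insert {p, b} (E \<union> star p W)) n ((t' W)(p := t' W p + 1, b := t' W b - 1))"
      using augment[OF W(4), of "S - W" p] S W by (auto simp: in_star doubleton_eq_iff)
    have "(t' W)(p := t' W p + 1, b := t' W b - 1) = t' (insert b W)"
      using b S finW W by (auto simp: t'_def fun_eq_iff)
    then show ?case using b W finW
      by (intro exI[of _ "insert b W"]) (auto simp: t'_def)
  qed
  from this[of "(card S + 1) div 2"] show ?thesis
    using that y S card_gt_0_iff[of S] by fastforce
qed

text \<open>Here the augmentation takes place at the outer vertex \<open>v\<close>, and an end moves
  from \<open>p\<close> to \<open>v\<close>. No vertex of \<open>R\<close> loses an end, so the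
  number of zeros around the remaining ones stays at most \<open>c\<close>. Each edge costs one end
  at \<open>p\<close>, and even the last needs more than \<open>c\<close> of them there, whence
  \<open>card R + c\<close>.\<close>

lemma add_star_outer:
  assumes "finite R" "decomp E n t" "p \<notin> R" "\<And>v. v \<in> R \<Longrightarrow> {p, v} \<notin> E \<and> 1 \<le> t v"
    and "\<And>v. v \<in> R \<Longrightarrow> \<exists>Z. finite Z \<and> card Z \<le> c \<and> (\<forall>u. {v, u} \<in> E \<longrightarrow> u \<notin> Z \<longrightarrow> 1 \<le> t u)"
    and "t p \<ge> int (card R + c)"
  shows "decomp (E \<union> star p R) n (\<lambda>v. t v - (if v = p then int (card R) else 0) + of_bool (v \<in> R))"
  using assms
proof (induction R arbitrary: E t rule: finite_induct)
  case (insert v R)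
  obtain Z where Z: "finite Z" "card Z \<le> c" "\<forall>u. {v, u} \<in> E \<longrightarrow> u \<notin> Z \<longrightarrow> 1 \<le> t u"
    using insert.prems(4)[of v] by blast
  have "{u. {v, u} \<in> E \<and> t u = 0} \<subseteq> Z" using Z(3) by force
  then have "card {u. {v, u} \<in> E \<and> t u = 0} \<le> c" using Z card_mono le_trans by metis
  then have "int (card {u. {v, u} \<in> E \<and> t u = 0}) < t p" using insert by simp
  then have s: "decomp (insert {v, p} E) n (t(v := t v + 1, p := t p - 1))"
    by (intro augment_edge) (use insert.prems(2) insert.prems(3)[of v] insert.prems(1) in \<open>auto simp: insert_commute[of p v]\<close>)
  have "decomp (insert {v, p} E \<union> star p R) n
     (\<lambda>u. (t(v := t v + 1, p := t p - 1)) u - (if u = p then int (card R) else 0) + of_bool (u \<in> R))"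
  proof (rule insert.IH)
    show "decomp (insert {v, p} E) n (t(v := t v + 1, p := t p - 1))" by (fact s)
    fix w assume w: "w \<in> R"
    then show "{p, w} \<notin> insert {v, p} E \<and> 1 \<le> (t(v := t v + 1, p := t p - 1)) w"
      using insert by (auto simp: doubleton_eq_iff)
    obtain Z where Z: "finite Z" "card Z \<le> c" "\<forall>u. {w, u} \<in> E \<longrightarrow> u \<notin> Z \<longrightarrow> 1 \<le> t u"
      using insert.prems(4)[of w] w by blast
    have "1 \<le> (t(v := t v + 1, p := t p - 1)) u" if "{w, u} \<in> insert {v, p} E" "u \<notin> Z" for u
    proof -
      have "w \<noteq> v" "w \<noteq> p" using w insert by auto
      then have "{w, u} \<in> E" using that(1) by (auto simp: doubleton_eq_iff)
      moreover have "u \<noteq> p" using insert.prems(3)[of w] w \<open>{w, u} \<in> E\<close> by (auto simp: insert_commute)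
      ultimately show ?thesis using Z(3) that(2) by auto
    qed
    then show "\<exists>Z. finite Z \<and> card Z \<le> c \<and> (\<forall>u. {w, u} \<in> insert {v, p} E \<longrightarrow> u \<notin> Z \<longrightarrow>
        1 \<le> (t(v := t v + 1, p := t p - 1)) u)"
      using Z by blast
  qed (use insert in auto)
  moreover have "insert {v, p} E \<union> star p R = E \<union> star p (insert v R)" by (auto simp: insert_commute)
  moreover have "(\<lambda>u. (t(v := t v + 1, p := t p - 1)) u - (if u = p then int (card R) else 0) + of_bool (u \<in> R))
      = (\<lambda>u. t u - (if u = p then int (card (insert v R)) else 0) + of_bool (u \<in> insert v R))"
    using insert by (auto simp: fun_eq_iff)
  ultimately show ?case by simp
qed (simp cong: if_cong)

text \<open>Augmenting at \<open>x i\<close> may leave \<open>y i\<close> without ends, but no other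
  vertex \<open>x j\<close> has \<open>y i\<close> as a neighbour, so these zeros never disturb a
  later insertion.\<close>

lemma add_pairs:
  assumes "finite I" "decomp E n t" "inj_on x I" "inj_on y I" "x ` I \<inter> y ` I = {}"
    and "\<And>i. i \<in> I \<Longrightarrow> {x i, y i} \<notin> E \<and> 1 \<le> t (y i)"
    and "\<And>i v. i \<in> I \<Longrightarrow> {x i, v} \<in> E \<Longrightarrow> 1 \<le> t v \<and> v \<notin> y ` I"
  shows "decomp (E \<union> (\<lambda>i. {x i, y i}) ` I) n (\<lambda>v. t v + of_bool (v \<in> x ` I) - of_bool (v \<in> y ` I))"
  using assms
proof (induction I arbitrary: E t rule: finite_induct)
  case (insert i I)
  have ne: "x i \<noteq> y j" "x j \<noteq> y i" "x j \<noteq> y k" "x i \<noteq> y i" if "j \<in> I" "k \<in> I" for j k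
    using that insert.prems(4) by (metis disjoint_iff imageI insertCI)+
  have ne0: "x i \<noteq> y i" using insert.prems(4) by auto
  have ne': "x i \<noteq> x j" "y i \<noteq> y j" if "j \<in> I" for j using that insert.prems(2,3) insert.hyps
    by (auto simp: inj_on_def)
  have ni: "x i \<notin> x ` I" "y i \<notin> y ` I" "x i \<notin> y ` I" "y i \<notin> x ` I"
    using ne' insert.prems(4) by auto
  have s: "decomp (insert {x i, y i} E) n (t(x i := t (x i) + 1, y i := t (y i) - 1))"
    by (intro augment_edge_no_zeros) (use insert.prems ne0 in auto)
  have "decomp (insert {x i, y i} E \<union> (\<lambda>i. {x i, y i}) ` I) n
    (\<lambda>v. (t(x i := t (x i) + 1, y i := t (y i) - 1)) v + of_bool (v \<in> x ` I) - of_bool (v \<in> y ` I))"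
  proof (rule insert.IH)
    show "decomp (insert {x i, y i} E) n (t(x i := t (x i) + 1, y i := t (y i) - 1))" by (fact s)
    show "inj_on x I" "inj_on y I" "x ` I \<inter> y ` I = {}" using insert.prems by auto
    fix j assume j: "j \<in> I"
    show "{x j, y j} \<notin> insert {x i, y i} E \<and> 1 \<le> (t(x i := t (x i) + 1, y i := t (y i) - 1)) (y j)"
      using j insert.prems ne[of j j] ne'[of j] ne0 by (auto simp: doubleton_eq_iff)
    fix v assume v: "{x j, v} \<in> insert {x i, y i} E"
    then have v': "{x j, v} \<in> E" using ne[of j j] ne'[of j] j by (auto simp: doubleton_eq_iff)
    then have "1 \<le> t v" "v \<notin> y ` insert i I" using insert.prems(6)[of j v] j by auto
    then show "1 \<le> (t(x i := t (x i) + 1, y i := t (y i) - 1)) v \<and> v \<notin> y ` I" by auto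
  qed
  moreover have "insert {x i, y i} E \<union> (\<lambda>i. {x i, y i}) ` I = E \<union> (\<lambda>i. {x i, y i}) ` insert i I" by auto
  moreover have "(\<lambda>v. (t(x i := t (x i) + 1, y i := t (y i) - 1)) v + of_bool (v \<in> x ` I) - of_bool (v \<in> y ` I))
    = (\<lambda>v. t v + of_bool (v \<in> x ` insert i I) - of_bool (v \<in> y ` insert i I))"
    using ni ne0 by (auto simp: fun_eq_iff of_bool_def)
  ultimately show ?case by simp
qed simp

section \<open>Graphs without edges between vertices of even degree\<close>

definition graph_on :: "'v set \<Rightarrow> 'v set set \<Rightarrow> bool" where
  "graph_on V E \<longleftrightarrow> finite V \<and> (\<forall>e\<in>E. e \<subseteq> V \<and> card e = 2)"

definition half_decomposable :: "'v set \<Rightarrow> 'v set set \<Rightarrow> bool" where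
  "half_decomposable V E \<longleftrightarrow> (\<exists>n t. n \<le> card V div 2 \<and> decomp E n t)"

lemma graph_on_finite: "graph_on V E \<Longrightarrow> finite E"
  unfolding graph_on_def by (meson finite_Pow_iff finite_subset PowI subsetI)

lemma graph_on_subset: "graph_on V E \<Longrightarrow> E' \<subseteq> E \<Longrightarrow> graph_on V E'"
  unfolding graph_on_def by blast

lemma graph_on_edge: "graph_on V E \<Longrightarrow> {u, v} \<in> E \<Longrightarrow> u \<noteq> v \<and> u \<in> V \<and> v \<in> V"
  using card_2_iff unfolding graph_on_def by (cases "u = v") fastforce+

lemma graph_on_edgeE:
  assumes "graph_on V E" "e \<in> E" "v \<in> e"
  obtains u where "e = {v, u}" "u \<noteq> v"
proof -
  have "card e = 2" using assms by (auto simp: graph_on_def)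
  then obtain x y where "e = {x, y}" "x \<noteq> y" by (auto simp: card_2_iff)
  then show ?thesis using that assms(3) by (metis insert_commute insert_iff singletonD)
qed

section \<open>Degree counting\<close>

lemma deg_Diff: "finite E \<Longrightarrow> M \<subseteq> E \<Longrightarrow> deg E v = deg (E - M) v + deg M v"
  unfolding deg_def
  by (subst card_Un_disjoint[symmetric]) (auto intro: finite_subset arg_cong[where f = card])

lemma deg_Un: "finite E \<Longrightarrow> finite E' \<Longrightarrow> E \<inter> E' = {} \<Longrightarrow> deg (E \<union> E') v = deg E v + deg E' v"
  unfolding deg_def
  by (subst card_Un_disjoint[symmetric]) (auto intro: arg_cong[where f = card])

lemma even_dg_Diff:
  "finite E \<Longrightarrow> M \<subseteq> E \<Longrightarrow> even (deg (E - M) v) \<longleftrightarrow> (even (deg E v) \<longleftrightarrow> even (deg M v))"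
  using deg_Diff[of E M v] by auto

lemma deg_empty [simp]: "deg {} v = 0"
  by (simp add: deg_def)

lemma deg_insert: "finite E \<Longrightarrow> e \<notin> E \<Longrightarrow> deg (insert e E) v = deg E v + of_bool (v \<in> e)"
  using deg_Un[of "{e}" E v] by (simp add: deg_def Collect_conv_if)

lemma deg_zero: "finite E \<Longrightarrow> deg E v = 0 \<longleftrightarrow> (\<forall>e\<in>E. v \<notin> e)"
  by (auto simp: deg_def)

lemma deg_pos:
  assumes "graph_on V E" "{v, u} \<in> E"
  shows "0 < deg E v" "0 < deg E u"
  using assms deg_zero[OF graph_on_finite[OF assms(1)]] by (metis insertCI not_gr_zero)+

lemma deg_posE:
  assumes "graph_on V E" "0 < deg E v"
  obtains u where "{v, u} \<in> E"
proof -
  have "\<exists>e\<in>E. v \<in> e" using deg_zero[of E v] graph_on_finite[OF assms(1)] assms(2) by auto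
  then show ?thesis using that graph_on_edgeE[OF assms(1)] by metis
qed

lemma finite_star [simp]: "finite S \<Longrightarrow> finite (star p S)"
  by (simp add: star_def)

lemma star_split: "W \<subseteq> S \<Longrightarrow> star p W \<union> star p (S - W) = star p S"
  by (metis star_Un Un_Diff_cancel sup.absorb2)

lemma deg_star: "finite S \<Longrightarrow> p \<notin> S \<Longrightarrow> deg (star p S) v = (if v = p then card S else of_bool (v \<in> S))"
proof (induction S rule: finite_induct)
  case (insert s S)
  have "{p, s} \<notin> star p S" using insert by (auto simp: in_star doubleton_eq_iff)
  then show ?case using insert by (auto simp: deg_insert)
qed simp

lemma deg_card_nbrs:
  assumes "graph_on V E"
  shows "deg E v = card {u. {v, u} \<in> E}"
proof -
  have "{e \<in> E. v \<in> e} = (\<lambda>u. {v, u}) ` {u. {v, u} \<in> E}"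
    using graph_on_edgeE[OF assms] by (auto simp: image_iff) metis
  then show ?thesis unfolding deg_def
    by (metis (no_types, lifting) card_image doubleton_eq_iff inj_onI)
qed

lemma finite_nbrs: "graph_on V E \<Longrightarrow> finite {u. {v, u} \<in> E}"
  by (rule finite_subset[of _ V]) (auto simp: graph_on_def)

lemma handshake:
  assumes "graph_on V E"
  shows "(\<Sum>v\<in>V. deg E v) = 2 * card E"
proof -
  have fin: "finite V" "finite E" using assms graph_on_finite by (auto simp: graph_on_def)
  have "(\<Sum>v\<in>V. deg E v) = (\<Sum>v\<in>V. \<Sum>e\<in>E. of_bool (v \<in> e))"
    using fin by (simp add: deg_def Int_def)
  also have "\<dots> = (\<Sum>e\<in>E. \<Sum>v\<in>V. of_bool (v \<in> e))" by (rule sum.swap)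
  also have "\<dots> = (\<Sum>e\<in>E. 2)"
  proof (rule sum.cong[OF refl])
    fix e assume "e \<in> E"
    then have "V \<inter> e = e" "card e = 2" using assms by (auto simp: graph_on_def)
    then show "(\<Sum>v\<in>V. of_bool (v \<in> e)) = (2::nat)" using fin by (simp add: Int_def)
  qed
  finally show ?thesis by simp
qed

lemma even_card_odd:
  assumes "graph_on V E"
  shows "even (card {v\<in>V. odd (deg E v)})"
  using handshake[OF assms] even_sum_iff[of V "deg E"] assms by (auto simp: graph_on_def)

lemma decomp_add_path:
  assumes "decomp E n t" "x \<noteq> y" "{x, y} \<notin> E"
  shows "\<exists>t'. decomp (insert {x, y} E) (Suc n) t'"
proof -
  obtain M where M: "decomposes E M" "size M = n" "finite E" using assms(1) by (auto simp: decomp_def)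
  have "decomposes (insert {x, y} E) (add_mset [x, y] M)" using M assms by (auto simp: decomposes_def)
  then show ?thesis using M unfolding decomp_def by auto
qed

lemma decomp_edges:
  assumes "finite E" "\<forall>e\<in>E. card e = 2"
  shows "\<exists>t. decomp E (card E) t"
  using assms
proof (induction E rule: finite_induct)
  case empty
  show ?case unfolding decomp_def decomposes_def by auto
next
  case (insert e E)
  then obtain x y where "e = {x, y}" "x \<noteq> y" by (auto simp: card_2_iff)
  then show ?case using insert decomp_add_path[of E "card E" _ x y] by auto
qed

text \<open>The only edge at a leaf is the first or last edge of its path and can be cut off. The
  path \<open>[y, x]\<close> shrinks to the one-vertex path \<open>[x]\<close>, which keeps the
  number of paths constant.\<close>

lemma decomp_remove_leaf:
  assumes decomp: "decomp E n t" and e: "{y, x} \<in> E" "x \<noteq> y" and leaf: "\<And>e. e \<in> E \<Longrightarrow> y \<in> e \<Longrightarrow> e = {y, x}"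
  shows "decomp (E - {{y, x}}) n (t(x := t x + 1, y := t y - 1))"
proof -
  obtain M where M: "decomposes E M" "size M = n" "end_mult M = t" "finite E" using decomp by (auto simp: decomp_def)
  have "{y, x} \<in># (\<Sum>P\<in>#M. path_edges P)" using M e by (simp add: decomposes_def)
  then obtain P where P: "P \<in># M" "{y, x} \<in># path_edges P" by auto
  then obtain M' where M': "M = add_mset P M'" by (metis insert_DiffM)
  have sub: "path_edges P \<subseteq># mset_set E" using M(1) M' unfolding decomposes_def
    by (metis image_mset_add_mset mset_subset_eq_add_left sum_mset.add_mset)
  have in_E: "e \<in> E" if "e \<in># path_edges P" for e using mset_subset_eqD[OF sub that] M(4) by simp
  have d: "distinct P" "P \<noteq> []" using M(1) M' by (auto simp: decomposes_def)
  have "y \<in> set P" using path_edges_subset[OF P(2)] by auto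
  then obtain L R where LR: "P = L @ y # R" by (meson split_list)
  have L: "last L = x" if "L \<noteq> []"
  proof -
    have "{y, last L} \<in># path_edges P" using that LR by (simp add: path_edges_append insert_commute)
    then show ?thesis using leaf[of "{y, last L}"] in_E by (auto simp: doubleton_eq_iff)
  qed
  have R: "hd R = x" if "R \<noteq> []"
  proof -
    have "{y, hd R} \<in># path_edges P" using that LR
      by (cases "L = []") (simp_all add: path_edges_append path_edges_Cons)
    then show ?thesis using leaf[of "{y, hd R}"] in_E by (auto simp: doubleton_eq_iff)
  qed
  have "L = [] \<or> R = []" using L R d LR by (cases R) (auto, metis last_in_set)
  moreover have "L \<noteq> [] \<or> R \<noteq> []" using P(2) LR by auto
  ultimately obtain R' where R': "R' \<noteq> []" "hd R' = x" "y # R' = P \<or> y # R' = rev P"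
    using L R LR by (cases "L = []") (auto simp: hd_rev intro: that[of "rev L"])
  have d1: "decomposes E (add_mset (y # R') M')" "end_mult (add_mset (y # R') M') = t"
    using R'(3) decomposes_rev_path[of E P M'] M M' by auto
  have "add_mset {y, x} (path_edges R' + (\<Sum>P\<in>#M'. path_edges P)) = mset_set E"
    using d1 R' by (simp add: decomposes_def path_edges_Cons)
  also have "\<dots> = add_mset {y, x} (mset_set (E - {{y, x}}))" using e M(4) by (metis mset_set.remove)
  finally have "path_edges R' + (\<Sum>P\<in>#M'. path_edges P) = mset_set (E - {{y, x}})" by simp
  then have "decomposes (E - {{y, x}}) (add_mset R' M')" using d1(1) R' by (auto simp: decomposes_def)
  moreover have "end_mult (add_mset R' M') = t(x := t x + 1, y := t y - 1)"
    unfolding d1(2)[symmetric] using R' e by (auto simp: fun_eq_iff end_count_def)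
  ultimately show ?thesis unfolding decomp_def using M M' by (intro conjI exI[of _ "add_mset R' M'"]) auto
qed

text \<open>If all degrees are odd, an edge \<open>yx\<close> is detached from \<open>y\<close> and attached to a new leaf; this does not
  change the bound, since the number of vertices was even. The fresh vertex is the reason for the
  infinite vertex type.\<close>

lemma lovasz_infinite:
  fixes V :: "'v set"
  assumes inf: "infinite (UNIV :: 'v set)"
    and "graph_on V E" "\<And>u v. {u, v} \<in> E \<Longrightarrow> odd (deg E u) \<or> odd (deg E v)"
  shows "half_decomposable V E"
  using assms(2,3)
proof (induction "card E" arbitrary: V E rule: less_induct)
  case less
  note sgE = less.prems(1) and ind = less.prems(2)
  note finE = graph_on_finite[OF sgE]
  show ?case
  proof (cases "\<exists>v. even (deg E v) \<and> 0 < deg E v")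
    case True
    then obtain v p where v: "even (deg E v)" "{p, v} \<in> E"
      using deg_posE[OF sgE] by (metis insert_commute)
    have p: "odd (deg E p)" using ind[OF v(2)] v by auto
    \<comment> \<open>Taking all even neighbours at once makes the induction work even if
      \<open>p\<close> turns even: its remaining neighbours were odd and stay odd.\<close>
    define S where "S = {s. {p, s} \<in> E \<and> even (deg E s)}"
    define E' where "E' = E - star p S"
    have S: "finite S" "p \<notin> S" "v \<in> S" "star p S \<subseteq> E"
      using rev_finite_subset[OF finite_nbrs[OF sgE, of p], of S] v graph_on_edge[OF sgE, of p p]
      by (auto simp: S_def in_star)
    have par: "even (deg E' u) \<longleftrightarrow> (even (deg E u) \<longleftrightarrow> even (if u = p then card S else of_bool (u \<in> S)))" for u
      unfolding E'_def even_dg_Diff[OF finE S(4)] deg_star[OF S(1,2)] ..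
    have par': "even (deg E' u) \<longleftrightarrow> even (deg E u) \<and> u \<notin> S" if "u \<noteq> p" for u
      using par[of u] that by (auto simp: S_def)
    have sub: "E' \<subseteq> E" by (auto simp: E'_def)
    have nbp: "u \<notin> S \<and> u \<noteq> p \<and> odd (deg E u)" if "{p, u} \<in> E'" for u
      using that graph_on_edge[OF sgE, of p u] by (auto simp: E'_def S_def in_star)
    have "{p, v} \<in> E - E'" using v(2) S(3) by (auto simp: E'_def in_star)
    then have "card E' < card E" using sub finE by (intro psubset_card_mono) auto
    moreover have "odd (deg E' u) \<or> odd (deg E' w)" if "{u, w} \<in> E'" for u w
    proof -
      have uw: "{u, w} \<in> E" "u \<noteq> w" using that sub graph_on_edge[OF sgE] by auto
      consider "u = p" | "w = p" | "u \<noteq> p" "w \<noteq> p" by blast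
      then show ?thesis
      proof cases
        case 1 then show ?thesis using nbp[of w] that par'[of w] by auto
      next
        case 2 then show ?thesis using nbp[of u] that par'[of u] by (auto simp: insert_commute)
      next
        case 3 then show ?thesis using ind[OF uw(1)] par' by auto
      qed
    qed
    ultimately have "half_decomposable V E'" using less.hyps[of E' V] graph_on_subset[OF sgE sub] by blast
    then obtain n t where nt: "n \<le> card V div 2" "decomp E' n t" by (auto simp: half_decomposable_def)
    have tS: "1 \<le> t s" if "s \<in> S" for s using decomp_odd_pos[OF nt(2)] that par'[of s] S(2) by auto
    have tN: "1 \<le> t u" if "u \<noteq> p" "odd (deg E u)" for u
      using decomp_odd_pos[OF nt(2)] that par'[of u] by auto
    have h1: "{p, s} \<notin> E' \<and> 1 \<le> t s" if "s \<in> S" for s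
      using tS[OF that] that by (auto simp: E'_def in_star)
    have h2: "1 \<le> t u" if "{p, u} \<in> E'" for u using nbp[OF that] tN by blast
    obtain W where W: "W \<subseteq> S" "v \<in> W" "card W = (card S + 1) div 2"
      and stW: "decomp (E' \<union> star p W) n (\<lambda>v. t v + (if v = p then int (card W) else 0) - of_bool (v \<in> W))"
      by (rule star_half[OF nt(2) S(1,2) h1 h2 S(3)])
    have finW: "finite W" using W S finite_subset by blast
    have "decomp ((E' \<union> star p W) \<union> star p (S - W)) n
      (\<lambda>v. (t v + (if v = p then int (card W) else 0) - of_bool (v \<in> W))
         - (if v = p then int (card (S - W)) else 0) + of_bool (v \<in> S - W))"
    \<comment> \<open>A vertex of \<open>S - W\<close> is even, so by \<open>ind\<close> it has only
      odd neighbours. The vertices of \<open>W\<close> are even, hence no zero is met and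
      \<open>c = 0\<close> suffices.\<close>
    proof (rule add_star_outer[OF _ stW, where c = 0])
      fix s assume s: "s \<in> S - W"
      show "{p, s} \<notin> E' \<union> star p W \<and> 1 \<le> t s + (if s = p then int (card W) else 0) - of_bool (s \<in> W)"
        using s tS S by (auto simp: E'_def in_star doubleton_eq_iff)
      have "1 \<le> t u + (if u = p then int (card W) else 0) - of_bool (u \<in> W)" if u: "{s, u} \<in> E' \<union> star p W" for u
      proof -
        have "s \<notin> W" "s \<noteq> p" using s S by auto
        then have "{s, u} \<in> E'" using u by (auto simp: in_star doubleton_eq_iff)
        moreover have "u \<noteq> p" using s calculation by (auto simp: E'_def in_star insert_commute)
        moreover have "odd (deg E u)" using ind[of s u] s calculation sub by (auto simp: S_def)
        ultimately show ?thesis using tN[of u] W by (auto simp: S_def)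
      qed
      then show "\<exists>Z. finite Z \<and> card Z \<le> 0 \<and> (\<forall>u. {s, u} \<in> E' \<union> star p W \<longrightarrow> u \<notin> Z \<longrightarrow>
          1 \<le> t u + (if u = p then int (card W) else 0) - of_bool (u \<in> W))"
        by (intro exI[of _ "{}"]) auto
    next
      have "card (S - W) = card S - card W" using W finW by (simp add: card_Diff_subset)
      then have "card (S - W) \<le> card W" using W(3) by linarith
      moreover have "p \<notin> W" using S W by auto
      ultimately show "int (card (S - W) + 0) \<le> t p + (if p = p then int (card W) else 0) - of_bool (p \<in> W)"
        using decomp_nonneg[OF nt(2), of p] by simp
    qed (use S in auto)
    moreover have "(E' \<union> star p W) \<union> star p (S - W) = E"
      using star_split[OF W(1), of p] S(4) unfolding E'_def by blast
    ultimately show ?thesis using nt(1) unfolding half_decomposable_def by auto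
  next
    case False
    then have odd: "odd (deg E v) \<or> deg E v = 0" for v by blast
    show ?thesis
    proof (cases "\<forall>v. deg E v \<le> 1")
      case True
      have "2 * card E \<le> (\<Sum>v\<in>V. 1)" unfolding handshake[OF sgE, symmetric]
        by (rule sum_mono) (use True in auto)
      then have "card E \<le> card V div 2" by simp
      moreover obtain t where "decomp E (card E) t" using decomp_edges[OF finE] sgE by (auto simp: graph_on_def)
      ultimately show ?thesis unfolding half_decomposable_def by blast
    next
      case False
      then obtain y where "\<not> deg E y \<le> 1" by auto
      then have "odd (deg E y)" "2 \<le> card {u. {y, u} \<in> E}" using odd[of y] deg_card_nbrs[OF sgE, of y] by auto
      then obtain x z where xz: "x \<noteq> z" "{y, x} \<in> E" "{y, z} \<in> E" and oy: "odd (deg E y)"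
        by (auto simp: card_le_Suc_iff numeral_2_eq_2)
      have ne: "x \<noteq> y" "z \<noteq> y" "x \<in> V" "y \<in> V" "z \<in> V" using graph_on_edge[OF sgE] xz by auto
      obtain y' where y': "y' \<notin> V" using ex_new_if_finite[OF inf] sgE by (auto simp: graph_on_def)
      have ne': "y' \<noteq> x" "y' \<noteq> y" "y' \<noteq> z" using y' ne by auto
      have fresh: "y' \<notin> e" if "e \<in> E" for e using that sgE y' by (auto simp: graph_on_def)
      \<comment> \<open>Isolated vertices are left out: it is the number of odd vertices that is
        even by handshaking, so that one more vertex does not raise the rounded down half.\<close>
      define V1 where "V1 = {v\<in>V. odd (deg E v)}"
      have V1: "finite V1" "even (card V1)" "card V1 \<le> card V"
        using even_card_odd[OF sgE] sgE by (auto simp: V1_def graph_on_def intro: card_mono)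
      have EV1: "e \<subseteq> V1" if "e \<in> E" for e
        using that sgE odd deg_zero[OF finE] by (fastforce simp: V1_def graph_on_def)
      \<comment> \<open>Removing two edges keeps \<open>y\<close> odd, and \<open>x\<close> keeps
        its degree by the new edge to \<open>y'\<close>. So \<open>z\<close> is the only vertex of
        positive degree that may be even, and the number of edges drops by one.\<close>
      define D where "D = {{y, x}, {y, z}}"
      define E3 where "E3 = insert {y', x} (E - D)"
      have D: "D \<subseteq> E" "{y, x} \<noteq> {y, z}" using xz by (auto simp: D_def doubleton_eq_iff)
      have dgD: "deg D v = of_bool (v \<in> {y, x}) + of_bool (v \<in> {y, z})" for v
        unfolding D_def using D(2) by (simp add: deg_insert)
      have y'x: "{y', x} \<notin> E" using fresh by blast
      have par3: "even (deg E3 v) \<longleftrightarrow> (even (deg E v) \<longleftrightarrow> even (deg D v)) \<noteq> (v \<in> {y', x})" for v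
        unfolding E3_def using deg_insert[of "E - D" "{y', x}" v] finE y'x even_dg_Diff[OF finE D(1), of v] by auto
      have sg3: "graph_on (insert y' V1) E3"
        using V1 EV1 sgE ne ne' xz by (auto simp: E3_def graph_on_def)
      have "card E3 = Suc (card E - card D)" unfolding E3_def using finE y'x D(1)
        by (simp add: card_Diff_subset finite_subset)
      moreover have "card D = 2" using D(2) by (simp add: D_def)
      moreover have "card D \<le> card E" using D(1) finE card_mono by blast
      ultimately have cE3: "card E3 < card E" by linarith
      have odd3: "odd (deg E3 v)" if "v \<noteq> z" "0 < deg E3 v" for v
      proof -
        have "v \<in> insert y' V1" using deg_posE[OF sg3 that(2)] graph_on_edge[OF sg3] by metis
        moreover have "deg E y' = 0" using fresh by (simp add: deg_zero[OF finE])
        ultimately show ?thesis using par3[of v] that ne ne' dgD[of v] xz by (auto simp: V1_def)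
      qed
      have "half_decomposable (insert y' V1) E3"
      proof (rule less.hyps[OF cE3 sg3])
        fix u v assume uv: "{u, v} \<in> E3"
        then have "u \<noteq> v" "0 < deg E3 u" "0 < deg E3 v"
          using graph_on_edge[OF sg3] deg_pos[OF sg3] by blast+
        then show "odd (deg E3 u) \<or> odd (deg E3 v)" using odd3 by metis
      qed
      then obtain n t where nt: "n \<le> card (insert y' V1) div 2" "decomp E3 n t" by (auto simp: half_decomposable_def)
      have "y' \<notin> V1" using y' by (auto simp: V1_def)
      then have n: "n \<le> card V div 2" using nt(1) V1 by auto
      have zy3: "{z, y} \<notin> E3" using ne' xz by (auto simp: E3_def D_def doubleton_eq_iff)
      have "odd (deg E3 y)" using par3[of y] dgD[of y] ne ne' oy xz by auto
      then have "decomp (insert {z, y} E3) n (t(z := t z + 1, y := t y - 1))"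
      proof (intro augment_edge_no_zeros[OF nt(2)])
        fix v assume "{z, v} \<in> E3"
        then have "v \<noteq> z" "0 < deg E3 v" using graph_on_edge[OF sg3] deg_pos[OF sg3] by blast+
        then show "1 \<le> t v" using odd3 decomp_odd_pos[OF nt(2)] by auto
      qed (use ne zy3 decomp_odd_pos[OF nt(2)] in auto)
      then obtain t4 where t4: "decomp (insert {z, y} E3) n t4" by blast
      \<comment> \<open>Cutting off the leaf moves an end to \<open>x\<close>, which guarantees the
        end there that is used up when \<open>yx\<close> is inserted at \<open>y\<close>.\<close>
      have "decomp (insert {z, y} E3 - {{y', x}}) n (t4(x := t4 x + 1, y' := t4 y' - 1))"
        by (rule decomp_remove_leaf[OF t4]) (use ne' fresh in \<open>auto simp: E3_def\<close>)
      moreover have "insert {z, y} E3 - {{y', x}} = E - {{y, x}}"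
        using ne ne' xz y'x unfolding E3_def D_def by (auto simp: insert_commute doubleton_eq_iff)
      moreover obtain t5 where t5: "t5 = t4(x := t4 x + 1, y' := t4 y' - 1)" by blast
      ultimately have s5: "decomp (E - {{y, x}}) n t5" by simp
      have "1 \<le> t5 x" using t5 ne' decomp_nonneg[OF t4, of x] by auto
      then have "decomp (insert {y, x} (E - {{y, x}})) n (t5(y := t5 y + 1, x := t5 x - 1))"
      proof (intro augment_edge_no_zeros[OF s5])
        fix v assume v: "{y, v} \<in> E - {{y, x}}"
        then have "v \<noteq> y" "v \<noteq> x" "0 < deg E v" using graph_on_edge[OF sgE] deg_pos[OF sgE]
          by blast+
        moreover have "odd (deg (E - {{y, x}}) v) \<longleftrightarrow> odd (deg E v)" if "v \<noteq> y" "v \<noteq> x"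
          using even_dg_Diff[OF finE, of "{{y, x}}" v] xz(2) that by (simp add: deg_insert)
        ultimately have "odd (deg (E - {{y, x}}) v)" using odd[of v] by auto
        then show "1 \<le> t5 v" by (rule decomp_odd_pos[OF s5])
      qed (use ne in auto)
      moreover have "insert {y, x} (E - {{y, x}}) = E" using xz by auto
      ultimately show ?thesis using n unfolding half_decomposable_def by auto
    qed
  qed
qed

section \<open>Transfer to arbitrary vertex types\<close>

lemma path_edges_map: "path_edges (map f P) = image_mset (image f) (path_edges P)"
  by (induction P rule: path_edges.induct) auto

lemma path_edges_covers: "v \<in> set P \<Longrightarrow> 2 \<le> length P \<Longrightarrow> \<exists>e. e \<in># path_edges P \<and> v \<in> e"
proof (induction P rule: path_edges.induct)
  case (1 x y r)
  show ?case
  proof (cases "v \<in> {x, y}")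
    case True then show ?thesis by auto
  next
    case False
    then have "v \<in> set (y # r)" "2 \<le> length (y # r)" using 1 by (auto simp: Suc_le_eq)
    then show ?thesis using 1 by auto
  qed
qed auto

lemma decomposes_nontrivial:
  assumes "decomposes E M"
  shows "decomposes E {#P \<in># M. 2 \<le> length P#}"
proof -
  have triv: "path_edges P = {#}" if "\<not> 2 \<le> length P" for P :: "'a list"
    using that by (cases P rule: path_edges.cases) auto
  have "(\<Sum>P\<in>#{#P \<in># X. 2 \<le> length P#}. path_edges P) = (\<Sum>P\<in>#X. path_edges P)" for X :: "'a list multiset"
    by (induction X) (auto simp: triv)
  then show ?thesis using assms by (auto simp: decomposes_def)
qed

text \<open>The graph is copied into \<open>nat\<close>, where fresh vertices exist. One-vertex
  paths are discarded before the decomposition is pulled back, since they may lie outside the copy,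
  where \<open>g\<close> is not controlled.\<close>

lemma lovasz:
  fixes V :: "'v set"
  assumes sgE: "graph_on V E" and ind: "\<And>u v. {u, v} \<in> E \<Longrightarrow> odd (deg E u) \<or> odd (deg E v)"
  shows "half_decomposable V E"
proof -
  have finV: "finite V" "finite E" using sgE graph_on_finite by (auto simp: graph_on_def)
  obtain f :: "'v \<Rightarrow> nat" where f: "inj_on f V" using finite_imp_inj_to_nat_seg[OF finV(1)] by blast
  define F where "F = (image f) ` E"
  have EV: "e \<subseteq> V" "card e = 2" if "e \<in> E" for e using that sgE by (auto simp: graph_on_def)
  have injE: "inj_on (image f) (Pow V)" using f by (rule inj_on_image_Pow)
  have sgF: "graph_on (f ` V) F"
    unfolding graph_on_def F_def using finV(1) EV card_image[OF inj_on_subset[OF f EV(1)]]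
    by (auto dest!: subsetD)
  have dgF: "deg F (f v) = deg E v" if "v \<in> V" for v
  proof -
    have "{e \<in> F. f v \<in> e} = image f ` {e \<in> E. v \<in> e}"
      unfolding F_def using inj_on_image_mem_iff[OF f that EV(1)] by blast
    moreover have "inj_on (image f) {e \<in> E. v \<in> e}" by (rule inj_on_subset[OF injE]) (use EV in auto)
    ultimately show ?thesis unfolding deg_def by (metis card_image)
  qed
  have "half_decomposable (f ` V) F"
  proof (rule lovasz_infinite[OF _ sgF])
    fix a b assume "{a, b} \<in> F"
    then obtain e where e: "e \<in> E" "f ` e = {a, b}" by (auto simp: F_def)
    then obtain u v where uv: "e = {u, v}" "u \<in> V" "v \<in> V" using EV[OF e(1)] by (auto simp: card_2_iff)
    then have "{a, b} = {f u, f v}" using e by auto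
    then have "a = f u \<and> b = f v \<or> a = f v \<and> b = f u" by (simp add: doubleton_eq_iff)
    moreover have "odd (deg F (f u)) \<or> odd (deg F (f v))" using ind[of u v] e(1) uv dgF by simp
    ultimately show "odd (deg F a) \<or> odd (deg F b)" by blast
  qed simp
  then obtain n M where nM: "n \<le> card V div 2" "decomposes F M" "size M = n"
    unfolding half_decomposable_def decomp_def using card_image[OF f] by auto
  define M1 where "M1 = {#P \<in># M. 2 \<le> length P#}"
  define g where "g = inv_into V f"
  have gf: "g (f v) = v" if "v \<in> V" for v using that f by (simp add: g_def)
  have d1: "decomposes F M1" unfolding M1_def by (rule decomposes_nontrivial[OF nM(2)])
  have PV: "set P \<subseteq> f ` V" if PM: "P \<in># M1" for P
  proof
    fix v assume "v \<in> set P"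
    then obtain e where e: "e \<in># path_edges P" "v \<in> e" using path_edges_covers[of v P] PM by (auto simp: M1_def)
    then have "e \<in># (\<Sum>P\<in>#M1. path_edges P)" using PM by auto
    then have "e \<in> F" using d1 graph_on_finite[OF sgF] unfolding decomposes_def by (metis finite_set_mset_mset_set)
    then show "v \<in> f ` V" using e sgF by (auto simp: graph_on_def)
  qed
  have injg: "inj_on g (f ` V)" using f by (auto simp: inj_on_def gf)
  have "image g ` F = E" 
  proof -
    have "g ` f ` e = e" if "e \<in> E" for e using EV(1)[OF that] gf by (force simp: image_image)
    then show ?thesis by (auto simp: F_def image_image)
  qed
  moreover have "inj_on (image g) F"
    by (rule inj_on_subset[OF inj_on_image_Pow[OF injg]]) (use sgF in \<open>auto simp: graph_on_def\<close>)
  ultimately have "image_mset (image g) (mset_set F) = mset_set E"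
    by (metis image_mset_mset_set)
  moreover have "(\<Sum>P\<in>#image_mset (map g) X. path_edges P) = image_mset (image g) (\<Sum>P\<in>#X. path_edges P)" for X
    by (induction X) (auto simp: path_edges_map)
  ultimately have "(\<Sum>P\<in>#image_mset (map g) M1. path_edges P) = mset_set E" using d1 by (simp add: decomposes_def)
  moreover have "distinct (map g P)" if "P \<in># M1" for P
    using that d1 PV[OF that] injg by (auto simp: decomposes_def distinct_map intro: inj_on_subset)
  ultimately have "decomposes E (image_mset (map g) M1)" using d1 by (auto simp: decomposes_def)
  moreover have "size (image_mset (map g) M1) \<le> n" using nM(3) size_filter_mset_lesseq[of "\<lambda>P. 2 \<le> length P" M] by (simp add: M1_def del: size_filter_mset_lesseq)
  ultimately have "size (image_mset (map g) M1) \<le> card V div 2"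
    "decomp E (size (image_mset (map g) M1)) (end_mult (image_mset (map g) M1))"
    unfolding decomp_def using nM(1) finV(2) le_trans by blast+
  then show ?thesis unfolding half_decomposable_def by blast
qed

section \<open>Even vertices forming isolated vertices and triangles\<close>

definition even_nbrs :: "'v set set \<Rightarrow> 'v \<Rightarrow> 'v set" where
  "even_nbrs E v = {u. {v, u} \<in> E \<and> even (deg E u)}"

definition tri_isolated :: "'v set set \<Rightarrow> bool" where
  "tri_isolated E \<longleftrightarrow> (\<forall>v. even (deg E v) \<longrightarrow> even_nbrs E v = {} \<or>
     (\<exists>y z. y \<noteq> z \<and> even_nbrs E v = {y, z} \<and> even_nbrs E y = {v, z} \<and> even_nbrs E z = {v, y}))"

text \<open>The components for which the bound \<open>n div 2\<close> may fail, such as \<open>K\<^sub>3\<close> and \<open>K\<^sub>5\<close> minus an edge.\<close>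

definition obstruction :: "'v set set \<Rightarrow> 'v set \<Rightarrow> 'v set \<Rightarrow> bool" where
  "obstruction E T K \<longleftrightarrow> T \<subseteq> K \<and> card T = 3 \<and> (\<forall>u\<in>T. \<forall>v\<in>T. u \<noteq> v \<longrightarrow> {u, v} \<in> E)
     \<and> (\<forall>v\<in>T. even (deg E v))
     \<and> (\<forall>q\<in>K - T. odd (deg E q) \<and> 2 \<le> card {v \<in> T. {q, v} \<in> E})
     \<and> (\<forall>e\<in>E. e \<inter> K \<noteq> {} \<longrightarrow> e \<subseteq> K)"

definition obstructed :: "'v set set \<Rightarrow> bool" where
  "obstructed E \<longleftrightarrow> (\<exists>T K. obstruction E T K)"

definition reduces :: "'v set set \<Rightarrow> 'v set set \<Rightarrow> bool" where
  "reduces E E' \<longleftrightarrow> E' \<subset> E \<and> (\<forall>n t. decomp E' n t \<longrightarrow> (\<exists>t'. decomp E n t'))"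

lemma in_even_nbrs: "u \<in> even_nbrs E v \<longleftrightarrow> {v, u} \<in> E \<and> even (deg E u)"
  by (simp add: even_nbrs_def)

lemma even_nbrs_sym: "even (deg E v) \<Longrightarrow> even (deg E u) \<Longrightarrow> u \<in> even_nbrs E v \<longleftrightarrow> v \<in> even_nbrs E u"
  by (simp add: in_even_nbrs insert_commute)

lemma finite_even_nbrs: "graph_on V E \<Longrightarrow> finite (even_nbrs E v)"
  by (rule finite_subset[OF _ finite_nbrs]) (auto simp: even_nbrs_def)

lemma not_in_even_nbrs: "graph_on V E \<Longrightarrow> v \<notin> even_nbrs E v"
  using graph_on_edge[of V E v v] by (auto simp: in_even_nbrs)

text \<open>For even \<open>v\<close>, the set \<open>insert v (even_nbrs E v)\<close> is the
  component of \<open>v\<close> in the even subgraph, a single vertex or a triangle, and hence the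
  same for all its members.\<close>

lemma tri_isolated_eq:
  assumes "tri_isolated E" "even (deg E v)" "u \<in> even_nbrs E v"
  shows "insert u (even_nbrs E u) = insert v (even_nbrs E v)"
proof -
  obtain y z where "even_nbrs E v = {y, z}" "even_nbrs E y = {v, z}" "even_nbrs E z = {v, y}"
    using assms unfolding tri_isolated_def by (metis empty_iff)
  then show ?thesis using assms(3) by auto
qed

lemma tri_isolated_card:
  assumes "tri_isolated E" "even (deg E v)" "even_nbrs E v \<noteq> {}"
  shows "card (even_nbrs E v) = 2"
proof -
  obtain y z where "y \<noteq> z" "even_nbrs E v = {y, z}" using assms unfolding tri_isolated_def by blast
  then show ?thesis by simp
qed

lemma tri_isolated_edge:
  assumes "graph_on V E" "tri_isolated E" "even (deg E v)" "u \<in> insert v (even_nbrs E v)" "w \<in> insert v (even_nbrs E v)" "u \<noteq> w"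
  shows "w \<in> even_nbrs E u"
proof -
  have "insert u (even_nbrs E u) = insert v (even_nbrs E v)" using tri_isolated_eq[OF assms(2,3)] assms(4) by blast
  then have "w \<in> insert u (even_nbrs E u)" using assms(5) by (simp only:)
  then show ?thesis using assms(6) by simp
qed

text \<open>Read backwards: a reduction creates an obstruction only if a deleted edge touches
  it.\<close>

lemma obstruction_mono:
  assumes b: "obstruction E' T K" and sub: "E' \<subseteq> E" and K: "\<And>e. e \<in> E - E' \<Longrightarrow> e \<inter> K = {}"
  shows "obstruction E T K"
proof -
  have d: "deg E v = deg E' v" if "v \<in> K" for v
  proof -
    have "{e \<in> E. v \<in> e} = {e \<in> E'. v \<in> e}" using sub K that by blast
    then show ?thesis by (simp add: deg_def)
  qed
  have n: "{v \<in> T. {q, v} \<in> E} = {v \<in> T. {q, v} \<in> E'}" if "q \<in> K" for q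
    using K[of "{q, _}"] sub that by blast
  show ?thesis unfolding obstruction_def
  proof (intro conjI ballI impI)
    fix e assume "e \<in> E" "e \<inter> K \<noteq> {}"
    then show "e \<subseteq> K" using b K[of e] unfolding obstruction_def by blast
  next
    fix v assume "v \<in> T" then show "even (deg E v)" using b d unfolding obstruction_def by (metis subsetD)
  next
    fix q assume "q \<in> K - T"
    then show "odd (deg E q)" "2 \<le> card {v \<in> T. {q, v} \<in> E}"
      using b d[of q] n[of q] unfolding obstruction_def by auto
  qed (use b sub in \<open>auto simp: obstruction_def\<close>)
qed

lemma deg_pairs:
  assumes "finite I" "inj_on x I" "inj_on y I" "x ` I \<inter> y ` I = {}"
  shows "deg ((\<lambda>i. {x i, y i}) ` I) u = of_bool (u \<in> x ` I \<union> y ` I)"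
  using assms
proof (induction I rule: finite_induct)
  case (insert i I)
  have ni: "x i \<notin> x ` I" "x i \<notin> y ` I" "y i \<notin> y ` I" "y i \<notin> x ` I"
    using insert.prems insert.hyps(2) by auto
  then have "{x i, y i} \<notin> (\<lambda>i. {x i, y i}) ` I" by (auto simp: doubleton_eq_iff)
  then have "deg ((\<lambda>i. {x i, y i}) ` insert i I) u = deg ((\<lambda>i. {x i, y i}) ` I) u + of_bool (u \<in> {x i, y i})"
    using insert by (simp add: deg_insert)
  also have "deg ((\<lambda>i. {x i, y i}) ` I) u = of_bool (u \<in> x ` I \<union> y ` I)"
    using insert by (auto simp: inj_on_def)
  finally show ?case using ni by auto
qed simp

text \<open>The star from \<open>p\<close> to its even neighbours is deleted. In a triangle \<open>xyz\<close> with \<open>z\<close> adjacent and \<open>y\<close> not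
  adjacent to \<open>p\<close>, the edges \<open>pz\<close> and \<open>xy\<close> are deleted instead of the edges to \<open>p\<close>. To insert \<open>xy\<close>
  again when \<open>x\<close> is adjacent to \<open>p\<close>, a path must end at \<open>p\<close>; if the parity is wrong for this, one such
  triangle (the one outside \<open>I\<close>) keeps \<open>xy\<close> and loses both edges to \<open>p\<close>.\<close>

lemma reduce_star:
  assumes sgE: "graph_on V E" and tri: "tri_isolated E" and p: "odd (deg E p)" "even_nbrs E p \<noteq> {}"
    and hS: "\<And>v. even (deg E v) \<Longrightarrow> even_nbrs E p \<subseteq> insert v (even_nbrs E v) \<Longrightarrow> card (even_nbrs E p) < 2"
  shows "\<exists>E'. reduces E E' \<and> tri_isolated E' \<and> (obstructed E' \<longrightarrow> obstructed E)"
proof -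
  note finE = graph_on_finite[OF sgE]
  define Sp where "Sp = even_nbrs E p"
  define tr where "tr v = insert v (even_nbrs E v)" for v
  have Sp: "finite Sp" "p \<notin> Sp" "\<And>v. v \<in> Sp \<Longrightarrow> {p, v} \<in> E \<and> even (deg E v)"
    using finite_even_nbrs[OF sgE] not_in_even_nbrs[OF sgE] by (auto simp: Sp_def in_even_nbrs)
  have tr_eq: "tr u = tr v" if "even (deg E v)" "u \<in> tr v" for u v
    using tri_isolated_eq[OF tri that(1)] that(2) by (auto simp: tr_def)
  have tr_ev: "even (deg E u)" if "even (deg E v)" "u \<in> tr v" for u v
    using that by (auto simp: tr_def in_even_nbrs)
  have tr_even_nbrs: "u \<in> even_nbrs E v \<longleftrightarrow> u \<in> tr v \<and> u \<noteq> v" for u v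
    using not_in_even_nbrs[OF sgE] by (auto simp: tr_def)
  define TT where "TT = {tr v | v. v \<in> Sp \<and> even_nbrs E v \<noteq> {} \<and> \<not> tr v \<subseteq> Sp}"
  have finTT: "finite TT" unfolding TT_def using Sp(1) by auto
  have TTtr: "tr v = T" if "T \<in> TT" "v \<in> T" for v T
    using that tr_eq Sp(3) unfolding TT_def by auto
  have TTev: "even (deg E v)" if "T \<in> TT" "v \<in> T" for v T
    using that tr_ev Sp(3) unfolding TT_def by auto
  have "\<exists>x y z. T = {x, y, z} \<and> x \<noteq> y \<and> x \<noteq> z \<and> y \<noteq> z \<and> z \<in> Sp \<and> y \<notin> Sp" if "T \<in> TT" for T
  proof -
    obtain v where v: "T = tr v" "v \<in> Sp" "even_nbrs E v \<noteq> {}" "\<not> tr v \<subseteq> Sp" using \<open>T \<in> TT\<close> by (auto simp: TT_def)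
    obtain y where y: "y \<in> even_nbrs E v" "y \<notin> Sp" using v by (auto simp: tr_def)
    obtain a b where ab: "even_nbrs E v = {a, b}" "a \<noteq> b"
      using tri_isolated_card[OF tri _ v(3)] Sp(3)[OF v(2)] by (auto simp: card_2_iff)
    obtain x where "even_nbrs E v = {x, y}" "x \<noteq> y" using ab y(1) by (metis insert_commute insertE singletonD)
    then have "T = {x, y, v} \<and> x \<noteq> y \<and> x \<noteq> v \<and> y \<noteq> v \<and> v \<in> Sp \<and> y \<notin> Sp"
      using v y not_in_even_nbrs[OF sgE, of v] by (auto simp: tr_def)
    then show ?thesis by blast
  qed
  then obtain x y z where xyz: "\<And>T. T \<in> TT \<Longrightarrow> T = {x T, y T, z T} \<and> x T \<noteq> y T \<and> x T \<noteq> z T \<and> y T \<noteq> z T \<and> z T \<in> Sp \<and> y T \<notin> Sp"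
    by metis
  have inT: "x T \<in> T" "y T \<in> T" "z T \<in> T" if "T \<in> TT" for T using xyz[OF that] by auto
  have same: "T = T'" if "T \<in> TT" "T' \<in> TT" "u \<in> T" "u \<in> T'" for T T' u
    using TTtr that by metis
  \<comment> \<open>\<open>S0\<close> is the star that results if every partly attached triangle
    loses its edge \<open>xy\<close>; its parity decides whether one triangle must be
    exempted.\<close>
  define S0 where "S0 = Sp - x ` TT"
  have "\<exists>I\<subseteq>TT. (\<forall>T\<in>TT - I. x T \<in> Sp \<and> TT - I = {T} \<and> even (card (Sp - x ` I)))
      \<and> ((\<exists>T\<in>I. x T \<in> Sp) \<longrightarrow> even (card (Sp - x ` I)))"
  proof (cases "(\<exists>T\<in>TT. x T \<in> Sp) \<and> odd (card S0)")
    case False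
    then show ?thesis by (intro exI[of _ TT]) (auto simp: S0_def)
  next
    case True
    then obtain T0 where T0: "T0 \<in> TT" "x T0 \<in> Sp" by blast
    have "x T0 \<notin> x ` (TT - {T0})" using same inT T0 by (metis DiffE image_iff singletonI)
    then have "Sp - x ` (TT - {T0}) = insert (x T0) S0" using T0 by (auto simp: S0_def)
    moreover have "x T0 \<notin> S0" using T0 by (auto simp: S0_def)
    ultimately have "even (card (Sp - x ` (TT - {T0})))" using True Sp(1) by (simp add: S0_def)
    then show ?thesis using T0 by (intro exI[of _ "TT - {T0}"]) auto
  qed
  then obtain I where I0: "I \<subseteq> TT \<and> (\<forall>T\<in>TT - I. x T \<in> Sp \<and> TT - I = {T} \<and> even (card (Sp - x ` I)))
      \<and> ((\<exists>T\<in>I. x T \<in> Sp) \<longrightarrow> even (card (Sp - x ` I)))" ..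
  note I = I0[THEN conjunct1] and I' = I0[THEN conjunct2, THEN conjunct1] I0[THEN conjunct2, THEN conjunct2]
  have T0: "x T \<in> Sp \<and> TT - I = {T} \<and> even (card (Sp - x ` I))" if "T \<in> TT" "T \<notin> I" for T
    using I'(1) that by simp
  have par_S: "even (card (Sp - x ` I))" if "T \<in> I" "x T \<in> Sp" for T
    using I'(2) that by blast
  define S where "S = Sp - x ` I"
  define X where "X = x ` I"
  define Y where "Y = y ` I"
  define Y' where "Y' = y ` TT"
  define M where "M = (\<lambda>T. {x T, y T}) ` I"
  define E' where "E' = E - (star p S \<union> M)"
  have finI: "finite I" using I finTT finite_subset by blast
  have inj: "inj_on x I" "inj_on y I"
  proof -
    have TI: "T \<in> TT" if "T \<in> I" for T using that I by blast
    show "inj_on x I" by (rule inj_onI) (metis same inT(1) TI)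
    show "inj_on y I" by (rule inj_onI) (metis same inT(2) TI)
  qed
  have XY: "X \<inter> Y' = {}"
  proof -
    have "x T \<noteq> y T'" if "T \<in> I" "T' \<in> TT" for T T'
    proof
      assume "x T = y T'"
      then have "T = T'" using same inT that I by (metis subsetD)
      then show False using xyz[of T'] \<open>x T = y T'\<close> that by auto
    qed
    then show ?thesis by (auto simp: X_def Y'_def)
  qed
  have YY: "Y \<subseteq> Y'" using I by (auto simp: Y_def Y'_def)
  have SY: "S \<inter> Y' = {}" "Sp \<inter> Y' = {}" using xyz by (auto simp: S_def Y'_def)
  have SX: "S \<inter> X = {}" "Sp \<subseteq> S \<union> X" by (auto simp: S_def X_def)
  have S: "finite S" "p \<notin> S" "S \<subseteq> Sp" using Sp by (auto simp: S_def)
  have zS: "z T \<in> S" if "T \<in> TT" for T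
  proof -
    have "z T \<noteq> x T'" if "T' \<in> I" for T'
    proof
      assume "z T = x T'"
      then have "T = T'" using same inT \<open>T \<in> TT\<close> that I by (metis subsetD)
      then show False using xyz[of T'] \<open>z T = x T'\<close> that I by auto
    qed
    then show ?thesis using xyz[OF \<open>T \<in> TT\<close>] by (auto simp: S_def)
  qed
  have xS: "x T \<in> S" if T: "T \<in> TT" "T \<notin> I" for T
  proof -
    have "x T \<notin> X"
    proof
      assume "x T \<in> X"
      then obtain T' where T': "T' \<in> I" "x T = x T'" by (auto simp: X_def)
      then have "T = T'" using same[of T T' "x T"] inT(1)[of T] inT(1)[of T'] T I by auto
      then show False using T T' by blast
    qed
    then show ?thesis using SX(2) T0[OF T] by blast
  qed
  have XYev: "even (deg E v)" if "v \<in> S \<union> X \<union> Y'" for v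
    using that TTev inT I S Sp(3) unfolding X_def Y'_def by blast
  have pXY: "p \<notin> S \<union> X \<union> Y'" using XYev p(1) by blast
  have ME: "M \<subseteq> E"
  proof -
    have "{x T, y T} \<in> E" if "T \<in> TT" for T
    proof -
      have "y T \<in> even_nbrs E (x T)" using TTtr[OF that inT(1)[OF that]] inT[OF that] xyz[OF that] tr_even_nbrs by auto
      then show ?thesis by (simp add: in_even_nbrs)
    qed
    then show ?thesis using I by (auto simp: M_def)
  qed
  have starE: "star p S \<subseteq> E" using S(3) Sp(3) unfolding star_def by blast
  have pM: "p \<notin> e" if "e \<in> M" for e
  proof -
    obtain T where "T \<in> I" "e = {x T, y T}" using \<open>e \<in> M\<close> by (auto simp: M_def)
    moreover have "x T \<in> X" "y T \<in> Y'" if "T \<in> I" for T using that I by (auto simp: X_def Y'_def)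
    ultimately show ?thesis using pXY by blast
  qed
  have disj: "star p S \<inter> M = {}" using pM unfolding star_def by blast
  have rem: "star p S \<union> M \<subseteq> E" using ME starE by blast
  have dgM: "deg M u = of_bool (u \<in> X \<union> Y)" for u
    unfolding M_def X_def Y_def
    by (rule deg_pairs[OF finI inj]) (use XY YY in \<open>auto simp: X_def Y_def\<close>)
  have par: "even (deg E' u) \<longleftrightarrow> even (deg E u) \<and> u \<notin> S \<union> X \<union> Y" if "u \<noteq> p" for u
  proof -
    have "deg (star p S \<union> M) u = of_bool (u \<in> S \<union> X \<union> Y)"
      using deg_Un[of "star p S" M u] dgM[of u] deg_star[OF S(1,2), of u] disj that S(1) finI SX SY YY
      by (auto simp: M_def)
    then show ?thesis using even_dg_Diff[OF finE rem, of u] XYev[of u] YY unfolding E'_def by auto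
  qed
  have parp: "even (deg E' p) \<longleftrightarrow> odd (card S)"
  proof -
    have "deg (star p S \<union> M) p = card S"
      using deg_Un[of "star p S" M p] dgM[of p] deg_star[OF S(1,2), of p] disj S(1) finI pXY YY
      by (auto simp: M_def)
    then show ?thesis using even_dg_Diff[OF finE rem, of p] p(1) unfolding E'_def by auto
  qed
  have sub: "E' \<subseteq> E" by (auto simp: E'_def)
  have pS: "{p, s} \<notin> E'" if "s \<in> S" for s using that by (auto simp: E'_def in_star)
  have nbp: "u \<in> X \<or> odd (deg E u)" if "{p, u} \<in> E'" for u
  proof -
    have "u \<in> Sp" if "even (deg E u)" using that sub \<open>{p, u} \<in> E'\<close> by (auto simp: Sp_def in_even_nbrs)
    then show ?thesis using pS[of u] that SX(2) by blast
  qed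
  \<comment> \<open>The neighbours left to \<open>p\<close> were odd or lie in \<open>X\<close>,
    whose members have become odd. So \<open>p\<close> is harmless even if it is now even
    itself.\<close>
  have even_nbrs_p: "even_nbrs E' p = {}"
  proof -
    have False if u: "{p, u} \<in> E'" "even (deg E' u)" for u
    proof -
      have "u \<noteq> p" using u(1) sub graph_on_edge[OF sgE, of p u] by auto
      then show False using nbp[OF u(1)] par[of u] u(2) by auto
    qed
    then show ?thesis unfolding even_nbrs_def by blast
  qed
  have cases_T: "T \<subseteq> S \<or> T \<in> TT" if "T = tr v" "v \<in> Sp" "even_nbrs E v \<noteq> {}" for T v
  proof (cases "T \<in> TT")
    case False
    then have "T \<subseteq> Sp" using that unfolding TT_def by blast
    moreover have "T \<inter> X = {}"
    proof -
      have False if u: "u \<in> T" "T' \<in> I" "u = x T'" for u T'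
      proof -
        have "tr u = T" using u \<open>T = tr v\<close> tr_eq[of v u] Sp(3)[OF \<open>v \<in> Sp\<close>] by auto
        moreover have "tr u = T'" using u TTtr[of T' u] inT I by blast
        ultimately show False using False u I by auto
      qed
      then show ?thesis by (auto simp: X_def)
    qed
    ultimately show ?thesis using SX(2) by blast
  qed simp
  \<comment> \<open>A component of the even subgraph that is hit disappears entirely, except for the
    exempted triangle, of which only the vertex \<open>y T\<close> stays even, without even
    neighbours.\<close>
  have touched: "T \<subseteq> S \<or> T \<subseteq> S \<union> X \<union> Y \<or> T \<in> TT - I" if that: "T = tr v" "even (deg E v)" "even_nbrs E v \<noteq> {}" "T \<inter> (S \<union> X \<union> Y) \<noteq> {}" for T v
  proof -
    note h = that
    have "T \<in> TT \<or> T \<inter> Sp \<noteq> {}"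
    proof -
      obtain u where u: "u \<in> T" "u \<in> S \<union> X \<union> Y" using h(4) by blast
      show ?thesis
      proof (cases "u \<in> S")
        case False
        then obtain T' where "T' \<in> I" "u \<in> T'" using u inT I unfolding X_def Y_def by blast
        then have "T' = T" using TTtr[of T' u] I tr_eq[of v u] h u by auto
        then show ?thesis using \<open>T' \<in> I\<close> I by auto
      qed (use u S in auto)
    qed
    then show ?thesis
    proof
      assume "T \<in> TT"
      then show ?thesis using xyz[of T] zS[of T] by (cases "T \<in> I") (auto simp: X_def Y_def)
    next
      assume "T \<inter> Sp \<noteq> {}"
      then obtain u where u: "u \<in> T" "u \<in> Sp" by blast
      have "tr u = T" using tr_eq h u by auto
      moreover have "even_nbrs E u \<noteq> {}" using tr_even_nbrs[of v u] h u tr_even_nbrs[of _ u] \<open>tr u = T\<close> tr_even_nbrs[of _ v] by (metis ex_in_conv tr_def insertI1)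
      ultimately have "T \<subseteq> S \<or> T \<in> TT" using cases_T u by metis
      then show ?thesis using xyz[of T] zS[of T] by (cases "T \<in> I") (auto simp: X_def Y_def)
    qed
  qed
  have enb': "even_nbrs E' u = even_nbrs E u - (S \<union> X \<union> Y)" if "u \<noteq> p" "even (deg E u)" "u \<notin> S \<union> X \<union> Y" for u
  proof (intro set_eqI iffI)
    fix w assume "w \<in> even_nbrs E' u"
    then have w: "{u, w} \<in> E'" "even (deg E' w)" by (auto simp: in_even_nbrs)
    have "w \<noteq> p"
    proof
      assume "w = p"
      then have "u \<in> Sp" using w sub that by (auto simp: Sp_def in_even_nbrs insert_commute)
      then show False using SX(2) that by blast
    qed
    then show "w \<in> even_nbrs E u - (S \<union> X \<union> Y)" using w sub par[of w] by (auto simp: in_even_nbrs)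
  next
    fix w assume w: "w \<in> even_nbrs E u - (S \<union> X \<union> Y)"
    then have "w \<noteq> p" "even (deg E w)" "{u, w} \<in> E" using p by (auto simp: in_even_nbrs)
    moreover have "{u, w} \<notin> star p S" using that \<open>w \<noteq> p\<close> by (auto simp: in_star doubleton_eq_iff)
    moreover have "{u, w} \<notin> M" using that w by (auto simp: M_def X_def Y_def doubleton_eq_iff)
    ultimately show "w \<in> even_nbrs E' u" using par[of w] w by (auto simp: in_even_nbrs E'_def)
  qed
  have enb'2: "even_nbrs E' u = {} \<or> (tr u \<inter> (S \<union> X \<union> Y) = {} \<and> even_nbrs E' u = even_nbrs E u)"
    if u: "u \<noteq> p" "even (deg E u)" "u \<notin> S \<union> X \<union> Y" for u
  proof (cases "even_nbrs E u = {} \<or> tr u \<inter> (S \<union> X \<union> Y) = {}")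
    case True
    then show ?thesis using enb'[OF u] by (auto simp: tr_def)
  next
    case False
    then have "tr u \<in> TT - I" using touched[OF refl u(2)] u(3) by (auto simp: tr_def)
    then have T: "tr u \<in> TT" "x (tr u) \<in> Sp" "TT - I = {tr u}" using T0 by auto
    have "x (tr u) \<in> S" using xS[OF T(1)] \<open>tr u \<in> TT - I\<close> by blast
    moreover have "tr u - {y (tr u)} \<subseteq> {x (tr u), z (tr u)}" using xyz[OF T(1)] by blast
    ultimately have "tr u - {y (tr u)} \<subseteq> S" using zS[OF T(1)] by blast
    then have "u = y (tr u)" using u(3) by (auto simp: tr_def)
    then have "even_nbrs E u \<subseteq> S" using \<open>tr u - {y (tr u)} \<subseteq> S\<close> tr_even_nbrs by auto
    then show ?thesis using enb'[OF u] by auto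
  qed
  have tri': "tri_isolated E'" unfolding tri_isolated_def
  proof (intro allI impI)
    fix u assume ev: "even (deg E' u)"
    show "even_nbrs E' u = {} \<or> (\<exists>y z. y \<noteq> z \<and> even_nbrs E' u = {y, z} \<and> even_nbrs E' y = {u, z} \<and> even_nbrs E' z = {u, y})"
    proof (cases "u = p \<or> even_nbrs E' u = {}")
      case True then show ?thesis using even_nbrs_p by auto
    next
      case False
      then have u: "u \<noteq> p" "even (deg E u)" "u \<notin> S \<union> X \<union> Y" using par[of u] ev by auto
      have e: "tr u \<inter> (S \<union> X \<union> Y) = {}" "even_nbrs E' u = even_nbrs E u" using enb'2[OF u] False by auto
      obtain a b where ab: "a \<noteq> b" "even_nbrs E u = {a, b}" "even_nbrs E a = {u, b}" "even_nbrs E b = {u, a}"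
        using tri u(2) False e unfolding tri_isolated_def by metis
      have q: "w \<noteq> p \<and> even (deg E w) \<and> w \<notin> S \<union> X \<union> Y" if "w \<in> {a, b}" for w
        using that ab(2) e(1) p(1) by (auto simp: tr_def in_even_nbrs)
      have "even_nbrs E' a = even_nbrs E a" "even_nbrs E' b = even_nbrs E b"
        using enb'[of a] enb'[of b] q ab u(3) by auto
      then show ?thesis using ab e by auto
    qed
  qed
  have bad': "obstructed E" if "obstructed E'"
  proof -
    obtain T K where TK: "obstruction E' T K" using \<open>obstructed E'\<close> by (auto simp: obstructed_def)
    have T: "T \<subseteq> K" "card T = 3" "\<And>u v. u \<in> T \<Longrightarrow> v \<in> T \<Longrightarrow> u \<noteq> v \<Longrightarrow> {u, v} \<in> E'" "\<And>u. u \<in> T \<Longrightarrow> even (deg E' u)"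
      using TK by (auto simp: obstruction_def)
    have nonempty: "even_nbrs E' u \<noteq> {}" if "u \<in> T" for u
    proof -
      have "\<not> T \<subseteq> {u}" using T(2) card_mono[of "{u}" T] by auto
      then obtain v where "v \<in> T" "v \<noteq> u" by auto
      then have "v \<in> even_nbrs E' u" using T that by (auto simp: in_even_nbrs)
      then show ?thesis by blast
    qed
    have Tu: "u \<noteq> p \<and> even (deg E u) \<and> tr u \<inter> (S \<union> X \<union> Y) = {}" if "u \<in> T" for u
    proof -
      have "u \<noteq> p" using nonempty[OF that] even_nbrs_p by auto
      then have "even (deg E u)" "u \<notin> S \<union> X \<union> Y" using par[of u] T(4)[OF that] by auto
      then show ?thesis using enb'2[of u] nonempty[OF that] \<open>u \<noteq> p\<close> by blast
    qed
    have nbrs: "\<exists>u\<in>T. {q, u} \<in> E'" if "q \<in> K - T" for q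
    proof -
      have "2 \<le> card {v \<in> T. {q, v} \<in> E'}" using TK that by (auto simp: obstruction_def)
      then have "{v \<in> T. {q, v} \<in> E'} \<noteq> {}" by (metis card.empty not_numeral_le_zero)
      then show ?thesis by blast
    qed
    \<comment> \<open>A touched vertex in \<open>K\<close> would lie outside \<open>T\<close> and be
      adjacent to some \<open>u\<close> in \<open>T\<close>. Both are even in \<open>E\<close>, so
      the component of \<open>u\<close> would have been touched, contrary to
      \<open>Tu\<close>.\<close>
    have "w \<notin> K" if w: "w \<in> S \<union> X \<union> Y" for w
    proof
      assume "w \<in> K"
      have wev: "even (deg E w)" "w \<noteq> p" using XYev w YY pXY by blast+
      have "w \<notin> T" using Tu[of w] w by (auto simp: tr_def)
      then obtain u where u: "u \<in> T" "{w, u} \<in> E'" using nbrs \<open>w \<in> K\<close> by blast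
      then have "w \<in> tr u" using sub wev by (auto simp: tr_def in_even_nbrs insert_commute)
      then show False using Tu[OF u(1)] w by blast
    qed
    moreover have "p \<notin> K"
    proof
      assume "p \<in> K"
      then obtain u where u: "u \<in> T" "{p, u} \<in> E'" using nbrs[of p] Tu[of p] by blast
      then show False using nbp[of u] Tu[of u] by (auto simp: tr_def)
    qed
    ultimately have "e \<inter> K = {}" if "e \<in> E - E'" for e
      using that by (auto simp: E'_def in_star M_def X_def Y_def)
    then show ?thesis using obstruction_mono[OF TK sub] by (auto simp: obstructed_def)
  qed
  have Sne: "S \<noteq> {}"
  proof -
    obtain v where v: "v \<in> Sp" using p(2) by (auto simp: Sp_def)
    show ?thesis
    proof (cases "v \<in> S")
      case False
      then obtain T where "T \<in> I" using v by (auto simp: S_def)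
      then show ?thesis using zS[of T] I by blast
    qed auto
  qed
  obtain s where "s \<in> S" using Sne by blast
  then have "{p, s} \<in> E" "{p, s} \<notin> E'" using starE pS by (auto simp: star_def)
  then have "E' \<subset> E" using sub by blast
  moreover have "\<exists>t'. decomp E n t'" if st0: "decomp E' n t" for n t
  proof -
    have tod: "1 \<le> t u" if "u \<noteq> p" "odd (deg E u) \<or> u \<in> S \<union> X \<union> Y" for u
      using decomp_odd_pos[OF st0, of u] par[of u] that by auto
    have tp: "1 \<le> t p" if "even (card S)" using decomp_odd_pos[OF st0, of p] parp that by auto
    define t1 where "t1 = (\<lambda>v. t v + of_bool (v \<in> X) - of_bool (v \<in> Y))"
    define E1 where "E1 = E' \<union> M"
    have st1: "decomp E1 n t1" unfolding E1_def M_def t1_def X_def Y_def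
    proof (rule add_pairs[OF finI st0 inj])
      show "x ` I \<inter> y ` I = {}" using XY YY by (auto simp: X_def Y_def)
      fix T assume T: "T \<in> I"
      have TT: "T \<in> TT" using T I by auto
      have "y T \<in> Y" "x T \<in> X" using T by (auto simp: X_def Y_def)
      then show "{x T, y T} \<notin> E' \<and> 1 \<le> t (y T)"
        using T tod[of "y T"] pXY YY by (auto simp: E'_def M_def)
      \<comment> \<open>The only neighbour of \<open>x T\<close> still to be considered among the
        vertices even in \<open>E\<close> is \<open>z T\<close>, which has become odd. Among the odd
        ones only \<open>p\<close> is doubtful; if it is adjacent to \<open>x T\<close>, the choice
        of \<open>I\<close> makes \<open>card S\<close> even and keeps \<open>p\<close> odd.\<close>
      fix v assume v: "{x T, v} \<in> E'"
      have "v \<notin> Y \<and> 1 \<le> t v"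
      proof (cases "even (deg E v)")
        case True
        then have "v \<in> even_nbrs E (x T)" using v sub by (auto simp: in_even_nbrs)
        then have "v \<in> T" "v \<noteq> x T" using tr_even_nbrs TTtr[OF TT inT(1)[OF TT]] by auto
        moreover have "v \<noteq> y T" using v T by (auto simp: E'_def M_def)
        ultimately have "v = z T" using xyz[OF TT] by auto
        then show ?thesis using zS[OF TT] tod[of v] pXY SY YY by auto
      next
        case False
        then have "v \<notin> Y" using XYev YY by auto
        moreover have "1 \<le> t v"
        proof (cases "v = p")
          case True
          then have "x T \<in> Sp" using v sub TTev[OF TT inT(1)[OF TT]] by (auto simp: Sp_def in_even_nbrs insert_commute)
          then show ?thesis using par_S[OF T] tp True by (auto simp: S_def)
        qed (use tod False in auto)
        ultimately show ?thesis by auto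
      qed
      then show "1 \<le> t v \<and> v \<notin> y ` I" by (auto simp: Y_def)
    qed
    have t1p: "t1 p = t p" using pXY YY by (auto simp: t1_def)
    have t1pos: "1 \<le> t1 u" if "u \<noteq> p" "odd (deg E u) \<or> u \<in> S \<union> X" for u
      using tod[of u] that XYev[of u] XY SY YY by (auto simp: t1_def)
    have E1: "{p, u} \<in> E1 \<longleftrightarrow> {p, u} \<in> E'" for u
      using pXY YY by (auto simp: E1_def M_def X_def Y_def doubleton_eq_iff)
    obtain y0 where "y0 \<in> S" using Sne by blast
    have h1: "{p, s} \<notin> E1 \<and> 1 \<le> t1 s" if "s \<in> S" for s using E1 pS t1pos[of s] that S(2) by auto
    have h2: "1 \<le> t1 u" if "{p, u} \<in> E1" for u
      using nbp[of u] that E1 t1pos[of u] sub graph_on_edge[OF sgE, of p u] by auto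
    obtain W where W: "W \<subseteq> S" "y0 \<in> W" "card W = (card S + 1) div 2"
      and st2: "decomp (E1 \<union> star p W) n (\<lambda>v. t1 v + (if v = p then int (card W) else 0) - of_bool (v \<in> W))"
      by (rule star_half[OF st1 S(1,2) h1 h2 \<open>y0 \<in> S\<close>])
    define t2 where "t2 = (\<lambda>v. t1 v + (if v = p then int (card W) else 0) - of_bool (v \<in> W))"
    define E2 where "E2 = E1 \<union> star p W"
    have st2: "decomp E2 n t2" using st2 by (simp add: t2_def E2_def)
    have finW: "finite W" using W S finite_subset by blast
    have pW: "p \<notin> W" using W S by auto
    have t2p: "t2 p = t p + int (card W)" using pW t1p by (simp add: t2_def)
    define R where "R = S - W"
    have cR: "card R = card S div 2" using W finW by (simp add: R_def card_Diff_subset)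
    \<comment> \<open>Only vertices of \<open>W\<close> and \<open>Y'\<close> can be without ends at
      this stage, so \<open>Z v\<close> contains every neighbour that can obstruct the insertion of
      \<open>pv\<close> at \<open>v\<close>.\<close>
    define Z where "Z v = even_nbrs E v \<inter> (W \<union> Y')" for v
    have finZ: "finite (Z v)" for v using finite_even_nbrs[OF sgE] by (simp add: Z_def)
    have R2: "{p, v} \<notin> E2" "1 \<le> t2 v" "v \<noteq> p" if "v \<in> R" for v
      using h1[of v] that S(2) by (auto simp: R_def E2_def in_star doubleton_eq_iff t2_def)
    have nz: "u \<noteq> p \<and> 1 \<le> t2 u" if v: "v \<in> R" and u: "{v, u} \<in> E2" "u \<notin> Z v" for u v
    proof -
      have up: "u \<noteq> p" using R2[OF v] u by (auto simp: insert_commute)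
      have vu: "{v, u} \<in> E"
      proof -
        have "{v, u} \<notin> star p W" using R2[OF v] up by (auto simp: in_star doubleton_eq_iff)
        then show ?thesis using u(1) sub ME by (auto simp: E2_def E1_def)
      qed
      have vS: "v \<in> S" "v \<in> Sp" "v \<notin> W" using v S by (auto simp: R_def)
      show ?thesis
      proof (cases "even (deg E u)")
        case False
        then have "u \<notin> W" using W S Sp(3) by auto
        then show ?thesis using t1pos[of u] False up by (auto simp: t2_def)
      next
        case True
        then have ue: "u \<in> even_nbrs E v" using vu by (auto simp: in_even_nbrs)
        then have uW: "u \<notin> W" "u \<notin> Y'" using u(2) by (auto simp: Z_def)
        have "tr v \<subseteq> S \<or> tr v \<in> TT" using cases_T[OF refl vS(2)] ue by auto
        moreover have "u \<in> tr v" using ue tr_even_nbrs by auto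
        moreover have "u \<in> S \<union> X" if "tr v \<in> TT" "u \<in> tr v"
        proof -
          have "u \<in> {x (tr v), z (tr v)}" using xyz[OF that(1)] that uW by (auto simp: Y'_def)
          moreover have "x (tr v) \<in> S \<union> X" using SX(2) T0[OF that(1)] by (cases "tr v \<in> I") (auto simp: X_def)
          ultimately show ?thesis using zS[OF that(1)] by auto
        qed
        ultimately have "u \<in> S \<union> X" by blast
        then show ?thesis using t1pos[of u] up uW by (auto simp: t2_def)
      qed
    qed
    \<comment> \<open>Vertices with two possible zeros need the larger reserve at \<open>p\<close>
      and are served first, before the other insertions use up its ends.\<close>
    define R1 where "R1 = {v \<in> R. 2 \<le> card (Z v)}"
    have finR: "finite R" "finite R1" using S by (auto simp: R_def R1_def)
    have Z2: "card (Z v) \<le> 2" if "v \<in> R" for v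
    proof -
      have "card (Z v) \<le> card (even_nbrs E v)" using finite_even_nbrs[OF sgE] by (auto simp: Z_def intro: card_mono)
      also have "\<dots> \<le> 2" using tri_isolated_card[OF tri, of v] Sp(3)[of v] that S by (cases "even_nbrs E v = {}") (auto simp: R_def)
      finally show ?thesis .
    qed
    have R1: "even_nbrs E v \<subseteq> W \<union> Y' \<and> card (even_nbrs E v) = 2 \<and> (tr v \<subseteq> S \<or> tr v \<in> TT - I)" if v: "v \<in> R1" for v
    proof -
      have vR: "v \<in> S" "v \<in> Sp" "2 \<le> card (Z v)" using v S by (auto simp: R1_def R_def)
      have "Z v \<noteq> {}" using vR by auto
      then have ne: "even_nbrs E v \<noteq> {}" by (auto simp: Z_def)
      then have c: "card (even_nbrs E v) = 2" using tri_isolated_card[OF tri] Sp(3)[OF vR(2)] by blast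
      have "Z v = even_nbrs E v" using c vR(3) finite_even_nbrs[OF sgE] by (intro card_seteq) (auto simp: Z_def)
      then have "even_nbrs E v \<subseteq> W \<union> Y'" by (auto simp: Z_def)
      moreover have "tr v \<notin> I"
      proof
        assume "tr v \<in> I"
        then have T: "tr v \<in> TT" "x (tr v) \<in> X" using I by (auto simp: X_def)
        then have "x (tr v) \<noteq> v" using SX vR by auto
        then have "x (tr v) \<in> even_nbrs E v" using inT(1)[OF T(1)] tr_even_nbrs by auto
        then show False using \<open>even_nbrs E v \<subseteq> W \<union> Y'\<close> T(2) XY W SX by blast
      qed
      ultimately show ?thesis using c cases_T[OF refl vR(2) ne] by blast
    qed
    have R1S: "R1 \<subseteq> S" "R1 \<inter> W = {}" by (auto simp: R1_def R_def)
    have disjR: "even_nbrs E v \<inter> even_nbrs E v' = {}" if "v \<in> R1" "v' \<in> R1" "v \<noteq> v'" for v v'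
    proof (rule ccontr)
      assume "even_nbrs E v \<inter> even_nbrs E v' \<noteq> {}"
      then obtain u where "u \<in> tr v" "u \<in> tr v'" by (auto simp: tr_def)
      moreover have "even (deg E v)" "even (deg E v')" using that R1S S Sp(3) by blast+
      ultimately have "tr v = tr v'" using tr_eq by metis
      then have "v' \<in> even_nbrs E v" using tr_even_nbrs that by (auto simp: tr_def)
      then show False using R1[OF that(1)] that R1S SY by blast
    qed
    have full: "even_nbrs E v \<subseteq> W" if "v \<in> R1" "tr v \<subseteq> S" for v
      using R1[OF that(1)] that SY by (auto simp: tr_def)
    have count: "t p + int (card W) \<ge> int (card R1 + 2)" if "R1 \<noteq> {}"
    proof -
      obtain v where v: "v \<in> R1" using \<open>R1 \<noteq> {}\<close> by blast
      \<comment> \<open>The sets \<open>A u\<close> are disjoint subsets of \<open>W\<close>, which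
        compares \<open>card R1\<close> with \<open>card W\<close>. Each has two elements if the
        triangle of \<open>u\<close> lies in \<open>S\<close>, and at least one in the exempted
        triangle.\<close>
      define A where "A u = even_nbrs E u \<inter> W" for u
      have "(\<Sum>u\<in>R1. card (A u)) = card (\<Union>u\<in>R1. A u)"
        by (rule card_UN_disjoint[symmetric]) (use finR disjR finW in \<open>auto simp: A_def\<close>)
      also have "\<dots> \<le> card W" by (rule card_mono) (use finW in \<open>auto simp: A_def\<close>)
      finally have sumA: "(\<Sum>u\<in>R1. card (A u)) \<le> card W" .
      have A2: "card (A u) = 2" if "u \<in> R1" "tr u \<subseteq> S" for u
        using full[OF that] R1[OF that(1)] by (simp add: A_def Int_absorb2)
      have A1: "1 \<le> card (A u)" if "u \<in> R1" for u
      proof -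
        have "A u \<noteq> {}"
        proof
          assume "A u = {}"
          then have "even_nbrs E u \<subseteq> Y'" "\<not> tr u \<subseteq> S" using R1[OF that] A2[OF that] by (auto simp: A_def)
          then have T: "tr u \<in> TT" using R1[OF that] by auto
          have "u \<in> S" using that R1S by auto
          have "tr u \<inter> Sp \<subseteq> {u}" using \<open>even_nbrs E u \<subseteq> Y'\<close> SY by (auto simp: tr_def)
          moreover have "x (tr u) \<in> Sp" "z (tr u) \<in> Sp" "x (tr u) \<noteq> z (tr u)" using T0[OF T] R1[OF that] \<open>\<not> tr u \<subseteq> S\<close> xyz[OF T] by auto
          ultimately have "x (tr u) = u" "z (tr u) = u" using inT[OF T] by blast+
          then show False using \<open>x (tr u) \<noteq> z (tr u)\<close> by simp
        qed
        then show ?thesis using finW by (simp add: A_def Suc_le_eq card_gt_0_iff)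
      qed
      show ?thesis
      proof (cases "even (card S)")
        case True
        have cW: "2 * card W = card S" using W(3) True by auto
        \<comment> \<open>Otherwise every \<open>A u\<close> is a singleton, so \<open>R1\<close>
          consists of one vertex of the exempted triangle, and \<open>S\<close> of the two
          neighbours of \<open>p\<close> in it. Then \<open>Sp\<close> lies in that triangle, which
          \<open>hS\<close> forbids.\<close>
        have "card R1 + 1 \<le> card W"
        proof (rule ccontr)
          assume "\<not> card R1 + 1 \<le> card W"
          then have le: "(\<Sum>u\<in>R1. card (A u)) \<le> (\<Sum>u\<in>R1. 1)" using sumA by simp
          have one: "card (A u) = 1" if "u \<in> R1" for u
          proof (rule ccontr)
            assume "card (A u) \<noteq> 1"
            then have "1 < card (A u)" using A1[OF that] by simp
            then have "(\<Sum>u\<in>R1. 1) < (\<Sum>u\<in>R1. card (A u))"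
              using that A1 by (intro sum_strict_mono_ex1[OF finR(2)]) auto
            then show False using le by simp
          qed
          then have T: "tr u \<in> TT - I" if "u \<in> R1" for u using R1[OF that] A2[OF that] that by force
          have "R1 = {v}"
          proof -
            have "u = v" if "u \<in> R1" for u
            proof (rule ccontr)
              assume "u \<noteq> v"
              have "tr u = tr v" using T[OF that] T[OF v] T0 by (metis Diff_iff singletonD)
              then have "u \<in> even_nbrs E v" using tr_even_nbrs \<open>u \<noteq> v\<close> by (auto simp: tr_def)
              then show False using R1[OF v] that R1S SY by blast
            qed
            then show ?thesis using v by blast
          qed
          then have "card W \<le> 1" using \<open>\<not> card R1 + 1 \<le> card W\<close> by simp
          moreover have "card W \<noteq> 0" using cW S(1) Sne by auto
          ultimately have cS: "card S = 2" using cW by linarith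
          define T where "T = tr v"
          have TT: "T \<in> TT" "T \<notin> I" using T[OF v] by (auto simp: T_def)
          have "x T \<in> S" using xS[OF TT] .
          then have "{x T, z T} = S" using zS[OF TT(1)] xyz[OF TT(1)] cS S(1)
            by (intro card_subset_eq) auto
          then have "S \<subseteq> T" using inT[OF TT(1)] by auto
          have "Sp \<subseteq> T"
          proof
            fix u assume u: "u \<in> Sp"
            show "u \<in> T"
            proof (rule ccontr)
              assume "u \<notin> T"
              then have "u \<notin> S" using \<open>S \<subseteq> T\<close> by auto
              then obtain T' where T': "T' \<in> I" "u = x T'" using u by (auto simp: S_def)
              then have "z T' \<in> T" using zS[of T'] I \<open>S \<subseteq> T\<close> by blast
              then have "T' = T" using same inT T' I TT by (metis subsetD)
              then show False using T' TT by auto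
            qed
          qed
          moreover have "even (deg E v)" using v R1S S Sp(3) by blast
          moreover have "2 \<le> card Sp" using cS S(3) Sp(1) card_mono by metis
          ultimately show False using hS[of v] by (auto simp: Sp_def T_def tr_def)
        qed
        then show ?thesis using tp True by simp
      next
        case False
        have cW: "2 * card W = card S + 1" using W(3) False by auto
        have fl: "tr u \<subseteq> S" if "u \<in> R1" for u
          using R1[OF that] T0 False by (auto simp: S_def)
        have "(\<Sum>u\<in>R1. card (A u)) = (\<Sum>u\<in>R1. 2)" by (rule sum.cong) (use A2 fl in auto)
        then have "2 * card R1 \<le> card W" using sumA by simp
        moreover have "card R1 \<noteq> 0" using v finR by auto
        \<comment> \<open>Given \<open>2 * card R1 \<le> card W\<close> and
          \<open>R1 \<noteq> {}\<close>, this is the only case in which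
          \<open>card R1 + 2 \<le> card W\<close> fails. It would make \<open>Sp\<close> a whole
          triangle, again contrary to \<open>hS\<close>.\<close>
        moreover have "\<not> (card R1 = 1 \<and> card W = 2)"
        proof
          assume c: "card R1 = 1 \<and> card W = 2"
          then have "card S = 3" using cW by linarith
          moreover have "card (tr v) = 3" using R1[OF v] finite_even_nbrs[OF sgE] not_in_even_nbrs[OF sgE] by (simp add: tr_def)
          ultimately have "tr v = S" using fl[OF v] S(1) by (intro card_subset_eq) auto
          moreover have "Sp = S"
          proof -
            have "x T \<notin> Sp" if "T \<in> I" for T using par_S[OF that] False by (auto simp: S_def)
            then show ?thesis by (auto simp: S_def)
          qed
          moreover have "even (deg E v)" using v R1S S Sp(3) by blast
          ultimately show False using hS[of v] \<open>card S = 3\<close> by (auto simp: Sp_def tr_def)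
        qed
        ultimately have "card R1 + 2 \<le> card W" by linarith
        then show ?thesis using decomp_nonneg[OF st0, of p] by simp
      qed
    qed
    have "decomp (E2 \<union> star p R1) n (\<lambda>v. t2 v - (if v = p then int (card R1) else 0) + of_bool (v \<in> R1))"
    proof (cases "R1 = {}")
      case True
      then show ?thesis using st2 by (simp cong: if_cong)
    next
      case False
      show ?thesis
      proof (rule add_star_outer[OF finR(2) st2, where c = 2])
        fix v assume v: "v \<in> R1"
        then have vR: "v \<in> R" by (auto simp: R1_def)
        show "{p, v} \<notin> E2 \<and> 1 \<le> t2 v" using R2[OF vR] by auto
        show "\<exists>Z. finite Z \<and> card Z \<le> 2 \<and> (\<forall>u. {v, u} \<in> E2 \<longrightarrow> u \<notin> Z \<longrightarrow> 1 \<le> t2 u)"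
          using finZ[of v] Z2[OF vR] nz[OF vR] by blast
      qed (use count[OF False] t2p S(2) R1S in auto)
    qed
    then obtain t3 where st3: "decomp (E2 \<union> star p R1) n t3" and
      t3: "t3 = (\<lambda>v. t2 v - (if v = p then int (card R1) else 0) + of_bool (v \<in> R1))" by blast
    have "decomp ((E2 \<union> star p R1) \<union> star p (R - R1)) n
      (\<lambda>v. t3 v - (if v = p then int (card (R - R1)) else 0) + of_bool (v \<in> R - R1))"
    proof (rule add_star_outer[OF _ st3, where c = 1])
      show "finite (R - R1)" "p \<notin> R - R1" using finR S(2) by (auto simp: R_def)
      fix v assume v: "v \<in> R - R1"
      then have vR: "v \<in> R" by auto
      show "{p, v} \<notin> E2 \<union> star p R1 \<and> 1 \<le> t3 v" using R2[OF vR] v by (auto simp: in_star doubleton_eq_iff t3)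
      have "1 \<le> t3 u" if u: "{v, u} \<in> E2 \<union> star p R1" "u \<notin> Z v" for u
      proof -
        have "{v, u} \<in> E2" using u v R2[OF vR] by (auto simp: in_star doubleton_eq_iff)
        then show ?thesis using nz[OF vR _ u(2)] by (auto simp: t3)
      qed
      moreover have "card (Z v) \<le> 1" using v by (auto simp: R1_def)
      ultimately show "\<exists>Z. finite Z \<and> card Z \<le> 1 \<and> (\<forall>u. {v, u} \<in> E2 \<union> star p R1 \<longrightarrow> u \<notin> Z \<longrightarrow> 1 \<le> t3 u)"
        using finZ[of v] by blast
    next
      have "card (R - R1) = card R - card R1" "card R1 \<le> card R"
        using finR by (auto simp: R1_def card_Diff_subset intro: card_mono)
      moreover have "t3 p = t p + int (card W) - int (card R1)" using t2p R1S S(2) by (auto simp: t3)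
      \<comment> \<open>For even \<open>card S\<close> the sets \<open>W\<close> and
        \<open>R\<close> have the same size and the spare end exists because \<open>p\<close> is
        still odd; for odd \<open>card S\<close> it comes from the larger half
        \<open>W\<close>.\<close>
      moreover have "t p + int (card W) \<ge> int (card R) + 1"
      proof (cases "even (card S)")
        case True
        then have "card W = card R" using W(3) cR by auto
        then show ?thesis using tp[OF True] by simp
      next
        case False
        then have "card W = card R + 1" using W(3) cR by (auto elim!: oddE)
        then show ?thesis using decomp_nonneg[OF st0, of p] by simp
      qed
      ultimately show "int (card (R - R1) + 1) \<le> t3 p" by simp
    qed
    moreover have "(E2 \<union> star p R1) \<union> star p (R - R1) = E"
    proof -
      have "star p R1 \<union> star p (R - R1) = star p R" by (rule star_split) (auto simp: R1_def)
      moreover have "star p W \<union> star p R = star p S" unfolding R_def by (rule star_split[OF W(1)])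
      ultimately show ?thesis using rem unfolding E2_def E1_def E'_def by blast
    qed
    ultimately show ?thesis by metis
  qed
  ultimately have "reduces E E'" unfolding reduces_def by blast
  then show ?thesis using tri' bad' by blast
qed

text \<open>A set of edges at a triangle and an outer vertex \<open>p\<close> that can be inserted if at least one path ends at \<open>p\<close>
  beforehand, leaving an additional end at \<open>p\<close>.\<close>

definition gadget :: "'v set set \<Rightarrow> 'v \<Rightarrow> 'v set \<Rightarrow> 'v set set \<Rightarrow> bool" where
  "gadget E p T M \<longleftrightarrow> M \<subseteq> E \<and> (\<forall>e\<in>M. e \<subseteq> insert p T) \<and> (\<forall>u. odd (deg M u) \<longleftrightarrow> u \<in> insert p T) \<and>
     (\<forall>E0 n t. E0 \<subseteq> E - M \<longrightarrow> decomp E0 n t \<longrightarrow> 1 \<le> t p \<longrightarrow> (\<forall>u\<in>T. 1 \<le> t u) \<longrightarrow>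
        (\<forall>u v. v \<in> insert p T \<longrightarrow> {v, u} \<in> E0 \<longrightarrow> u \<notin> T \<longrightarrow> 1 \<le> t u) \<longrightarrow>
        (\<exists>t'. decomp (E0 \<union> M) n t' \<and> (\<forall>u. u \<notin> insert p T \<longrightarrow> t' u = t u) \<and> 2 \<le> t' p))"

lemma gadgetD:
  assumes "gadget E p T M"
  shows "M \<subseteq> E" "e \<in> M \<Longrightarrow> e \<subseteq> insert p T" "odd (deg M u) \<longleftrightarrow> u \<in> insert p T"
  using assms unfolding gadget_def by simp_all

lemma gadget_add:
  assumes g: "gadget E p T M" and "E0 \<subseteq> E - M" "decomp E0 n t" "1 \<le> t p" "\<forall>u\<in>T. 1 \<le> t u"
    "\<forall>u v. v \<in> insert p T \<longrightarrow> {v, u} \<in> E0 \<longrightarrow> u \<notin> T \<longrightarrow> 1 \<le> t u"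
  shows "\<exists>t'. decomp (E0 \<union> M) n t' \<and> (\<forall>u. u \<notin> insert p T \<longrightarrow> t' u = t u) \<and> 2 \<le> t' p"
proof -
  note * = g[unfolded gadget_def, THEN conjunct2, THEN conjunct2, THEN conjunct2]
  show ?thesis by (rule *[rule_format, OF assms(2,3,4)]) (use assms(5,6) in auto)
qed

text \<open>If \<open>p\<close> sees all of \<open>T\<close>, its star to \<open>T\<close> is used:
  after two edges at least 3 ends lie at \<open>p\<close>, enough for the third edge although both
  other triangle vertices may be without ends. If \<open>p\<close> sees only \<open>x\<close> and
  \<open>z\<close>, the gadget is the matching \<open>xy\<close>, \<open>pz\<close>; inserting
  \<open>xy\<close> first gives \<open>x\<close> an additional end, and \<open>y\<close>, which may
  be left without ends, is not adjacent to \<open>p\<close>.\<close>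

lemma gadget_exists:
  assumes sgE: "graph_on V E" and T: "card T = 3" "\<And>u v. u \<in> T \<Longrightarrow> v \<in> T \<Longrightarrow> u \<noteq> v \<Longrightarrow> {u, v} \<in> E"
    and p: "p \<notin> T" "\<And>u. u \<in> T \<Longrightarrow> {p, u} \<in> E \<longleftrightarrow> u \<in> Sp" "Sp \<subseteq> T" "2 \<le> card Sp"
  shows "\<exists>M. gadget E p T M"
proof -
  have finT: "finite T" using T(1) by (metis card.infinite zero_neq_numeral)
  have "card Sp \<le> 3" using card_mono[OF finT p(3)] T(1) by simp
  then consider "card Sp = 3" | "card Sp = 2" using p(4) by linarith
  then show ?thesis
  proof cases
    case 1
    then have Sp: "Sp = T" using p(3) T(1) finT by (simp add: card_subset_eq)
    define M where "M = star p T"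
    have ME: "M \<subseteq> E" using p(2) Sp by (auto simp: M_def star_def)
    have "\<exists>t'. decomp (E0 \<union> M) n t' \<and> (\<forall>u. u \<notin> insert p T \<longrightarrow> t' u = t u) \<and> 2 \<le> t' p"
      if E0: "E0 \<subseteq> E - M" and st0: "decomp E0 n t" and tp: "1 \<le> t p" and tT: "\<forall>u\<in>T. 1 \<le> t u"
        and tN: "\<forall>u v. v \<in> insert p T \<longrightarrow> {v, u} \<in> E0 \<longrightarrow> u \<notin> T \<longrightarrow> 1 \<le> t u" for E0 n t
    proof -
      obtain y where y: "y \<in> T" using T(1) by fastforce
      have pT: "{p, s} \<notin> E0" if "s \<in> T" for s using that E0 by (auto simp: M_def star_def)
      have h1: "{p, s} \<notin> E0 \<and> 1 \<le> t s" if "s \<in> T" for s using pT tT that by blast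
      have h2: "1 \<le> t u" if "{p, u} \<in> E0" for u using pT tN that by blast
      obtain W where W: "W \<subseteq> T" "y \<in> W" "card W = (card T + 1) div 2"
        and stW: "decomp (E0 \<union> star p W) n (\<lambda>v. t v + (if v = p then int (card W) else 0) - of_bool (v \<in> W))"
        by (rule star_half[OF st0 finT p(1) h1 h2 y])
      define t1 where "t1 = (\<lambda>v. t v + (if v = p then int (card W) else 0) - of_bool (v \<in> W))"
      have cW: "card W = 2" "card (T - W) = 1" using W T(1) finT by (auto simp: card_Diff_subset finite_subset)
      have pW: "p \<notin> W" using W p(1) by blast
      have t1p: "t1 p = t p + 2" using pW cW by (simp add: t1_def)
      have stW: "decomp (E0 \<union> star p W) n t1" using stW by (simp add: t1_def)
      have "decomp ((E0 \<union> star p W) \<union> star p (T - W)) n (\<lambda>v. t1 v - (if v = p then int (card (T - W)) else 0) + of_bool (v \<in> T - W))"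
      proof (rule add_star_outer[OF _ stW, where c = 2])
        fix v assume v: "v \<in> T - W"
        show "{p, v} \<notin> E0 \<union> star p W \<and> 1 \<le> t1 v"
          using h1[of v] v p(1) by (auto simp: in_star doubleton_eq_iff t1_def)
        have "1 \<le> t1 u" if u: "{v, u} \<in> E0 \<union> star p W" "u \<notin> T - {v}" for u
        proof -
          have vp: "v \<noteq> p" "v \<notin> W" using v p(1) by auto
          then have E: "{v, u} \<in> E0" using u(1) by (auto simp: in_star doubleton_eq_iff)
          then have "u \<noteq> v" "u \<noteq> p" using E0 graph_on_edge[OF sgE, of v u] pT[of v] v by (auto simp: insert_commute)
          then have "u \<notin> T" using u(2) by blast
          then have "1 \<le> t u" using tN E v by blast
          then show ?thesis using \<open>u \<notin> T\<close> \<open>u \<noteq> p\<close> W(1) by (auto simp: t1_def)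
        qed
        moreover have "card (T - {v}) \<le> 2" using T(1) v finT by simp
        ultimately show "\<exists>Z. finite Z \<and> card Z \<le> 2 \<and> (\<forall>u. {v, u} \<in> E0 \<union> star p W \<longrightarrow> u \<notin> Z \<longrightarrow> 1 \<le> t1 u)"
          using finT by (intro exI[of _ "T - {v}"]) auto
      qed (use finT p(1) cW t1p tp in auto)
      moreover have "(E0 \<union> star p W) \<union> star p (T - W) = E0 \<union> M"
        using star_split[OF W(1), of p] unfolding M_def by blast
      moreover have "\<forall>u. u \<notin> insert p T \<longrightarrow> t1 u - (if u = p then int (card (T - W)) else 0) + of_bool (u \<in> T - W) = t u"
        using W(1) by (auto simp: t1_def)
      moreover have "2 \<le> t1 p - (if p = p then int (card (T - W)) else 0) + of_bool (p \<in> T - W)"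
        using t1p tp cW by simp
      ultimately show ?thesis
        by (intro exI[of _ "\<lambda>v. t1 v - (if v = p then int (card (T - W)) else 0) + of_bool (v \<in> T - W)"]) simp
    qed
    then have "gadget E p T M" unfolding gadget_def
      using ME deg_star[OF finT p(1)] T(1) by (auto simp: M_def in_star)
    then show ?thesis by blast
  next
    case 2
    then obtain x z where xz: "Sp = {x, z}" "x \<noteq> z" by (auto simp: card_2_iff)
    have "card (T - Sp) = 1" using T(1) 2 p(3) finT by (simp add: card_Diff_subset finite_subset)
    then obtain y where "T - Sp = {y}" by (auto simp: card_1_singleton_iff)
    then have Te: "T = {x, y, z}" "y \<notin> Sp" "y \<in> T" using xz p(3) by auto
    have ne: "x \<noteq> y" "y \<noteq> z" "p \<noteq> x" "p \<noteq> y" "p \<noteq> z" using Te xz p(1) by auto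
    define M where "M = {{x, y}, {p, z}}"
    have ME: "M \<subseteq> E" using T(2)[of x y] p(2)[of z] Te xz ne by (auto simp: M_def)
    have dgM: "deg M u = of_bool (u \<in> insert p T)" for u
      using ne xz Te unfolding M_def by (auto simp: deg_insert doubleton_eq_iff)
    have "\<exists>t'. decomp (E0 \<union> M) n t' \<and> (\<forall>u. u \<notin> insert p T \<longrightarrow> t' u = t u) \<and> 2 \<le> t' p"
      if E0: "E0 \<subseteq> E - M" and st0: "decomp E0 n t" and tp: "1 \<le> t p" and tT: "\<forall>u\<in>T. 1 \<le> t u"
        and tN: "\<forall>u v. v \<in> insert p T \<longrightarrow> {v, u} \<in> E0 \<longrightarrow> u \<notin> T \<longrightarrow> 1 \<le> t u" for E0 n t
    proof -
      have n1: "{x, y} \<notin> E0" "{p, z} \<notin> E0" using E0 by (auto simp: M_def)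
      define t1 where "t1 = t(x := t x + 1, y := t y - 1)"
      have s1: "decomp (insert {x, y} E0) n t1" unfolding t1_def
      proof (rule augment_edge_no_zeros[OF st0 ne(1) n1(1)])
        show "1 \<le> t y" using tT Te by blast
        fix v assume "{x, v} \<in> E0"
        then show "1 \<le> t v" using tT tN Te by blast
      qed
      have "decomp (insert {p, z} (insert {x, y} E0)) n (t1(p := t1 p + 1, z := t1 z - 1))"
      proof (rule augment_edge_no_zeros[OF s1 ne(5)])
        show "{p, z} \<notin> insert {x, y} E0" using n1 ne by (auto simp: doubleton_eq_iff)
        show "1 \<le> t1 z" using tT Te ne xz by (auto simp: t1_def)
        fix v assume v: "{p, v} \<in> insert {x, y} E0"
        then have v0: "{p, v} \<in> E0" using ne by (auto simp: doubleton_eq_iff)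
        show "1 \<le> t1 v"
        proof (cases "v \<in> T")
          case True
          then have "v \<in> Sp" using p(2) v0 E0 by blast
          then have "v = x" using xz n1 v0 by auto
          then show ?thesis using tT Te ne by (auto simp: t1_def)
        next
          case False
          then have "1 \<le> t v" using tN v0 by blast
          then show ?thesis using False Te by (auto simp: t1_def)
        qed
      qed
      moreover have "insert {p, z} (insert {x, y} E0) = E0 \<union> M" by (auto simp: M_def)
      moreover have "\<forall>u. u \<notin> insert p T \<longrightarrow> (t1(p := t1 p + 1, z := t1 z - 1)) u = t u"
        using Te by (auto simp: t1_def)
      moreover have "2 \<le> (t1(p := t1 p + 1, z := t1 z - 1)) p" using ne tp by (auto simp: t1_def)
      ultimately show ?thesis by metis
    qed
    moreover have "\<forall>e\<in>M. e \<subseteq> insert p T" using Te by (auto simp: M_def)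
    moreover have "\<forall>u. odd (deg M u) \<longleftrightarrow> u \<in> insert p T" using dgM by simp
    ultimately have "gadget E p T M" unfolding gadget_def using ME by blast
    then show ?thesis by blast
  qed
qed

text \<open>Deleting \<open>qr\<close> together with the gadget makes a path end at \<open>q\<close>; the additional end at \<open>q\<close> then pays for
  inserting \<open>qr\<close>.\<close>

lemma reduce_tight:
  assumes sgE: "graph_on V E" and tri: "tri_isolated E"
    and T: "even (deg E v0)" "even_nbrs E v0 \<noteq> {}" "T = insert v0 (even_nbrs E v0)"
    and q: "odd (deg E q)" "even_nbrs E q \<subseteq> T" and r: "{q, r} \<in> E" "odd (deg E r)" "even_nbrs E r \<inter> T = {}"
    and Mq: "gadget E q T Mq"
    and T2: "T2 = {} \<and> Mr = {} \<and> even_nbrs E r = {} \<or>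
        (\<exists>v. even (deg E v) \<and> even_nbrs E v \<noteq> {} \<and> T2 = insert v (even_nbrs E v)) \<and> gadget E r T2 Mr \<and> even_nbrs E r \<subseteq> T2"
      "T \<inter> T2 = {}"
  shows "\<exists>E'. reduces E E' \<and> tri_isolated E' \<and> (obstructed E' \<longrightarrow> obstructed E)"
proof -
  note finE = graph_on_finite[OF sgE]
  have evT: "even (deg E u) \<and> insert u (even_nbrs E u) = T" if "u \<in> T" for u
    using that T tri_isolated_eq[OF tri T(1)] by (auto simp: in_even_nbrs)
  have evT2: "even (deg E u) \<and> insert u (even_nbrs E u) = T2" if u2: "u \<in> T2" for u
  proof -
    obtain v where "even (deg E v)" "T2 = insert v (even_nbrs E v)" using T2 u2 by auto
    then show ?thesis using u2 tri_isolated_eq[OF tri, of v] by (auto simp: in_even_nbrs)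
  qed
  have qr: "q \<noteq> r" using graph_on_edge[OF sgE r(1)] by auto
  have qT: "q \<notin> T" "q \<notin> T2" "r \<notin> T" "r \<notin> T2" using evT evT2 q(1) r(2) by blast+
  have even_nbrs_r: "even_nbrs E r \<subseteq> T2" using T2 by auto
  have MqE: "Mq \<subseteq> E" "\<And>e. e \<in> Mq \<Longrightarrow> e \<subseteq> insert q T" "\<And>u. odd (deg Mq u) \<longleftrightarrow> u \<in> insert q T"
    using gadgetD[OF Mq] by blast+
  have MrE: "Mr \<subseteq> E" "\<And>e. e \<in> Mr \<Longrightarrow> e \<subseteq> insert r T2" "\<And>u. odd (deg Mr u) \<longleftrightarrow> Mr \<noteq> {} \<and> u \<in> insert r T2"
  proof -
    have "Mr = {} \<or> gadget E r T2 Mr" using T2(1) by blast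
    then show "Mr \<subseteq> E" "\<And>e. e \<in> Mr \<Longrightarrow> e \<subseteq> insert r T2" using gadgetD[of E r T2 Mr] by blast+
    have "Mr \<noteq> {}" if "gadget E r T2 Mr"
    proof
      assume "Mr = {}"
      moreover have "odd (deg Mr r)" using that unfolding gadget_def by blast
      ultimately show False by simp
    qed
    then show "odd (deg Mr u) \<longleftrightarrow> Mr \<noteq> {} \<and> u \<in> insert r T2" for u
      using \<open>Mr = {} \<or> gadget E r T2 Mr\<close> unfolding gadget_def by (cases "Mr = {}") auto
  qed
  have Mr0: "T2 = {}" if "Mr = {}" using T2(1) that MrE(3)[of r] unfolding gadget_def by auto
  \<comment> \<open>An odd number of gadget edges together with \<open>qr\<close> keeps
    \<open>q\<close> odd. The same holds for \<open>r\<close> if it has a gadget of its own;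
    otherwise \<open>r\<close> turns even, but then it has no even neighbours.\<close>
  define D where "D = insert {q, r} (Mq \<union> Mr)"
  define E' where "E' = E - D"
  have DE: "D \<subseteq> E" using MqE(1) MrE(1) r(1) by (auto simp: D_def)
  have dis: "Mq \<inter> Mr = {}" "{q, r} \<notin> Mq" "{q, r} \<notin> Mr"
  proof -
    show "Mq \<inter> Mr = {}"
    proof (rule ccontr)
      assume "Mq \<inter> Mr \<noteq> {}"
      then obtain e where e: "e \<in> Mq" "e \<in> Mr" by blast
      then have "e \<subseteq> insert q T \<inter> insert r T2" using MqE(2) MrE(2) by blast
      then have "e = {}" using qT qr T2(2) by blast
      moreover have "card e = 2" using sgE e MqE(1) by (auto simp: graph_on_def)
      ultimately show False by simp
    qed
    show "{q, r} \<notin> Mq" "{q, r} \<notin> Mr" using MqE(2)[of "{q, r}"] MrE(2)[of "{q, r}"] qT qr by blast+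
  qed
  have finM: "finite Mq" "finite Mr" using MqE(1) MrE(1) finE finite_subset by blast+
  have dgD: "deg D u = deg Mq u + deg Mr u + of_bool (u \<in> {q, r})" for u
    unfolding D_def using deg_insert[of "Mq \<union> Mr" "{q, r}" u] deg_Un[of Mq Mr u] finM dis by auto
  have par: "even (deg E' u) \<longleftrightarrow> (even (deg E u) \<and> u \<notin> T \<union> T2) \<or> (u = r \<and> Mr = {})" for u
  proof -
    have "odd (deg D u) \<longleftrightarrow> u \<in> T \<union> T2 \<or> (u = r \<and> Mr = {})"
      using dgD[of u] MqE(3)[of u] MrE(3)[of u] qT qr Mr0 T2(2) by auto
    then show ?thesis using even_dg_Diff[OF finE DE, of u] evT[of u] evT2[of u] r(2) unfolding E'_def by auto
  qed
  have sub: "E' \<subseteq> E" by (auto simp: E'_def)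
  have Dv: "e \<subseteq> insert q (insert r (T \<union> T2))" if "e \<in> D" for e
    using that MqE(2)[of e] MrE(2)[of e] unfolding D_def by blast
  have even_nbrs_r': "even_nbrs E' r = {}" if "Mr = {}"
  proof -
    have False if w: "{r, w} \<in> E'" "even (deg E' w)" for w
    proof -
      have "w \<noteq> r" using w(1) sub graph_on_edge[OF sgE, of r w] by auto
      then have "w \<in> even_nbrs E r" using w sub par[of w] by (auto simp: in_even_nbrs)
      then show False using even_nbrs_r Mr0 \<open>Mr = {}\<close> by blast
    qed
    then show ?thesis unfolding even_nbrs_def by blast
  qed
  have enb': "even_nbrs E' u = even_nbrs E u" if u: "even (deg E u)" "u \<notin> T \<union> T2" for u
  proof (intro set_eqI iffI)
    fix w assume w: "w \<in> even_nbrs E' u"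
    have "w \<noteq> r"
    proof
      assume "w = r"
      then have "u \<in> even_nbrs E r" using w sub u by (auto simp: in_even_nbrs insert_commute)
      then show False using even_nbrs_r u by blast
    qed
    then show "w \<in> even_nbrs E u" using w sub par[of w] by (auto simp: in_even_nbrs)
  next
    fix w assume w: "w \<in> even_nbrs E u"
    have "w \<notin> T" using evT[of w] even_nbrs_sym[OF u(1), of w] w u by (auto simp: in_even_nbrs)
    moreover have "w \<notin> T2" using evT2[of w] even_nbrs_sym[OF u(1), of w] w u by (auto simp: in_even_nbrs)
    moreover have "{u, w} \<notin> D"
    proof
      assume "{u, w} \<in> D"
      then have "u \<in> insert q (insert r (T \<union> T2))" using Dv by blast
      then show False using u q(1) r(2) by auto
    qed
    ultimately show "w \<in> even_nbrs E' u" using w par[of w] by (auto simp: in_even_nbrs E'_def)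
  qed
  have tri': "tri_isolated E'" unfolding tri_isolated_def
  proof (intro allI impI)
    fix u assume ev: "even (deg E' u)"
    show "even_nbrs E' u = {} \<or> (\<exists>y z. y \<noteq> z \<and> even_nbrs E' u = {y, z} \<and> even_nbrs E' y = {u, z} \<and> even_nbrs E' z = {u, y})"
    proof (cases "u = r \<and> Mr = {} \<or> even_nbrs E u = {}")
      case True
      then show ?thesis
      proof
        assume "even_nbrs E u = {}"
        then show ?thesis using ev par[of u] enb'[of u] even_nbrs_r' by (cases "u = r \<and> Mr = {}") auto
      qed (use even_nbrs_r' in auto)
    next
      case False
      then have u: "even (deg E u)" "u \<notin> T \<union> T2" using par[of u] ev by auto
      obtain a b where ab: "a \<noteq> b" "even_nbrs E u = {a, b}" "even_nbrs E a = {u, b}" "even_nbrs E b = {u, a}"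
        using tri u(1) False unfolding tri_isolated_def by metis
      have q: "even (deg E w) \<and> w \<notin> T \<union> T2" if "w \<in> even_nbrs E u" for w
      proof -
        have w: "even (deg E w)" "u \<in> even_nbrs E w" using that u(1) by (auto simp: in_even_nbrs insert_commute)
        then show ?thesis using evT[of w] evT2[of w] u(2) by blast
      qed
      have "even_nbrs E' a = even_nbrs E a" "even_nbrs E' b = even_nbrs E b" using enb' q ab by auto
      then show ?thesis using ab enb'[OF u] by auto
    qed
  qed
  have bad': "obstructed E" if "obstructed E'"
  proof -
    obtain T' K where TK: "obstruction E' T' K" using \<open>obstructed E'\<close> by (auto simp: obstructed_def)
    have T': "card T' = 3" "\<And>u v. u \<in> T' \<Longrightarrow> v \<in> T' \<Longrightarrow> u \<noteq> v \<Longrightarrow> {u, v} \<in> E'" "\<And>u. u \<in> T' \<Longrightarrow> even (deg E' u)"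
      using TK by (auto simp: obstruction_def)
    have nonempty: "even_nbrs E' u \<noteq> {}" if "u \<in> T'" for u
    proof -
      have "\<not> T' \<subseteq> {u}" using T'(1) card_mono[of "{u}" T'] by auto
      then obtain v where "v \<in> T'" "v \<noteq> u" by auto
      then have "v \<in> even_nbrs E' u" using T' that by (auto simp: in_even_nbrs)
      then show ?thesis by blast
    qed
    have Tu: "even (deg E u) \<and> u \<notin> T \<union> T2" if "u \<in> T'" for u
      using T'(3)[OF that] par[of u] nonempty[OF that] even_nbrs_r' by auto
    have nbrs: "\<exists>u\<in>T'. {w, u} \<in> E'" if "w \<in> K - T'" for w
    proof -
      have "2 \<le> card {v \<in> T'. {w, v} \<in> E'}" using TK that by (auto simp: obstruction_def)
      then have "{v \<in> T'. {w, v} \<in> E'} \<noteq> {}" by (metis card.empty not_numeral_le_zero)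
      then show ?thesis by blast
    qed
    have "w \<notin> K" if w: "w \<in> insert q (insert r (T \<union> T2))" for w
    proof
      assume "w \<in> K"
      have "w \<notin> T'" using Tu[of w] w q(1) r(2) by auto
      then obtain u where u: "u \<in> T'" "{w, u} \<in> E'" using nbrs \<open>w \<in> K\<close> by blast
      then have "u \<in> even_nbrs E w" using sub Tu by (auto simp: in_even_nbrs)
      then show False using Tu[OF u(1)] w q(2) even_nbrs_r evT[of w] evT2[of w] by blast
    qed
    then have "e \<inter> K = {}" if "e \<in> E - E'" for e
      using that Dv[of e] by (auto simp: E'_def)
    then show ?thesis using obstruction_mono[OF TK sub] by (auto simp: obstructed_def)
  qed
  have psub: "E' \<subset> E" using r(1) by (auto simp: E'_def D_def)
  have "\<exists>t'. decomp E n t'" if st0: "decomp E' n t" for n t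
  proof -
    have tod: "1 \<le> t u" if "u \<in> T \<union> T2 \<or> (odd (deg E u) \<and> (u \<noteq> r \<or> Mr \<noteq> {}))" for u
      using decomp_odd_pos[OF st0, of u] par[of u] that qT Mr0 by auto
    have "\<exists>t'. decomp (E' \<union> Mq) n t' \<and> (\<forall>u. u \<notin> insert q T \<longrightarrow> t' u = t u) \<and> 2 \<le> t' q"
    proof -
      have c1: "E' \<subseteq> E - Mq" by (auto simp: E'_def D_def)
      have c2: "1 \<le> t q" "\<forall>u\<in>T. 1 \<le> t u" using tod q(1) qr by auto
      have c3: "\<forall>u v. v \<in> insert q T \<longrightarrow> {v, u} \<in> E' \<longrightarrow> u \<notin> T \<longrightarrow> 1 \<le> t u"
      proof (intro allI impI)
        fix u v assume v: "v \<in> insert q T" "{v, u} \<in> E'" "u \<notin> T"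
        have "odd (deg E u)"
        proof (rule ccontr)
          assume "\<not> odd (deg E u)"
          then have "u \<in> even_nbrs E v" using v(2) sub by (auto simp: in_even_nbrs)
          then show False using v q(2) evT[of v] by blast
        qed
        moreover have "u \<noteq> r"
        proof
          assume "u = r"
          then have "v \<noteq> q" using v(2) by (auto simp: E'_def D_def)
          then have "v \<in> even_nbrs E r" using v \<open>u = r\<close> sub evT[of v] by (auto simp: in_even_nbrs insert_commute)
          then show False using r(3) v \<open>v \<noteq> q\<close> by blast
        qed
        ultimately show "1 \<le> t u" using tod by blast
      qed
      show ?thesis by (rule gadget_add[OF Mq c1 st0 c2 c3])
    qed
    then obtain t1 where st1: "decomp (E' \<union> Mq) n t1" and t1: "\<And>u. u \<notin> insert q T \<Longrightarrow> t1 u = t u" "2 \<le> t1 q" by blast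
    define t2 where "t2 = t1(r := t1 r + 1, q := t1 q - 1)"
    define E2 where "E2 = insert {r, q} (E' \<union> Mq)"
    \<comment> \<open>The neighbours of \<open>r\<close> avoid \<open>T\<close>, so the zeros that
      the gadget at \<open>q\<close> may have left behind are not seen from
      \<open>r\<close>.\<close>
    have rN: "u \<noteq> q \<and> u \<noteq> r \<and> 1 \<le> t1 u" if u: "{r, u} \<in> E' \<union> Mq" for u
    proof -
      have uE: "{r, u} \<in> E'" using u MqE(2)[of "{r, u}"] qT qr by auto
      have uq: "u \<noteq> q" using uE by (auto simp: E'_def D_def insert_commute)
      have ur: "u \<noteq> r" using uE sub graph_on_edge[OF sgE, of r u] by auto
      have uE2: "{r, u} \<in> E" using uE sub by blast
      have "u \<in> T2 \<or> odd (deg E u)" using uE2 even_nbrs_r unfolding even_nbrs_def by blast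
      then have "1 \<le> t u" using tod ur by blast
      moreover have "u \<notin> T" using uE2 r(3) evT[of u] unfolding even_nbrs_def by blast
      ultimately show ?thesis using t1(1)[of u] uq ur by auto
    qed
    have st2: "decomp E2 n t2" unfolding t2_def E2_def
    proof (rule augment_edge_no_zeros[OF st1])
      show "r \<noteq> q" using qr by simp
      show "{r, q} \<notin> E' \<union> Mq" using dis by (auto simp: E'_def D_def insert_commute)
      show "1 \<le> t1 q" using t1(2) by simp
    qed (use rN in blast)
    show ?thesis
    proof (cases "Mr = {}")
      case True
      then have "E2 = E" using DE unfolding E2_def E'_def D_def by (auto simp: insert_commute)
      then show ?thesis using st2 by blast
    next
      case False
      then have Mr: "gadget E r T2 Mr" using T2(1) by blast
      have c1: "E2 \<subseteq> E - Mr" using dis r(1) MqE(1) by (auto simp: E2_def E'_def D_def insert_commute)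
      have "t1 r = t r" using t1(1)[of r] qT qr by auto
      then have t2r: "1 \<le> t2 r" using tod[of r] False r(2) qr by (auto simp: t2_def)
      \<comment> \<open>This is why a gadget leaves two ends: one pays for \<open>qr\<close>, the
        other keeps \<open>q\<close> positive as a neighbour of \<open>r\<close> when the gadget at
        \<open>r\<close> is inserted.\<close>
      have t2q: "1 \<le> t2 q" using t1(2) by (auto simp: t2_def)
      have t2u: "t2 u = t u" if "u \<notin> T" "u \<noteq> q" "u \<noteq> r" for u using that t1(1)[of u] by (auto simp: t2_def)
      have c2: "\<forall>u\<in>T2. 1 \<le> t2 u"
      proof
        fix u assume u: "u \<in> T2"
        then have "t2 u = t u" using t2u[of u] T2(2) qT by blast
        then show "1 \<le> t2 u" using tod u by simp
      qed
      have c3: "\<forall>u v. v \<in> insert r T2 \<longrightarrow> {v, u} \<in> E2 \<longrightarrow> u \<notin> T2 \<longrightarrow> 1 \<le> t2 u"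
      proof (intro allI impI)
        fix u v assume v: "v \<in> insert r T2" "{v, u} \<in> E2" "u \<notin> T2"
        show "1 \<le> t2 u"
        proof (cases "u = q \<or> u = r")
          case True then show ?thesis using t2q t2r by auto
        next
          case False
          show ?thesis
          proof (cases "v = r")
            case True
            then have "{r, u} \<in> E' \<union> Mq" using v False by (auto simp: E2_def doubleton_eq_iff)
            then show ?thesis using rN[of u] by (auto simp: t2_def)
          next
            case vr: False
            then have vT: "v \<in> T2" "v \<notin> insert q T" using v T2(2) qT by auto
            then have "{v, u} \<in> E'" using v(2) False MqE(2)[of "{v, u}"] vr by (auto simp: E2_def doubleton_eq_iff)
            then have uE: "{v, u} \<in> E" using sub by blast
            have "odd (deg E u)" using uE evT2[OF vT(1)] v(3) by (auto simp: in_even_nbrs)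
            then have "1 \<le> t u" "u \<notin> T" using tod False evT by auto
            then show ?thesis using t2u False by simp
          qed
        qed
      qed
      have "\<exists>t'. decomp (E2 \<union> Mr) n t'" using gadget_add[OF Mr c1 st2 t2r c2 c3] by blast
      moreover have "E2 \<union> Mr = E" using DE unfolding E2_def E'_def D_def by (auto simp: insert_commute)
      ultimately show ?thesis by simp
    qed
  qed
  then have "reduces E E'" using psub unfolding reduces_def by blast
  then show ?thesis using tri' bad' by blast
qed

text \<open>If neither \<open>lovasz\<close> nor \<open>reduce_star\<close> applies, every odd
  vertex with an even neighbour is tied to a single even triangle. The odd vertices \<open>Q\<close>
  tied to a triangle \<open>T\<close> then either have an edge leaving \<open>T \<union> Q\<close>,
  which is the input of \<open>reduce_tight\<close>, or \<open>T \<union> Q\<close> is closed and is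
  an obstruction.\<close>

lemma tri_isolated_good:
  assumes "graph_on V E" "tri_isolated E" "\<not> obstructed E"
  shows "half_decomposable V E"
  using assms
proof (induction "card E" arbitrary: E rule: less_induct)
  case less
  note sgE = less.prems(1) and tri = less.prems(2) and nbad = less.prems(3)
  have step: "half_decomposable V E" if "\<exists>E'. reduces E E' \<and> tri_isolated E' \<and> (obstructed E' \<longrightarrow> obstructed E)"
  proof -
    obtain E' where E': "reduces E E'" "tri_isolated E'" "obstructed E' \<longrightarrow> obstructed E" using \<open>\<exists>E'. _\<close> by blast
    have sub: "E' \<subset> E" using E'(1) by (simp add: reduces_def)
    then have "card E' < card E" using graph_on_finite[OF sgE] psubset_card_mono by blast
    then have "half_decomposable V E'" using less.hyps[of E'] graph_on_subset[OF sgE] sub E' nbad by blast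
    then show ?thesis using E'(1) unfolding half_decomposable_def reduces_def by blast
  qed
  show ?case
  proof (cases "\<forall>u v. {u, v} \<in> E \<longrightarrow> odd (deg E u) \<or> odd (deg E v)")
    case True
    then show ?thesis using lovasz[OF sgE] by blast
  next
    case False
    then obtain v0 w0 where v0: "even (deg E v0)" "w0 \<in> even_nbrs E v0" by (auto simp: in_even_nbrs)
    define T where "T = insert v0 (even_nbrs E v0)"
    have ne: "even_nbrs E v0 \<noteq> {}" using v0 by blast
    have evT: "even (deg E u) \<and> insert u (even_nbrs E u) = T" if "u \<in> T" for u
      using that v0 tri_isolated_eq[OF tri v0(1)] by (auto simp: T_def in_even_nbrs)
    have tri_edge: "{u, v} \<in> E" if "even (deg E w)" "u \<in> insert w (even_nbrs E w)" "v \<in> insert w (even_nbrs E w)" "u \<noteq> v" for u v w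
      using tri_isolated_edge[OF sgE tri that] by (simp add: in_even_nbrs)
    have tri3: "card (insert w (even_nbrs E w)) = 3" if "even (deg E w)" "even_nbrs E w \<noteq> {}" for w
      using tri_isolated_card[OF tri that] not_in_even_nbrs[OF sgE, of w] finite_even_nbrs[OF sgE, of w] by simp
    show ?thesis
    proof (cases "\<exists>p. odd (deg E p) \<and> even_nbrs E p \<noteq> {} \<and>
        (\<forall>v. even (deg E v) \<longrightarrow> even_nbrs E p \<subseteq> insert v (even_nbrs E v) \<longrightarrow> card (even_nbrs E p) < 2)")
      case True
      then show ?thesis using step reduce_star[OF sgE tri] by blast
    next
      case tight: False
      \<comment> \<open>All even neighbours of \<open>p\<close> lie in one component of the even
        subgraph and number at least two, so this component is a triangle and not a single
        vertex.\<close>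
      have inT: "even_nbrs E p \<subseteq> insert w (even_nbrs E w) \<and> 2 \<le> card (even_nbrs E p)"
        if p: "odd (deg E p)" "even (deg E w)" "u \<in> even_nbrs E p" "u \<in> insert w (even_nbrs E w)" for p u w
      proof -
        obtain v where v: "even (deg E v)" "even_nbrs E p \<subseteq> insert v (even_nbrs E v)" "2 \<le> card (even_nbrs E p)"
          using tight p by (metis not_less empty_iff)
        have "insert v (even_nbrs E v) = insert u (even_nbrs E u)"
          using tri_isolated_eq[OF tri v(1), of u] v(2) p(3) by blast
        also have "\<dots> = insert w (even_nbrs E w)" using tri_isolated_eq[OF tri p(2), of u] p(4) by blast
        finally show ?thesis using v by simp
      qed
      have gad: "\<exists>M. gadget E p (insert w (even_nbrs E w)) M"
        if p: "odd (deg E p)" "even (deg E w)" "even_nbrs E w \<noteq> {}" "u \<in> even_nbrs E p" "u \<in> insert w (even_nbrs E w)" for p u w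
      proof (rule gadget_exists[OF sgE tri3[OF p(2,3)], where Sp = "even_nbrs E p"])
        show "{u, v} \<in> E" if "u \<in> insert w (even_nbrs E w)" "v \<in> insert w (even_nbrs E w)" "u \<noteq> v" for u v
          using tri_edge[OF p(2) that] .
        show "p \<notin> insert w (even_nbrs E w)" using p by (auto simp: in_even_nbrs)
        show "({p, u} \<in> E) = (u \<in> even_nbrs E p)" if "u \<in> insert w (even_nbrs E w)" for u
          using that p(2) by (auto simp: in_even_nbrs)
      qed (use inT[OF p(1,2,4,5)] in auto)
      define Q where "Q = {q. odd (deg E q) \<and> even_nbrs E q \<inter> T \<noteq> {}}"
      show ?thesis
      proof (cases "\<exists>q\<in>Q. \<exists>r. {q, r} \<in> E \<and> r \<notin> T \<union> Q")
        case True
        then obtain q r where qr: "q \<in> Q" "{q, r} \<in> E" "r \<notin> T" "r \<notin> Q" by blast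
        then obtain u where u: "odd (deg E q)" "u \<in> even_nbrs E q" "u \<in> T" by (auto simp: Q_def)
        have eq: "even_nbrs E q \<subseteq> T" using inT[OF u(1) v0(1) u(2)] u(3) by (auto simp: T_def)
        have r: "odd (deg E r)" "even_nbrs E r \<inter> T = {}" using qr eq by (auto simp: in_even_nbrs Q_def)
        obtain Mq where Mq: "gadget E q T Mq" using gad[OF u(1) v0(1) ne u(2)] u(3) by (auto simp: T_def)
        have "\<exists>T2 Mr. (T2 = {} \<and> Mr = {} \<and> even_nbrs E r = {} \<or>
          (\<exists>v. even (deg E v) \<and> even_nbrs E v \<noteq> {} \<and> T2 = insert v (even_nbrs E v)) \<and> gadget E r T2 Mr \<and> even_nbrs E r \<subseteq> T2) \<and> T \<inter> T2 = {}"
        proof (cases "even_nbrs E r = {}")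
          case False
          then obtain w where w: "w \<in> even_nbrs E r" by blast
          have ew: "even (deg E w)" using w by (simp add: in_even_nbrs)
          have i: "even_nbrs E r \<subseteq> insert w (even_nbrs E w)" "2 \<le> card (even_nbrs E r)" using inT[OF r(1) ew w] by auto
          then have "even_nbrs E w \<noteq> {}" by auto (metis One_nat_def Suc_1 card_mono finite.emptyI finite.insertI is_singletonI is_singleton_altdef not_less_eq_eq)
          then obtain Mr where "gadget E r (insert w (even_nbrs E w)) Mr" using gad[OF r(1) ew _ w] by auto
          moreover have "T \<inter> insert w (even_nbrs E w) = {}"
          proof (rule ccontr)
            assume "T \<inter> insert w (even_nbrs E w) \<noteq> {}"
            then obtain u where "u \<in> T" "u \<in> insert w (even_nbrs E w)" by blast
            then have "insert w (even_nbrs E w) = T" using tri_isolated_eq[OF tri ew, of u] evT[of u] by auto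
            then show False using w r(2) by blast
          qed
          ultimately show ?thesis using ew \<open>even_nbrs E w \<noteq> {}\<close> i by blast
        qed blast
        then obtain T2 Mr where "T2 = {} \<and> Mr = {} \<and> even_nbrs E r = {} \<or>
          (\<exists>v. even (deg E v) \<and> even_nbrs E v \<noteq> {} \<and> T2 = insert v (even_nbrs E v)) \<and> gadget E r T2 Mr \<and> even_nbrs E r \<subseteq> T2" "T \<inter> T2 = {}" by blast
        from reduce_tight[OF sgE tri v0(1) ne T_def u(1) eq qr(2) r Mq this] show ?thesis by (rule step)
      next
        case closed: False
        have "obstruction E T (T \<union> Q)" unfolding obstruction_def
        proof (intro conjI ballI impI)
          show "card T = 3" using tri3[OF v0(1) ne] by (simp add: T_def)
          show "{u, v} \<in> E" if "u \<in> T" "v \<in> T" "u \<noteq> v" for u v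
            using tri_edge[OF v0(1)] that by (simp add: T_def)
          show "even (deg E v)" if "v \<in> T" for v using evT that by blast
        next
          fix q assume "q \<in> T \<union> Q - T"
          then obtain u where u: "odd (deg E q)" "u \<in> even_nbrs E q" "u \<in> T" by (auto simp: Q_def)
          show "odd (deg E q)" by fact
          have i: "even_nbrs E q \<subseteq> T" "2 \<le> card (even_nbrs E q)" using inT[OF u(1) v0(1) u(2)] u(3) by (auto simp: T_def)
          have "{v \<in> T. {q, v} \<in> E} = even_nbrs E q" using i(1) evT by (auto simp: in_even_nbrs)
          then show "2 \<le> card {v \<in> T. {q, v} \<in> E}" using i by simp
        next
          fix e assume e: "e \<in> E" "e \<inter> (T \<union> Q) \<noteq> {}"
          then obtain v where v: "v \<in> e" "v \<in> T \<union> Q" by blast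
          obtain u where u: "e = {v, u}" using graph_on_edgeE[OF sgE e(1) v(1)] by blast
          have "u \<in> T \<union> Q"
          proof (cases "v \<in> Q")
            case True
            then show ?thesis using closed e(1) u by blast
          next
            case False
            then have vT: "v \<in> T" using v by blast
            show ?thesis
            proof (cases "even (deg E u)")
              case True
              then have "u \<in> even_nbrs E v" using e(1) u by (auto simp: in_even_nbrs)
              then show ?thesis using evT[OF vT] by blast
            next
              case False
              have "v \<in> even_nbrs E u" using e(1) u evT[OF vT] by (auto simp: in_even_nbrs insert_commute)
              then show ?thesis using False vT by (auto simp: Q_def)
            qed
          qed
          then show "e \<subseteq> T \<union> Q" using v u by blast
        qed blast
        then show ?thesis using nbad by (auto simp: obstructed_def)
      qed
    qed
  qed
qed

section \<open>Reductions inside the even subgraph\<close>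

text \<open>All vertices covered by \<open>M\<close> turn from even to odd and no other parity
  changes, so the even subgraph simply loses these vertices.\<close>

definition even_removal :: "'v set set \<Rightarrow> 'v set set \<Rightarrow> bool" where
  "even_removal E M \<longleftrightarrow> M \<subseteq> E \<and> (\<forall>u. odd (deg M u) \<longleftrightarrow> u \<in> \<Union>M) \<and> (\<forall>u\<in>\<Union>M. even (deg E u))"

definition even_reduction :: "'v set set \<Rightarrow> 'v set set \<Rightarrow> bool" where
  "even_reduction E M \<longleftrightarrow> even_removal E M \<and> reduces E (E - M)"

lemma even_removal_even:
  assumes "finite E" "even_removal E M"
  shows "even (deg (E - M) u) \<longleftrightarrow> even (deg E u) \<and> u \<notin> \<Union>M"
proof -
  have "odd (deg M u) \<longleftrightarrow> u \<in> \<Union>M" "u \<in> \<Union>M \<Longrightarrow> even (deg E u)" "M \<subseteq> E"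
    using assms(2) unfolding even_removal_def by blast+
  then show ?thesis using even_dg_Diff[OF assms(1), of M u] by blast
qed

text \<open>Apart from \<open>y i\<close>, the even neighbours of \<open>x i\<close> are vertices
  \<open>x j\<close>. These become odd and gain an end when their edges are inserted, so no zero
  ever appears around \<open>x i\<close>.\<close>

lemma even_reduction_pairs:
  assumes sgE: "graph_on V E" and I: "finite I" "I \<noteq> {}" "inj_on x I" "inj_on y I" "x ` I \<inter> y ` I = {}"
    and e: "\<And>i. i \<in> I \<Longrightarrow> even (deg E (x i)) \<and> y i \<in> even_nbrs E (x i) \<and> even_nbrs E (x i) \<subseteq> insert (y i) (x ` I)"
  shows "even_reduction E ((\<lambda>i. {x i, y i}) ` I)"
proof -
  define M where "M = (\<lambda>i. {x i, y i}) ` I"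
  note finE = graph_on_finite[OF sgE]
  have UM: "\<Union>M = x ` I \<union> y ` I" by (auto simp: M_def)
  have ME: "M \<subseteq> E" using e by (auto simp: M_def in_even_nbrs)
  have fr: "even_removal E M" unfolding even_removal_def UM
    using ME deg_pairs[OF I(1,3,4,5)] e by (auto simp: M_def in_even_nbrs)
  have sub: "E - M \<subset> E"
  proof -
    obtain i where "i \<in> I" using I(2) by blast
    then have "{x i, y i} \<in> M" by (auto simp: M_def)
    then show ?thesis using ME by blast
  qed
  have "\<exists>t'. decomp E n t'" if s: "decomp (E - M) n t" for n t
  proof -
    have tU: "1 \<le> t u" if "u \<in> x ` I \<union> y ` I \<or> odd (deg E u)" for u
      using decomp_odd_pos[OF s, of u] even_removal_even[OF finE fr, of u] that unfolding UM by blast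
    have "decomp ((E - M) \<union> (\<lambda>i. {x i, y i}) ` I) n (\<lambda>v. t v + of_bool (v \<in> x ` I) - of_bool (v \<in> y ` I))"
    proof (rule add_pairs[OF I(1) s I(3,4,5)])
      fix i assume i: "i \<in> I"
      show "{x i, y i} \<notin> E - M \<and> 1 \<le> t (y i)" using i tU[of "y i"] by (auto simp: M_def)
      fix v assume v: "{x i, v} \<in> E - M"
      show "1 \<le> t v \<and> v \<notin> y ` I"
      proof (cases "even (deg E v)")
        case True
        then have "v \<in> even_nbrs E (x i)" using v by (auto simp: in_even_nbrs)
        moreover have "v \<noteq> y i" using v i by (auto simp: M_def)
        ultimately have "v \<in> x ` I" using e[OF i] by blast
        then show ?thesis using tU I(5) by blast
      next
        case False
        moreover have "even (deg E (y j))" if "j \<in> I" for j using e[OF that] by (simp add: in_even_nbrs)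
        ultimately show ?thesis using tU by blast
      qed
    qed
    moreover have "(E - M) \<union> (\<lambda>i. {x i, y i}) ` I = E" using ME by (auto simp: M_def)
    ultimately show ?thesis by auto
  qed
  then show ?thesis unfolding even_reduction_def reduces_def M_def[symmetric] using fr sub by blast
qed

lemma even_reduction_leaf:
  assumes "graph_on V E" "even (deg E a)" "even_nbrs E a = {b}"
  shows "\<exists>M. even_reduction E M"
proof -
  have "a \<noteq> b" using not_in_even_nbrs[OF assms(1), of a] assms(3) by auto
  then show ?thesis
    using even_reduction_pairs[OF assms(1), of "{()}" "\<lambda>_. a" "\<lambda>_. b"] assms by auto
qed

text \<open>The edges \<open>ab\<close> and \<open>a'b'\<close> are deleted and \<open>aa'\<close>
  is kept; distinctness of \<open>b\<close> and \<open>b'\<close> makes them a matching.\<close>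

lemma even_reduction_adjacent:
  assumes sgE: "graph_on V E" and e: "even (deg E a)" "even (deg E a')"
    and n: "even_nbrs E a = {a', b}" "even_nbrs E a' = {a, b'}" "b \<noteq> b'" "b \<noteq> a'" "b' \<noteq> a"
  shows "\<exists>M. even_reduction E M"
proof -
  have ne: "a \<noteq> a'" "a \<noteq> b" "a' \<noteq> b'" using not_in_even_nbrs[OF sgE] n by (metis insertCI)+
  define x where "x i = (if i then a else a')" for i
  define y where "y i = (if i then b else b')" for i
  have "even_reduction E ((\<lambda>i. {x i, y i}) ` UNIV)"
  proof (rule even_reduction_pairs[OF sgE])
    show "x ` UNIV \<inter> y ` UNIV = {}" using ne n by (auto simp: x_def y_def)
    fix i :: bool
    have "x ` UNIV = {a, a'}" by (auto simp: x_def)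
    then show "even (deg E (x i)) \<and> y i \<in> even_nbrs E (x i) \<and> even_nbrs E (x i) \<subseteq> insert (y i) (x ` UNIV)"
      using e n by (cases i) (auto simp: x_def y_def)
  qed (use ne n in \<open>auto simp: x_def y_def inj_on_def\<close>)
  then show ?thesis by blast
qed

text \<open>One neighbour \<open>y\<close> may have any degree, because \<open>star_half\<close>
  allows it to be put into the first half. The single outer vertex left has at most two even
  neighbours besides \<open>x\<close>, and three ends at \<open>x\<close> are enough for it.\<close>

lemma even_reduction_star3:
  assumes sgE: "graph_on V E" and x: "even (deg E x)" "card (even_nbrs E x) = 3" "y \<in> even_nbrs E x"
    and d: "\<And>v. v \<in> even_nbrs E x \<Longrightarrow> v \<noteq> y \<Longrightarrow> card (even_nbrs E v) \<le> 3"
  shows "even_reduction E (star x (even_nbrs E x))"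
proof -
  note finE = graph_on_finite[OF sgE]
  define S where "S = even_nbrs E x"
  define M where "M = star x S"
  have S: "finite S" "x \<notin> S" "card S = 3" "y \<in> S" "\<And>s. s \<in> S \<Longrightarrow> {x, s} \<in> E \<and> even (deg E s)"
    using finite_even_nbrs[OF sgE] not_in_even_nbrs[OF sgE] x by (auto simp: S_def in_even_nbrs)
  have UM: "\<Union>M = insert x S" using S(4) by (auto simp: M_def star_def)
  have ME: "M \<subseteq> E" using S(5) by (auto simp: M_def star_def)
  have fr: "even_removal E M" unfolding even_removal_def UM
    using ME deg_star[OF S(1,2)] S x(1) by (auto simp: M_def)
  have "{x, y} \<in> M" using S(4) by (auto simp: M_def star_def)
  then have sub: "E - M \<subset> E" using ME by blast
  have "\<exists>t'. decomp E n t'" if s: "decomp (E - M) n t" for n t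
  proof -
    have tU: "1 \<le> t u" if "u \<in> insert x S \<or> odd (deg E u)" for u
      using decomp_odd_pos[OF s, of u] even_removal_even[OF finE fr, of u] that unfolding UM by blast
    have xS: "{x, v} \<notin> E - M" if "v \<in> S" for v using that by (auto simp: M_def star_def)
    have h1: "{x, v} \<notin> E - M \<and> 1 \<le> t v" if "v \<in> S" for v using xS tU that by blast
    have h2: "1 \<le> t u" if u: "{x, u} \<in> E - M" for u
    proof -
      have "u \<notin> S" using u xS by blast
      then have "odd (deg E u)" using u by (auto simp: S_def in_even_nbrs)
      then show ?thesis using tU by blast
    qed
    obtain W where W: "W \<subseteq> S" "y \<in> W" "card W = (card S + 1) div 2"
      and stW: "decomp ((E - M) \<union> star x W) n (\<lambda>v. t v + (if v = x then int (card W) else 0) - of_bool (v \<in> W))"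
      by (rule star_half[OF s S(1,2) h1 h2 S(4)])
    define t1 where "t1 = (\<lambda>v. t v + (if v = x then int (card W) else 0) - of_bool (v \<in> W))"
    have stW: "decomp ((E - M) \<union> star x W) n t1" using stW by (simp add: t1_def)
    have cW: "card W = 2" "card (S - W) = 1" using W S by (auto simp: card_Diff_subset finite_subset)
    have xW: "x \<notin> W" using W S(2) by blast
    have t1x: "3 \<le> t1 x" using xW cW tU[of x] by (simp add: t1_def)
    have "decomp (((E - M) \<union> star x W) \<union> star x (S - W)) n (\<lambda>v. t1 v - (if v = x then int (card (S - W)) else 0) + of_bool (v \<in> S - W))"
    proof (rule add_star_outer[OF _ stW, where c = 2])
      fix v assume v: "v \<in> S - W"
      then have vx: "v \<noteq> x" "v \<noteq> y" "v \<in> S" using S W by auto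
      show "{x, v} \<notin> (E - M) \<union> star x W \<and> 1 \<le> t1 v"
        using h1[OF vx(3)] v vx by (auto simp: in_star doubleton_eq_iff t1_def)
      have "1 \<le> t1 u" if u: "{v, u} \<in> (E - M) \<union> star x W" "u \<notin> even_nbrs E v - {x}" for u
      proof -
        have E: "{v, u} \<in> E - M" using u(1) v vx by (auto simp: in_star doubleton_eq_iff)
        then have "u \<noteq> x" using xS[OF vx(3)] by (auto simp: insert_commute)
        then have "odd (deg E u)" using u(2) E by (auto simp: in_even_nbrs)
        moreover from this have "u \<notin> W" using S(5) W by blast
        ultimately show ?thesis using tU[of u] \<open>u \<noteq> x\<close> by (simp add: t1_def)
      qed
      moreover have "card (even_nbrs E v - {x}) \<le> 2"
      proof -
        have "x \<in> even_nbrs E v" using S(5)[OF vx(3)] x(1) by (auto simp: in_even_nbrs insert_commute)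
        then show ?thesis using d[of v] vx finite_even_nbrs[OF sgE, of v] by (auto simp: S_def)
      qed
      ultimately show "\<exists>Z. finite Z \<and> card Z \<le> 2 \<and> (\<forall>u. {v, u} \<in> (E - M) \<union> star x W \<longrightarrow> u \<notin> Z \<longrightarrow> 1 \<le> t1 u)"
        using finite_even_nbrs[OF sgE, of v] by (intro exI[of _ "even_nbrs E v - {x}"]) auto
    qed (use S cW t1x in auto)
    moreover have "((E - M) \<union> star x W) \<union> star x (S - W) = E"
      using star_split[OF W(1), of x] ME unfolding M_def by blast
    ultimately show ?thesis by auto
  qed
  then show ?thesis unfolding even_reduction_def reduces_def using fr sub unfolding M_def S_def by blast
qed

section \<open>Obstructions created by removing edges between even vertices\<close>

text \<open>The excluded configuration consists of a vertex \<open>t\<close> and four neighbours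
  that are connected among themselves. It is 2-connected with degree 4 at \<open>t\<close>, hence
  impossible if blocks have maximum degree 3, and it arises when two further even vertices attach to
  the same even triangle.\<close>

definition wheel_free :: "'v set set \<Rightarrow> bool" where
  "wheel_free E \<longleftrightarrow> (\<forall>t y z u w. distinct [t, y, z, u, w] \<longrightarrow> even (deg E t) \<longrightarrow> {y, z, u, w} \<subseteq> even_nbrs E t \<longrightarrow>
     z \<in> even_nbrs E y \<longrightarrow> u \<in> even_nbrs E y \<union> even_nbrs E z \<longrightarrow> w \<in> even_nbrs E y \<union> even_nbrs E z \<longrightarrow> False)"

text \<open>In the even subgraph \<open>T\<close> and \<open>q\<close> span \<open>K\<^sub>4\<close>
  or \<open>K\<^sub>4\<close> minus an edge, and only \<open>q\<close> may be joined to the rest.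
  This is the trace in \<open>E\<close> of an obstruction that arises on removal.\<close>

definition diamond_tip :: "'v set set \<Rightarrow> 'v set \<Rightarrow> 'v \<Rightarrow> bool" where
  "diamond_tip E T q \<longleftrightarrow> card T = 3 \<and> (\<forall>u\<in>T. \<forall>v\<in>T. u \<noteq> v \<longrightarrow> {u, v} \<in> E) \<and> (\<forall>u\<in>T. even (deg E u))
     \<and> q \<notin> T \<and> even (deg E q) \<and> 2 \<le> card {v \<in> T. {q, v} \<in> E} \<and> (\<forall>u\<in>T. even_nbrs E u \<subseteq> insert q T)"

lemma two_of_three_meet:
  assumes "card T = 3" "A \<subseteq> T" "B \<subseteq> T" "2 \<le> card A" "2 \<le> card B"
  shows "A \<inter> B \<noteq> {}"
proof
  assume "A \<inter> B = {}"
  have "finite T" using assms(1) by (metis card.infinite zero_neq_numeral)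
  then have "finite A" "finite B" using assms(2,3) finite_subset by blast+
  then have "card (A \<union> B) = card A + card B" using \<open>A \<inter> B = {}\<close> card_Un_disjoint by blast
  moreover have "card (A \<union> B) \<le> 3" using assms \<open>finite T\<close> card_mono[of T "A \<union> B"] by simp
  ultimately show False using assms by simp
qed

lemma obstructed_atD:
  assumes "obstruction E T K"
  shows "T \<subseteq> K" "card T = 3" "u \<in> T \<Longrightarrow> v \<in> T \<Longrightarrow> u \<noteq> v \<Longrightarrow> {u, v} \<in> E" "u \<in> T \<Longrightarrow> even (deg E u)"
    "q \<in> K - T \<Longrightarrow> odd (deg E q) \<and> 2 \<le> card {v \<in> T. {q, v} \<in> E}" "e \<in> E \<Longrightarrow> e \<inter> K \<noteq> {} \<Longrightarrow> e \<subseteq> K"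
  using assms unfolding obstruction_def by simp_all

text \<open>A new obstruction contains a vertex covered by \<open>M\<close>. It was even and now
  lies in \<open>K - T\<close>, so it sees two vertices of \<open>T\<close>. Two such vertices would
  have a common neighbour \<open>t\<close> in \<open>T\<close>, and together with \<open>T\<close>
  they would form the configuration excluded by \<open>wheel_free\<close>. So there is exactly one,
  and it is the tip.\<close>

lemma new_bad:
  assumes sgE: "graph_on V E" and fr: "even_removal E M" and wf: "wheel_free E" and nbrs: "\<not> obstructed E" and TK: "obstruction (E - M) T K"
  shows "\<exists>q. diamond_tip E T q \<and> K \<inter> \<Union>M = {q} \<and> T \<inter> \<Union>M = {}"
proof -
  note finE = graph_on_finite[OF sgE]
  define E' where "E' = E - M"
  have TK: "obstruction E' T K" using TK by (simp add: E'_def)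
  have ev: "even (deg E' u) \<longleftrightarrow> even (deg E u) \<and> u \<notin> \<Union>M" for u
    unfolding E'_def by (rule even_removal_even[OF finE fr])
  have evM: "even (deg E u)" if "u \<in> \<Union>M" for u using fr that unfolding even_removal_def by blast
  have sub: "E' \<subseteq> E" by (auto simp: E'_def)
  note T = obstructed_atD[OF TK]
  have TE: "even (deg E u)" "u \<notin> \<Union>M" if "u \<in> T" for u using T(4)[OF that] ev by auto
  define U where "U = K \<inter> \<Union>M"
  have UT: "u \<in> K - T" if "u \<in> U" for u using that TE(2) by (auto simp: U_def)
  have Ueq: "{v \<in> T. {u, v} \<in> E} = {v \<in> T. {u, v} \<in> E'}" for u using TE(2) unfolding E'_def by blast
  have Uadj: "2 \<le> card {v \<in> T. {u, v} \<in> E}" if "u \<in> U" for u using T(5)[OF UT[OF that]] Ueq by simp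
  have "U \<noteq> {}"
  proof
    assume "U = {}"
    then have "e \<inter> K = {}" if "e \<in> E - E'" for e using that by (auto simp: U_def E'_def)
    then show False using obstruction_mono[OF TK sub] nbrs by (auto simp: obstructed_def)
  qed
  then obtain q where q: "q \<in> U" by blast
  have uniq: "w = q" if w: "w \<in> U" for w
  proof (rule ccontr)
    assume "w \<noteq> q"
    define A where "A u = {v \<in> T. {u, v} \<in> E}" for u
    have "A q \<inter> A w \<noteq> {}" using two_of_three_meet[OF T(2), of "A q" "A w"] Uadj q w by (auto simp: A_def)
    then obtain t where t: "t \<in> T" "{q, t} \<in> E" "{w, t} \<in> E" by (auto simp: A_def)
    have finT: "finite T" using T(2) by (metis card.infinite zero_neq_numeral)
    have "card (T - {t}) = 2" using t T(2) finT by simp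
    then obtain y z where yz: "T - {t} = {y, z}" "y \<noteq> z" by (auto simp: card_2_iff)
    then have Te: "T = {t, y, z}" "t \<noteq> y" "t \<noteq> z" using t by auto
    have other: "{u, y} \<in> E \<or> {u, z} \<in> E" if "u \<in> U" for u
    proof (rule ccontr)
      assume "\<not> ?thesis"
      then have "{v \<in> T. {u, v} \<in> E} \<subseteq> {t}" using Te by auto
      then have "card {v \<in> T. {u, v} \<in> E} \<le> 1" using card_mono[of "{t}"] by fastforce
      then show False using Uadj[OF that] by simp
    qed
    have eU: "even (deg E u)" "u \<notin> T" if "u \<in> U" for u using that evM UT by (auto simp: U_def)
    have in_y: "u \<in> even_nbrs E y \<union> even_nbrs E z" if "u \<in> U" for u
      using other[OF that] eU[OF that] by (auto simp: in_even_nbrs insert_commute)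
    have "distinct [t, y, z, q, w]" using Te yz q w \<open>w \<noteq> q\<close> eU by auto
    moreover have "{y, z, q, w} \<subseteq> even_nbrs E t"
      using T(3)[of t y] T(3)[of t z] Te sub t TE(1)[of y] TE(1)[of z] eU(1)[OF q] eU(1)[OF w]
      by (auto simp: in_even_nbrs insert_commute)
    moreover have "z \<in> even_nbrs E y" using T(3)[of y z] Te yz sub TE(1)[of z] by (auto simp: in_even_nbrs)
    ultimately show False using wf in_y[OF q] in_y[OF w] TE(1)[OF t(1)] unfolding wheel_free_def by blast
  qed
  have "even_nbrs E u \<subseteq> insert q T" if u: "u \<in> T" for u
  proof
    fix s assume s: "s \<in> even_nbrs E u"
    then have us: "{u, s} \<in> E'" "even (deg E s)" using TE(2)[OF u] by (auto simp: in_even_nbrs E'_def)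
    then have sK: "s \<in> K" using T(6)[OF us(1)] u T(1) by blast
    show "s \<in> insert q T"
    proof (cases "s \<in> \<Union>M")
      case True
      then have "s \<in> U" using sK by (auto simp: U_def)
      then show ?thesis using uniq by blast
    next
      case False
      then have "even (deg E' s)" using ev us by blast
      then show ?thesis using T(5)[of s] sK by blast
    qed
  qed
  moreover have "q \<notin> T" "even (deg E q)" using UT[OF q] evM q by (auto simp: U_def)
  ultimately have "diamond_tip E T q" unfolding diamond_tip_def
    using T(2,3) sub TE(1) Uadj[OF q] by blast
  moreover have "K \<inter> \<Union>M = {q}" using q uniq unfolding U_def by blast
  moreover have "T \<inter> \<Union>M = {}" using TE(2) by blast
  ultimately show ?thesis by blast
qed

text \<open>The star at a vertex \<open>t1\<close> of \<open>T\<close> adjacent to the tip is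
  removed instead; it has three edges and turns all of \<open>T\<close> and \<open>q\<close>
  odd.\<close>

lemma even_reduction_diamond:
  assumes sgE: "graph_on V E" and wf: "wheel_free E" and nbrs: "\<not> obstructed E" and d: "diamond_tip E T q"
  shows "\<exists>M. even_reduction E M \<and> \<not> obstructed (E - M)"
proof -
  have T: "card T = 3" "\<And>u v. u \<in> T \<Longrightarrow> v \<in> T \<Longrightarrow> u \<noteq> v \<Longrightarrow> {u, v} \<in> E" "\<And>u. u \<in> T \<Longrightarrow> even (deg E u)"
    "q \<notin> T" "even (deg E q)" "2 \<le> card {v \<in> T. {q, v} \<in> E}" "\<And>u. u \<in> T \<Longrightarrow> even_nbrs E u \<subseteq> insert q T"
    using d unfolding diamond_tip_def by blast+
  have finT: "finite T" using T(1) by (metis card.infinite zero_neq_numeral)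
  obtain t1 t2 where t: "t1 \<in> T" "t2 \<in> T" "t1 \<noteq> t2" "{q, t1} \<in> E" "{q, t2} \<in> E"
  proof -
    have "\<exists>t1 t2. t1 \<in> {v \<in> T. {q, v} \<in> E} \<and> t2 \<in> {v \<in> T. {q, v} \<in> E} \<and> t1 \<noteq> t2"
    proof -
      obtain A where "A \<subseteq> {v \<in> T. {q, v} \<in> E}" "card A = 2" "finite A"
        by (rule obtain_subset_with_card_n[OF T(6)])
      then show ?thesis by (auto simp: card_2_iff)
    qed
    then show ?thesis using that by blast
  qed
  have e1: "even_nbrs E t1 = insert q (T - {t1})"
  proof
    show "even_nbrs E t1 \<subseteq> insert q (T - {t1})" using T(7)[OF t(1)] not_in_even_nbrs[OF sgE, of t1] by blast
    have "q \<in> even_nbrs E t1" using t(4) T(5) by (simp add: in_even_nbrs insert_commute)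
    moreover have "s \<in> even_nbrs E t1" if "s \<in> T" "s \<noteq> t1" for s using T(2)[OF t(1) that(1)] T(3) that by (simp add: in_even_nbrs)
    ultimately show "insert q (T - {t1}) \<subseteq> even_nbrs E t1" by blast
  qed
  define M where "M = star t1 (even_nbrs E t1)"
  have r: "even_reduction E M" unfolding M_def
  proof (rule even_reduction_star3[OF sgE])
    show "even (deg E t1)" using T(3) t by blast
    show "card (even_nbrs E t1) = 3" unfolding e1 using T(1,4) finT t by simp
    show "q \<in> even_nbrs E t1" unfolding e1 by blast
    fix v assume "v \<in> even_nbrs E t1" "v \<noteq> q"
    then have vT: "v \<in> T" unfolding e1 by blast
    have "even_nbrs E v \<subseteq> insert q (T - {v})" using T(7)[OF vT] not_in_even_nbrs[OF sgE, of v] by blast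
    moreover have "card (insert q (T - {v})) = 3" using T(1,4) finT vT by simp
    ultimately show "card (even_nbrs E v) \<le> 3" using finT card_mono[of "insert q (T - {v})" "even_nbrs E v"] by auto
  qed
  have UM: "\<Union>M = insert q T" using t unfolding M_def e1 star_def by auto
  have "\<not> obstructed (E - M)"
  proof
    assume "obstructed (E - M)"
    then obtain T' K where TK: "obstruction (E - M) T' K" by (auto simp: obstructed_def)
    have "even_removal E M" using r by (simp add: even_reduction_def)
    \<comment> \<open>Another new obstruction would contain exactly one vertex of
      \<open>insert q T\<close>. It cannot be in \<open>T\<close>, whose even neighbours are all
      covered by \<open>M\<close>, and it cannot be \<open>q\<close>, which is still joined to
      \<open>t2\<close>.\<close>
    from new_bad[OF sgE this wf nbrs TK] obtain q' where q': "diamond_tip E T' q'" "K \<inter> \<Union>M = {q'}" "T' \<inter> \<Union>M = {}" by blast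
    have "{v \<in> T'. {q', v} \<in> E} \<noteq> {}" using q'(1) unfolding diamond_tip_def by (metis card.empty not_numeral_le_zero)
    then obtain v where v: "v \<in> T'" "{q', v} \<in> E" by blast
    then have "v \<in> even_nbrs E q'" using q'(1) unfolding diamond_tip_def by (auto simp: in_even_nbrs)
    then have "q' \<notin> T" using T(7)[of q'] v q'(3) UM by blast
    then have "q' = q" using q'(2) UM by blast
    then have "q \<in> K" using q'(2) by blast
    moreover have "{q, t2} \<in> E - M"
    proof -
      have "q \<noteq> t1" "t2 \<noteq> t1" using T(4) t by auto
      then have "{q, t2} \<notin> M" unfolding M_def star_def by (auto simp: doubleton_eq_iff)
      then show ?thesis using t by blast
    qed
    ultimately have "t2 \<in> K" using obstructed_atD(6)[OF TK, of "{q, t2}"] by blast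
    then have "t2 \<in> K \<inter> \<Union>M" using UM t by blast
    then have "t2 = q" unfolding q'(2) \<open>q' = q\<close> by simp
    then show False using T(4) t by blast
  qed
  then show ?thesis using r by blast
qed

text \<open>\<open>C\<close> is any property inherited under removals that provides reductions and
  excludes wheels. A reduction that would create an obstruction is exchanged for the star at the
  diamond that causes it.\<close>

lemma reducible_good:
  assumes mono: "\<And>E M. C E \<Longrightarrow> even_removal E M \<Longrightarrow> finite E \<Longrightarrow> C (E - M)"
    and wf: "\<And>E. C E \<Longrightarrow> graph_on V E \<Longrightarrow> wheel_free E"
    and irr: "\<And>E. C E \<Longrightarrow> graph_on V E \<Longrightarrow> tri_isolated E \<or> (\<exists>M. even_reduction E M)"
    and "graph_on V E" "C E" "\<not> obstructed E"
  shows "half_decomposable V E"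
  using assms(4-6)
proof (induction "card E" arbitrary: E rule: less_induct)
  case less
  note sgE = less.prems(1)
  note finE = graph_on_finite[OF sgE]
  show ?case
  proof (cases "tri_isolated E")
    case True
    then show ?thesis using tri_isolated_good less.prems by blast
  next
    case False
    then obtain M0 where M0: "even_reduction E M0" using irr less.prems by blast
    have "\<exists>M. even_reduction E M \<and> \<not> obstructed (E - M)"
    proof (cases "obstructed (E - M0)")
      case True
      then obtain T K where "obstruction (E - M0) T K" by (auto simp: obstructed_def)
      moreover have "even_removal E M0" using M0 by (simp add: even_reduction_def)
      ultimately obtain q where "diamond_tip E T q" using new_bad[OF sgE _ wf[OF less.prems(2) sgE] less.prems(3)] by blast
      then show ?thesis using even_reduction_diamond[OF sgE wf[OF less.prems(2) sgE] less.prems(3)] by blast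
    qed (use M0 in blast)
    then obtain M where M: "even_reduction E M" "\<not> obstructed (E - M)" by blast
    have "E - M \<subset> E" using M(1) by (simp add: even_reduction_def reduces_def)
    then have "card (E - M) < card E" using finE psubset_card_mono by blast
    moreover have "C (E - M)" using mono less.prems(2) M(1) finE by (auto simp: even_reduction_def)
    ultimately have "half_decomposable V (E - M)" using less.hyps[of "E - M"] graph_on_subset[OF sgE, of "E - M"] M(2) by blast
    then show ?thesis using M(1) unfolding half_decomposable_def even_reduction_def reduces_def by blast
  qed
qed

section \<open>Blocks\<close>

definition adj :: "'v set set \<Rightarrow> 'v \<Rightarrow> 'v \<Rightarrow> bool" where
  "adj E x y \<longleftrightarrow> {x, y} \<in> E"

definition induced_on :: "'v set set \<Rightarrow> 'v set \<Rightarrow> 'v sgraph" where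
  "induced_on E X = \<lparr>verts = X, edges = {e \<in> E. e \<subseteq> X}\<rparr>"

lemma induced_on_simps [simp]: "verts (induced_on E X) = X" "edges (induced_on E X) = {e \<in> E. e \<subseteq> X}"
  by (simp_all add: induced_on_def)

lemma adj_sym: "(adj E)\<^sup>*\<^sup>* x y \<Longrightarrow> (adj E)\<^sup>*\<^sup>* y x"
proof (induction rule: rtranclp_induct)
  case (step y z)
  then show ?case by (metis adj_def converse_rtranclp_into_rtranclp insert_commute)
qed simp

lemma adj_mono: "(adj E)\<^sup>*\<^sup>* x y \<Longrightarrow> E \<subseteq> E' \<Longrightarrow> (adj E')\<^sup>*\<^sup>* x y"
proof (induction rule: rtranclp_induct)
  case (step y z)
  then have "adj E' y z" by (auto simp: adj_def)
  then show ?case using step by (metis rtranclp.rtrancl_into_rtrancl)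
qed simp

lemma connected_graph_adj:
  "connected_graph G \<longleftrightarrow> verts G \<noteq> {} \<and> (\<forall>u\<in>verts G. \<forall>v\<in>verts G. (adj (edges G))\<^sup>*\<^sup>* u v)"
  unfolding connected_graph_def adj_def ..

lemma connected_hub:
  assumes "c \<in> verts G" "\<And>v. v \<in> verts G \<Longrightarrow> (adj (edges G))\<^sup>*\<^sup>* c v"
  shows "connected_graph G"
  unfolding connected_graph_adj using assms adj_sym rtranclp_trans by (metis empty_iff)

lemma subgraph_trans: "subgraph A B \<Longrightarrow> subgraph B C \<Longrightarrow> subgraph A C"
  by (auto simp: subgraph_def)

lemma sgraph_eqI: "verts A = verts B \<Longrightarrow> edges A = edges B \<Longrightarrow> A = (B :: 'v sgraph)"
  by simp

lemma finite_edges: "simple_graph G \<Longrightarrow> finite (edges G)"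
  unfolding simple_graph_def by (meson PowI finite_Pow_iff finite_subset subsetI)

lemma block_exists:
  assumes "simple_graph H" "subgraph D H" "two_connected D"
  shows "\<exists>B. block H B \<and> subgraph D B"
proof -
  define P where "P B \<longleftrightarrow> subgraph B H \<and> two_connected B \<and> subgraph D B" for B
  define m where "m B = card (verts B) + card (edges B)" for B :: "'a sgraph"
  have finH: "finite (verts H)" "finite (edges H)" using assms finite_edges by (auto simp: simple_graph_def)
  have "P D" using assms by (auto simp: P_def subgraph_def)
  moreover have "m B < Suc (card (verts H) + card (edges H))" if "P B" for B
  proof -
    have "verts B \<subseteq> verts H" "edges B \<subseteq> edges H" using that by (auto simp: P_def subgraph_def)
    then show ?thesis using card_mono[OF finH(1)] card_mono[OF finH(2)] by (simp add: m_def add_mono less_Suc_eq_le)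
  qed
  ultimately obtain B where B: "P B" "\<And>B'. P B' \<Longrightarrow> m B' \<le> m B"
    using ex_has_greatest_nat[of P D m] by (metis less_or_eq_imp_le)
  have "D' = B" if D': "subgraph D' H" "two_connected D'" "subgraph B D'" for D'
  proof -
    have "P D'" using D' B(1) subgraph_trans by (auto simp: P_def)
    then have le: "m D' \<le> m B" by (rule B(2))
    have s: "verts B \<subseteq> verts D'" "edges B \<subseteq> edges D'" "verts D' \<subseteq> verts H" "edges D' \<subseteq> edges H"
      using D' by (auto simp: subgraph_def)
    have fin: "finite (verts D')" "finite (edges D')" using s finH finite_subset by blast+
    have "card (verts B) \<le> card (verts D')" "card (edges B) \<le> card (edges D')"
      using s fin card_mono by blast+
    then have "card (verts B) = card (verts D')" "card (edges B) = card (edges D')" using le by (auto simp: m_def)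
    then show ?thesis using s fin by (intro sgraph_eqI) (metis card_subset_eq)+
  qed
  then show ?thesis using B(1) unfolding block_def P_def by blast
qed

text \<open>Condition (i) speaks of blocks only, but every 2-connected subgraph is contained in a
  block.\<close>

lemma family_degree:
  assumes H: "H \<in> \<G>" and D: "subgraph D H" "two_connected D" "v \<in> verts D"
  shows "degree D v \<le> 3"
proof -
  have sH: "simple_graph H" using H by (simp add: graph_family_def)
  obtain B where B: "block H B" "subgraph D B" using block_exists[OF sH D(1,2)] by blast
  have "max_degree_le B 3" using H B(1) by (auto simp: graph_family_def)
  then have "degree B v \<le> 3" using D(3) B(2) by (auto simp: max_degree_le_def subgraph_def)
  moreover have "finite (edges B)" using B(1) finite_edges by (auto simp: block_def subgraph_def)
  then have "degree D v \<le> degree B v" unfolding degree_def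
    using B(2) by (intro card_mono) (auto simp: subgraph_def)
  ultimately show ?thesis by linarith
qed

lemma induced_induced_on [simp]: "induced (induced_on E X) (X - {v}) = induced_on E (X - {v})"
  unfolding induced_def induced_on_def by (auto simp: subset_iff)

lemma simple_induced_on: "graph_on V E \<Longrightarrow> finite X \<Longrightarrow> simple_graph (induced_on E X)"
  by (auto simp: simple_graph_def graph_on_def)

text \<open>Deleting any other vertex leaves \<open>t\<close> joined to all the rest, so only the
  deletion of \<open>t\<close> needs the hypothesis \<open>c\<close>.\<close>

lemma two_connected_dominating:
  assumes X: "finite X" "3 \<le> card X" "t \<in> X" "\<And>v. v \<in> X \<Longrightarrow> v \<noteq> t \<Longrightarrow> {t, v} \<in> E"
    and c: "connected_graph (induced_on E (X - {t}))"
  shows "two_connected (induced_on E X)"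
proof -
  have hub: "connected_graph (induced_on E Y)" if "Y \<subseteq> X" "t \<in> Y" for Y
  proof (rule connected_hub[where c = t])
    fix v assume v: "v \<in> verts (induced_on E Y)"
    show "(adj (edges (induced_on E Y)))\<^sup>*\<^sup>* t v"
    proof (cases "v = t")
      case False
      then have "adj (edges (induced_on E Y)) t v" using X(4)[of v] v that by (auto simp: adj_def)
      then show ?thesis by blast
    qed simp
  qed (use that in simp)
  have "connected_graph (induced_on E (X - {v}))" if "v \<in> X" for v
    using hub[of "X - {v}"] c X(3) by (cases "v = t") auto
  then show ?thesis unfolding two_connected_def using X hub[of X] by auto
qed

lemma two_connected_triangle:
  assumes "x \<noteq> y" "x \<noteq> z" "y \<noteq> z" "{x, y} \<in> E" "{x, z} \<in> E" "{y, z} \<in> E"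
  shows "two_connected (induced_on E {x, y, z})"
proof (rule two_connected_dominating[where t = x])
  have e: "{x, y, z} - {x} = {y, z}" using assms by auto
  show "connected_graph (induced_on E ({x, y, z} - {x}))" unfolding e
  proof (rule connected_hub[where c = y])
    fix v assume "v \<in> verts (induced_on E {y, z})"
    moreover have "adj (edges (induced_on E {y, z})) y z" using assms by (simp add: adj_def)
    ultimately show "(adj (edges (induced_on E {y, z})))\<^sup>*\<^sup>* y v" by auto
  qed simp
qed (use assms in auto)

lemma path_adj:
  assumes "set_mset (path_edges L) \<subseteq> E" "u \<in> set L" "v \<in> set L"
  shows "(adj E)\<^sup>*\<^sup>* u v"
proof -
  have "(adj E)\<^sup>*\<^sup>* (hd L) w" if "set_mset (path_edges L) \<subseteq> E" "w \<in> set L" for w and L :: "'a list"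
    using that
  proof (induction L rule: path_edges.induct)
    case (1 x y r)
    have xy: "adj E x y" using 1 by (simp add: adj_def)
    show ?case
    proof (cases "w = x")
      case False
      then have "(adj E)\<^sup>*\<^sup>* y w" using 1 by simp
      then show ?thesis using xy by simp
    qed simp
  qed auto
  then show ?thesis using assms adj_sym rtranclp_trans by metis
qed

text \<open>Deleting an inner vertex of the ear leaves two pieces hanging at \<open>c\<close> and
  \<open>f\<close>. Deleting a vertex of \<open>B\<close> leaves \<open>B\<close> connected and the
  ear attached at one of its ends at least. With \<open>ps = []\<close> the ear is a single edge
  between two vertices of \<open>B\<close>.\<close>

lemma two_connected_ear:
  assumes B: "two_connected B" "simple_graph B"
    and Q: "distinct (c # ps @ [f])" "c \<in> verts B" "f \<in> verts B" "set ps \<inter> verts B = {}"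
  shows "two_connected \<lparr>verts = verts B \<union> set ps, edges = edges B \<union> set_mset (path_edges (c # ps @ [f]))\<rparr>"
proof -
  define Q where "Q = c # ps @ [f]"
  define D where "D = \<lparr>verts = verts B \<union> set ps, edges = edges B \<union> set_mset (path_edges Q)\<rparr>"
  have vD: "verts D = verts B \<union> set ps" "edges D = edges B \<union> set_mset (path_edges Q)" by (simp_all add: D_def)
  have setQ: "set Q \<subseteq> verts D" using Q by (auto simp: Q_def vD)
  have eB: "e \<subseteq> verts B" if "e \<in> edges B" for e using that B(2) by (auto simp: simple_graph_def)
  have eQ: "e \<subseteq> set Q" if "e \<in># path_edges Q" for e using path_edges_subset that by fastforce
  have finB: "finite (verts B)" using B(2) by (simp add: simple_graph_def)
  define Ev where "Ev v = {e \<in> edges D. v \<notin> e}" for v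
  have ind: "edges (induced D (verts D - {v})) = Ev v" "verts (induced D (verts D - {v})) = verts D - {v}" for v
    using eB eQ setQ by (auto simp: induced_def Ev_def vD)
  have subl: "set_mset (path_edges L) \<subseteq> Ev v" if "set_mset (path_edges L) \<subseteq> set_mset (path_edges Q)" "v \<notin> set L" for L v
    using that path_edges_subset[of _ L] by (auto simp: Ev_def vD)
  have pre: "set_mset (path_edges L) \<subseteq> set_mset (path_edges (L @ R))" "set_mset (path_edges R) \<subseteq> set_mset (path_edges (L @ R))" for L R :: "'a list"
    by (cases "L = []"; cases "R = []"; auto simp: path_edges_append; fail)+
  have connB: "(adj (edges B))\<^sup>*\<^sup>* x y" if "x \<in> verts B" "y \<in> verts B" for x y
    using B(1) that unfolding two_connected_def connected_graph_adj by blast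
  have connBv: "(adj (Ev v))\<^sup>*\<^sup>* x y" if v: "x \<in> verts B" "y \<in> verts B" "x \<noteq> v" "y \<noteq> v" for x y v
  proof (cases "v \<in> verts B")
    case True
    then have "connected_graph (induced B (verts B - {v}))" using B(1) unfolding two_connected_def by blast
    then have "(adj (edges (induced B (verts B - {v}))))\<^sup>*\<^sup>* x y"
      using v unfolding connected_graph_adj by (auto simp: induced_def)
    then show ?thesis by (rule adj_mono) (auto simp: induced_def Ev_def vD)
  next
    case False
    then show ?thesis by (intro adj_mono[OF connB[OF v(1,2)]]) (use eB in \<open>auto simp: Ev_def vD\<close>)
  qed
  have conn: "connected_graph (induced D (verts D - {v}))" if v: "v \<in> verts D" for v
  proof (cases "v \<in> set ps")
    case True
    then obtain P1 P2 where ps: "ps = P1 @ v # P2" by (meson split_list)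
    have Qe: "Q = (c # P1) @ (v # P2 @ [f])" "Q = (c # P1 @ [v]) @ (P2 @ [f])" by (simp_all add: Q_def ps)
    have vc: "v \<noteq> c" "v \<notin> verts B" "v \<noteq> f" using True Q by auto
    have p1: "(adj (Ev v))\<^sup>*\<^sup>* c w" if "w \<in> set (c # P1)" for w
    proof (rule path_adj)
      show "set_mset (path_edges (c # P1)) \<subseteq> Ev v" by (rule subl) (use pre(1)[of "c # P1" "v # P2 @ [f]"] Qe Q ps in auto)
    qed (use that in auto)
    have p2: "(adj (Ev v))\<^sup>*\<^sup>* f w" if "w \<in> set (P2 @ [f])" for w
    proof (rule path_adj)
      show "set_mset (path_edges (P2 @ [f])) \<subseteq> Ev v" by (rule subl) (use pre(2)[of "P2 @ [f]" "c # P1 @ [v]"] Qe Q ps in auto)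
    qed (use that in auto)
    show ?thesis
    proof (rule connected_hub[where c = c], unfold ind)
      show "c \<in> verts D - {v}" using Q vc by (auto simp: vD)
      fix w assume w: "w \<in> verts D - {v}"
      have cf: "(adj (Ev v))\<^sup>*\<^sup>* c f" using connBv[of c f v] Q vc by auto
      show "(adj (Ev v))\<^sup>*\<^sup>* c w"
      proof (cases "w \<in> verts B")
        case True then show ?thesis using connBv[of c w v] Q vc w by auto
      next
        case False
        then have "w \<in> set P1 \<or> w \<in> set P2" using w ps by (auto simp: vD)
        then show ?thesis using p1[of w] p2[of w] cf by (auto intro: rtranclp_trans)
      qed
    qed
  next
    case False
    then have vB: "v \<in> verts B" using v by (auto simp: vD)
    obtain h where h: "h \<in> {c, f}" "h \<noteq> v" "h \<in> verts B" using Q by auto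
    have path: "(adj (Ev v))\<^sup>*\<^sup>* h w" if w: "w \<in> set ps" for w
    proof (cases "v = f")
      case True
      then have hc: "h = c" using h by auto
      show ?thesis
      proof (rule path_adj)
        show "set_mset (path_edges (c # ps)) \<subseteq> Ev v" by (rule subl) (use pre(1)[of "c # ps" "[f]"] True Q in \<open>auto simp: Q_def\<close>)
      qed (use w hc in auto)
    next
      case vf: False
      show ?thesis
      proof (cases "v = c")
        case True
        then have hf: "h = f" using h by auto
        show ?thesis
        proof (rule path_adj)
          show "set_mset (path_edges (ps @ [f])) \<subseteq> Ev v" by (rule subl) (use pre(2)[of "ps @ [f]" "[c]"] True Q in \<open>auto simp: Q_def\<close>)
        qed (use w hf in auto)
      next
        case vc: False
        show ?thesis
        proof (rule path_adj)
          show "set_mset (path_edges Q) \<subseteq> Ev v" by (rule subl) (use vf vc False in \<open>auto simp: Q_def\<close>)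
        qed (use w h in \<open>auto simp: Q_def\<close>)
      qed
    qed
    show ?thesis
    proof (rule connected_hub[where c = h], unfold ind)
      show "h \<in> verts D - {v}" using h by (auto simp: vD)
      fix w assume w: "w \<in> verts D - {v}"
      then show "(adj (Ev v))\<^sup>*\<^sup>* h w" using path[of w] connBv[of h w v] h by (auto simp: vD)
    qed
  qed
  have "connected_graph D"
  proof (rule connected_hub[where c = c])
    show "c \<in> verts D" using Q by (auto simp: vD)
    fix w assume w: "w \<in> verts D"
    show "(adj (edges D))\<^sup>*\<^sup>* c w"
    proof (cases "w \<in> verts B")
      case True
      then show ?thesis using connB[of c w] Q by (intro adj_mono[OF connB]) (auto simp: vD)
    next
      case False
      then show ?thesis using w by (intro path_adj[of Q]) (auto simp: vD Q_def)
    qed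
  qed
  moreover have "3 \<le> card (verts D)"
    using B(1) card_mono[of "verts D" "verts B"] finB by (auto simp: two_connected_def vD)
  ultimately have "two_connected D" unfolding two_connected_def using conn by blast
  then show ?thesis by (simp add: D_def Q_def)
qed

lemma wheel_degree:
  assumes H: "H \<in> \<G>" and sgF: "graph_on A F" "F \<subseteq> edges H"
    and d: "distinct [t, y, z, u, w]" "{t, y} \<in> F" "{t, z} \<in> F" "{t, u} \<in> F" "{t, w} \<in> F" "{y, z} \<in> F"
      "{y, u} \<in> F \<or> {z, u} \<in> F" "{y, w} \<in> F \<or> {z, w} \<in> F"
  shows False
proof -
  define X where "X = {t, y, z, u, w}"
  have sH: "simple_graph H" using H by (simp add: graph_family_def)
  have cX: "card X = 5" using d(1) by (simp add: X_def)
  have Xt: "X - {t} = {y, z, u, w}" using d(1) by (auto simp: X_def)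
  have conn: "connected_graph (induced_on F (X - {t}))" unfolding Xt
  proof (rule connected_hub[where c = y])
    let ?a = "adj (edges (induced_on F {y, z, u, w}))"
    have yz: "?a y z" using d by (simp add: adj_def)
    have flip_step: "?a\<^sup>*\<^sup>* y v" if "{y, v} \<in> F \<or> {z, v} \<in> F" "v \<in> {u, w}" for v
    proof -
      have "?a y v \<or> ?a z v" using that by (auto simp: adj_def)
      then show ?thesis using yz by (meson converse_rtranclp_into_rtranclp r_into_rtranclp)
    qed
    fix v assume "v \<in> verts (induced_on F {y, z, u, w})"
    then consider "v = y" | "v = z" | "v \<in> {u, w}" by auto
    then show "?a\<^sup>*\<^sup>* y v"
    proof cases
      case 3 then show ?thesis using flip_step[of v] d(7,8) by auto
    qed (use yz in auto)
  qed simp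
  have "two_connected (induced_on F X)"
    by (rule two_connected_dominating[where t = t]) (use cX conn d in \<open>auto simp: X_def\<close>)
  moreover have "subgraph (induced_on F X) H"
  proof -
    have "X \<subseteq> verts H" using sH sgF(2) d(2-5) unfolding simple_graph_def X_def by blast
    then show ?thesis using simple_induced_on[OF sgF(1), of X] sgF(2) by (auto simp: subgraph_def X_def)
  qed
  ultimately have "degree (induced_on F X) t \<le> 3" using family_degree[OF H] by (auto simp: X_def)
  moreover have f1: "{{t, y}, {t, z}, {t, u}, {t, w}} \<subseteq> {e \<in> edges (induced_on F X). t \<in> e}" using d by (auto simp: X_def)
  moreover have f2: "finite {e \<in> edges (induced_on F X). t \<in> e}" using graph_on_finite[OF sgF(1)] by auto
  moreover have f3: "card {{t, y}, {t, z}, {t, u}, {t, w}} = 4" using d(1) by (auto simp: doubleton_eq_iff card_insert_if)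
  ultimately show False using card_mono[OF f2 f1] unfolding degree_def by linarith
qed

section \<open>Irreducible even subgraphs\<close>

definition nbrs :: "'v set set \<Rightarrow> 'v \<Rightarrow> 'v set" where
  "nbrs F v = {u. {v, u} \<in> F}"

text \<open>\<open>D\<close> is joined to the rest of \<open>K\<close> only through
  \<open>c\<close>, where the rest may be empty; so a branch also exists when there is no cut
  vertex.\<close>

definition branch :: "'v set set \<Rightarrow> 'v set \<Rightarrow> 'v \<Rightarrow> 'v set \<Rightarrow> bool" where
  "branch F K c D \<longleftrightarrow> D \<noteq> {} \<and> c \<notin> D \<and> D \<subseteq> K \<and> c \<in> K \<and> (\<forall>d\<in>D. nbrs F d \<subseteq> insert c D)"

text \<open>The three clauses rule out the configurations of \<open>even_reduction_leaf\<close>,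
  \<open>even_reduction_adjacent\<close> and \<open>even_reduction_star3\<close>; in the last one
  the third neighbour of \<open>x\<close> is unrestricted.\<close>

definition irreducible_graph :: "'v set set \<Rightarrow> bool" where
  "irreducible_graph F \<longleftrightarrow> (\<forall>v. card (nbrs F v) \<noteq> 1) \<and>
     (\<forall>a a' b b'. nbrs F a = {a', b} \<longrightarrow> nbrs F a' = {a, b'} \<longrightarrow> b \<noteq> a' \<longrightarrow> b' \<noteq> a \<longrightarrow> b = b') \<and>
     (\<forall>x v v'. card (nbrs F x) = 3 \<longrightarrow> v \<in> nbrs F x \<longrightarrow> v' \<in> nbrs F x \<longrightarrow> v \<noteq> v' \<longrightarrow>
        card (nbrs F v) \<le> 3 \<longrightarrow> card (nbrs F v') \<le> 3 \<longrightarrow> False)"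

lemma in_nb: "u \<in> nbrs F v \<longleftrightarrow> {v, u} \<in> F"
  by (simp add: nbrs_def)

lemma nbrs_sym: "u \<in> nbrs F v \<longleftrightarrow> v \<in> nbrs F u"
  by (simp add: nbrs_def insert_commute)

lemma closed_reach:
  assumes "(adj F)\<^sup>*\<^sup>* v w" "v \<in> Y" "\<And>y. y \<in> Y \<Longrightarrow> nbrs F y \<subseteq> Y"
  shows "w \<in> Y"
  using assms by (induction rule: rtranclp_induct) (auto simp: nbrs_def adj_def)

text \<open>For a minimal branch \<open>D\<close> at \<open>c\<close>, the graph on \<open>insert c D\<close> is 2-connected, i.e. a leaf block.\<close>

lemma pendant_triangle:
  assumes H: "H \<in> \<G>" and sgF: "graph_on A F" "F \<subseteq> edges H" and irr: "irreducible_graph F"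
    and K: "K = {v. (adj F)\<^sup>*\<^sup>* v0 v}" "finite K" and br: "branch F K c0 D0"
  shows "\<exists>c d d'. c \<in> K \<and> d \<in> D0 \<and> d' \<in> D0 \<and> c \<noteq> d \<and> c \<noteq> d' \<and> d \<noteq> d' \<and> nbrs F d = {d', c} \<and> nbrs F d' = {d, c}
     \<and> (4 \<le> card (nbrs F c) \<or> (K = {c, d, d'} \<and> nbrs F c = {d, d'}))"
proof -
  have sH: "simple_graph H" using H by (simp add: graph_family_def)
  have finN: "finite (nbrs F v)" for v unfolding nbrs_def by (rule finite_nbrs[OF sgF(1)])
  have noloop: "v \<notin> nbrs F v" for v using graph_on_edge[OF sgF(1), of v v] by (auto simp: in_nb)
  have irr1: "card (nbrs F v) \<noteq> 1" for v using irr by (simp add: irreducible_graph_def)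
  have irr2: "b = b'" if "nbrs F a = {a', b}" "nbrs F a' = {a, b'}" "b \<noteq> a'" "b' \<noteq> a" for a a' b b'
    using irr that unfolding irreducible_graph_def by blast
  have irr3: False if "card (nbrs F x) = 3" "v \<in> nbrs F x" "v' \<in> nbrs F x" "v \<noteq> v'" "card (nbrs F v) \<le> 3" "card (nbrs F v') \<le> 3" for x v v'
    using irr that unfolding irreducible_graph_def by blast
  have Kreach: "(adj F)\<^sup>*\<^sup>* u v" if "u \<in> K" "v \<in> K" for u v
    using that adj_sym[of F v0 u] by (auto simp: K(1) intro: rtranclp_trans)
  have Kcl: "K \<subseteq> Y" if "y \<in> Y" "y \<in> K" "\<And>y. y \<in> Y \<Longrightarrow> nbrs F y \<subseteq> Y" for y Y
    using closed_reach[OF Kreach[OF that(2)] that(1,3)] by blast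
  obtain c D where cD: "branch F K c D" "D \<subseteq> D0"
    and min: "\<And>c' D'. branch F K c' D' \<Longrightarrow> D' \<subseteq> D0 \<Longrightarrow> card D \<le> card D'"
  proof -
    define P where "P x \<longleftrightarrow> branch F K (fst x) (snd x) \<and> snd x \<subseteq> D0" for x
    have "P (c0, D0)" using br by (simp add: P_def)
    then obtain x where "P x" "\<And>y. P y \<Longrightarrow> card (snd x) \<le> card (snd y)"
      using ex_has_least_nat[of P "(c0, D0)" "\<lambda>x. card (snd x)"] by blast
    then show ?thesis using that[of "fst x" "snd x"] by (auto simp: P_def)
  qed
  have D: "D \<noteq> {}" "c \<notin> D" "D \<subseteq> K" "c \<in> K" "\<And>d. d \<in> D \<Longrightarrow> nbrs F d \<subseteq> insert c D"
    using cD(1) by (auto simp: branch_def)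
  have finD: "finite D" using D(3) K(2) finite_subset by blast
  have min': "D' = D" if "branch F K c' D'" "D' \<subseteq> D" for c' D'
    using min[OF that(1)] that(2) cD(2) finD by (meson card_seteq order_trans)
  define X where "X = insert c D"
  \<comment> \<open>Otherwise the part of \<open>D\<close> reachable from \<open>d0\<close> would be
    a smaller branch at \<open>c\<close>.\<close>
  have connD: "(adj (edges (induced_on F D)))\<^sup>*\<^sup>* d0 d" if "d0 \<in> D" "d \<in> D" for d0 d
  proof -
    define D' where "D' = {d \<in> D. (adj (edges (induced_on F D)))\<^sup>*\<^sup>* d0 d}"
    have "branch F K c D'" unfolding branch_def
    proof (intro conjI ballI)
      show "D' \<noteq> {}" using that by (auto simp: D'_def)
      fix d assume d: "d \<in> D'"
      show "nbrs F d \<subseteq> insert c D'"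
      proof
        fix w assume w: "w \<in> nbrs F d"
        then have "w = c \<or> w \<in> D" using D(5) d by (auto simp: D'_def)
        moreover have "w \<in> D'" if "w \<in> D"
        proof -
          have "adj (edges (induced_on F D)) d w" using w d that by (auto simp: adj_def D'_def in_nb)
          then show ?thesis using d that by (auto simp: D'_def intro: rtranclp.rtrancl_into_rtrancl)
        qed
        ultimately show "w \<in> insert c D'" by blast
      qed
    qed (use D in \<open>auto simp: D'_def\<close>)
    then have "D' = D" by (rule min') (auto simp: D'_def)
    then show ?thesis using that by (auto simp: D'_def)
  qed
  \<comment> \<open>The vertices separated from \<open>c\<close> by \<open>d\<close> would form a
    branch at \<open>d\<close> that is contained in \<open>D\<close> but misses \<open>d\<close>,
    contrary to minimality.\<close>
  have connX: "(adj (edges (induced_on F (X - {d}))))\<^sup>*\<^sup>* c u" if d: "d \<in> D" and u: "u \<in> X - {d}" for d u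
  proof (rule ccontr)
    assume nr: "\<not> ?thesis"
    define D' where "D' = {w \<in> X - {d}. \<not> (adj (edges (induced_on F (X - {d}))))\<^sup>*\<^sup>* c w}"
    have D'D: "D' \<subseteq> D" by (auto simp: D'_def X_def)
    have "branch F K d D'" unfolding branch_def
    proof (intro conjI ballI)
      show "D' \<noteq> {}" using nr u by (auto simp: D'_def)
      fix w assume w: "w \<in> D'"
      show "nbrs F w \<subseteq> insert d D'"
      proof
        fix s assume s: "s \<in> nbrs F w"
        have sX: "s \<in> X" using D(5)[of w] s w D'D by (auto simp: X_def)
        show "s \<in> insert d D'"
        proof (rule ccontr)
          assume "s \<notin> insert d D'"
          then have r: "(adj (edges (induced_on F (X - {d}))))\<^sup>*\<^sup>* c s" "s \<noteq> d" using sX by (auto simp: D'_def)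
          have "adj (edges (induced_on F (X - {d}))) s w" using s w sX r(2) by (auto simp: adj_def in_nb D'_def insert_commute)
          then show False using r(1) w by (auto simp: D'_def intro: rtranclp.rtrancl_into_rtrancl)
        qed
      qed
    qed (use D D'D d in \<open>auto simp: D'_def\<close>)
    then have "D' = D" using min' D'D by blast
    then show False using d by (auto simp: D'_def)
  qed
  have nonempty: "nbrs F d \<noteq> {}" if "d \<in> K" "w \<in> K" "d \<noteq> w" for d w
  proof
    assume "nbrs F d = {}"
    then have "K \<subseteq> {d}" using Kcl[of d "{d}"] that by auto
    then show False using that by auto
  qed
  have D2: "2 \<le> card D"
  proof (rule ccontr)
    assume "\<not> 2 \<le> card D"
    moreover have "card D \<noteq> 0" using D(1) finD by auto
    ultimately have "card D = 1" by linarith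
    then obtain d where d: "D = {d}" by (auto simp: card_1_singleton_iff)
    then have "nbrs F d \<subseteq> {c}" using D(5)[of d] noloop[of d] by auto
    moreover have "nbrs F d \<noteq> {}" using nonempty[of d c] D d by auto
    ultimately have "nbrs F d = {c}" by auto
    then show False using irr1[of d] by simp
  qed
  have tc: "two_connected (induced_on F X)"
  proof -
    have "connected_graph (induced_on F X)"
    proof (rule connected_hub[where c = c])
      fix u assume "u \<in> verts (induced_on F X)"
      then have u: "u \<in> X" by simp
      have "\<exists>d\<in>D. d \<noteq> u"
      proof (rule ccontr)
        assume "\<not> ?thesis"
        then have "D \<subseteq> {u}" by auto
        then show False using D2 card_mono[of "{u}" D] by auto
      qed
      then obtain d where d: "d \<in> D" "d \<noteq> u" by blast
      have "(adj (edges (induced_on F (X - {d}))))\<^sup>*\<^sup>* c u" by (rule connX) (use d u in auto)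
      then show "(adj (edges (induced_on F X)))\<^sup>*\<^sup>* c u" by (rule adj_mono) auto
    qed (simp add: X_def)
    moreover have "connected_graph (induced_on F (X - {v}))" if "v \<in> X" for v
    proof (cases "v = c")
      case True
      then have "X - {v} = D" using D(2) by (auto simp: X_def)
      then show ?thesis using connD D(1) unfolding connected_graph_adj by auto
    next
      case False
      then have v: "v \<in> D" using that by (auto simp: X_def)
      show ?thesis
      proof (rule connected_hub[where c = c])
        show "c \<in> verts (induced_on F (X - {v}))" using False by (auto simp: X_def)
        fix u assume "u \<in> verts (induced_on F (X - {v}))"
        then show "(adj (edges (induced_on F (X - {v}))))\<^sup>*\<^sup>* c u" using connX[OF v] by simp
      qed
    qed
    moreover have "3 \<le> card X" using D2 finD D(2) by (simp add: X_def)
    ultimately show ?thesis unfolding two_connected_def by simp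
  qed
  have finX: "finite X" using finD by (simp add: X_def)
  have "X \<subseteq> verts H"
  proof
    fix u assume "u \<in> X"
    then have uK: "u \<in> K" using D by (auto simp: X_def)
    obtain d0 where "d0 \<in> D" using D(1) by blast
    then have "d0 \<in> K" "d0 \<noteq> c" using D(2,3) by blast+
    then have "\<exists>w\<in>K. u \<noteq> w" using D(4) by metis
    then obtain w where "w \<in> nbrs F u" using nonempty[OF uK] by blast
    then have "{u, w} \<in> edges H" using sgF(2) by (auto simp: in_nb)
    then show "u \<in> verts H" using sH by (auto simp: simple_graph_def)
  qed
  then have subX: "subgraph (induced_on F X) H"
    using simple_induced_on[OF sgF(1) finX] sgF(2) by (auto simp: subgraph_def)
  have deg: "card (nbrs F d) \<le> 3" if d: "d \<in> D" for d
  proof -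
    have "{e \<in> edges (induced_on F X). d \<in> e} = (\<lambda>u. {d, u}) ` nbrs F d"
    proof
      show "{e \<in> edges (induced_on F X). d \<in> e} \<subseteq> (\<lambda>u. {d, u}) ` nbrs F d"
      proof
        fix e assume e: "e \<in> {e \<in> edges (induced_on F X). d \<in> e}"
        then obtain u where "e = {d, u}" using graph_on_edgeE[OF sgF(1), of e d] by auto
        then show "e \<in> (\<lambda>u. {d, u}) ` nbrs F d" using e by (auto simp: in_nb)
      qed
      show "(\<lambda>u. {d, u}) ` nbrs F d \<subseteq> {e \<in> edges (induced_on F X). d \<in> e}"
        using D(5)[OF d] d by (auto simp: in_nb X_def)
    qed
    moreover have "inj_on (\<lambda>u. {d, u}) (nbrs F d)" by (auto simp: inj_on_def doubleton_eq_iff)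
    ultimately have "degree (induced_on F X) d = card (nbrs F d)" unfolding degree_def by (simp add: card_image)
    then show ?thesis using family_degree[OF H subX tc, of d] d by (simp add: X_def)
  qed
  \<comment> \<open>A vertex of degree 3 in \<open>D\<close> would have two neighbours in
    \<open>D\<close>, again of degree at most 3, which \<open>irr3\<close> forbids.\<close>
  have deg2: "card (nbrs F d) = 2" if d: "d \<in> D" for d
  proof -
    have "card (nbrs F d) \<noteq> 0" using nonempty[of d c] D d finN by auto
    moreover have "card (nbrs F d) \<noteq> 3"
    proof
      assume c3: "card (nbrs F d) = 3"
      have "2 \<le> card (nbrs F d - {c})" using c3 finN[of d] by (simp add: card_Diff_singleton_if)
      then obtain S where S: "S \<subseteq> nbrs F d - {c}" "card S = 2" "finite S" by (rule obtain_subset_with_card_n)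
      then obtain v v' where "v \<noteq> v'" "v \<in> nbrs F d - {c}" "v' \<in> nbrs F d - {c}" by (auto simp: card_2_iff)
      moreover from this have "v \<in> D" "v' \<in> D" using D(5)[OF d] by auto
      ultimately show False using irr3[OF c3, of v v'] deg by auto
    qed
    ultimately show ?thesis using deg[OF d] irr1[of d] by linarith
  qed
  obtain d where d: "d \<in> D" using D(1) by blast
  obtain d' b where db: "nbrs F d = {d', b}" "d' \<noteq> b" "d' \<in> D"
  proof -
    obtain a b where ab: "nbrs F d = {a, b}" "a \<noteq> b" using deg2[OF d] by (auto simp: card_2_iff)
    then have "a \<in> D \<or> b \<in> D" using D(5)[OF d] by auto
    then show ?thesis using that[of a b] that[of b a] ab by auto
  qed
  obtain b' where db': "nbrs F d' = {d, b'}" "d \<noteq> b'"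
  proof -
    have "d \<in> nbrs F d'" using db nbrs_sym[of d' F d] by auto
    moreover obtain a b where "nbrs F d' = {a, b}" "a \<noteq> b" using deg2[OF db(3)] by (auto simp: card_2_iff)
    ultimately show ?thesis using that[of a] that[of b] by auto
  qed
  have bb: "b' = b" using irr2[OF db(1) db'(1)] db(2) db'(2) by auto
  have ne: "d \<noteq> d'" "d' \<noteq> b" "d \<noteq> b" using noloop[of d] noloop[of d'] db db' bb by auto
  have nbb: "d \<in> nbrs F b" "d' \<in> nbrs F b" using db db' bb nbrs_sym[of _ F b] by auto
  \<comment> \<open>With \<open>b\<close> in \<open>D\<close> all three vertices would have degree
    2, so \<open>K\<close> would be this triangle and lie inside \<open>D\<close>, although
    \<open>c\<close> belongs to \<open>K\<close> and not to \<open>D\<close>.\<close>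
  have bc: "b = c"
  proof (rule ccontr)
    assume "b \<noteq> c"
    then have "b \<in> D" using D(5)[OF d] db by auto
    then have "card (nbrs F b) = 2" by (rule deg2)
    then have nB: "nbrs F b = {d, d'}" using nbb ne finN[of b] card_subset_eq[of "nbrs F b" "{d, d'}"] by simp
    have "K \<subseteq> {d, d', b}" using Kcl[of d "{d, d', b}"] d D(3) db db' bb nB by auto
    then have "c \<in> D" using D(4) d db(3) \<open>b \<in> D\<close> by auto
    then show False using D(2) by simp
  qed
  \<comment> \<open>Degree 3 at \<open>c\<close> is excluded by \<open>irr3\<close>, because
    \<open>d\<close> and \<open>d'\<close> have degree 2; degree 2 closes the triangle and exhausts
    \<open>K\<close>.\<close>
  have fin: "4 \<le> card (nbrs F c) \<or> (K = {c, d, d'} \<and> nbrs F c = {d, d'})"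
  proof (cases "4 \<le> card (nbrs F c)")
    case False
    have "card {d, d'} \<le> card (nbrs F c)" using nbb bc finN by (intro card_mono) auto
    then have "card (nbrs F c) = 2 \<or> card (nbrs F c) = 3" using False ne by auto
    moreover have "card (nbrs F c) \<noteq> 3" using irr3[of c d d'] nbb bc ne deg2[OF d] deg2[OF db(3)] by auto
    ultimately have "nbrs F c = {d, d'}" using nbb bc ne finN[of c] card_subset_eq[of "nbrs F c" "{d, d'}"] by simp
    moreover have "K \<subseteq> {c, d, d'}" using Kcl[of c "{c, d, d'}"] D(4) db db' bb bc calculation by auto
    ultimately show ?thesis using D d db(3) by auto
  qed simp
  have "c \<in> K \<and> d \<in> D0 \<and> d' \<in> D0 \<and> c \<noteq> d \<and> c \<noteq> d' \<and> d \<noteq> d' \<and> nbrs F d = {d', c} \<and> nbrs F d' = {d, c}"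
    using D(4) d db db' bb bc ne cD(2) by auto
  then show ?thesis using fin by blast
qed

text \<open>A pendant triangle whose attachment \<open>c\<close> has degree at least 4 contradicts
  condition (ii). That component of \<open>H\<close> has only one block with a triangle, and at most
  three edges at \<open>c\<close> lie in it. Beyond a further edge at \<open>c\<close> there is
  another pendant triangle, necessarily in the same block, and this yields an ear through that
  edge.\<close>

lemma irreducible_triangle:
  assumes H: "H \<in> \<G>" and sgF: "graph_on A F" "F \<subseteq> edges H" and irr: "irreducible_graph F" and v0: "nbrs F v0 \<noteq> {}"
  shows "\<exists>y z. y \<noteq> z \<and> nbrs F v0 = {y, z} \<and> nbrs F y = {v0, z} \<and> nbrs F z = {v0, y}"
proof -
  have sH: "simple_graph H" using H by (simp add: graph_family_def)
  define K where "K = {v. (adj F)\<^sup>*\<^sup>* v0 v}"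
  have noloop: "v \<notin> nbrs F v" for v using graph_on_edge[OF sgF(1), of v v] by (auto simp: in_nb)
  have Ecl: "u \<in> K" if "v \<in> K" "u \<in> nbrs F v" for u v
    using that by (auto simp: K_def in_nb adj_def intro: rtranclp.rtrancl_into_rtrancl)
  have KA: "K \<subseteq> insert v0 A"
  proof
    fix v assume "v \<in> K"
    then have "(adj F)\<^sup>*\<^sup>* v0 v" by (simp add: K_def)
    then show "v \<in> insert v0 A" using graph_on_edge[OF sgF(1)] by (cases rule: rtranclp.cases) (auto simp: adj_def)
  qed
  then have finK: "finite K" using sgF(1) finite_subset by (auto simp: graph_on_def)
  have v0K: "v0 \<in> K" by (simp add: K_def)
  obtain u where u: "u \<in> nbrs F v0" using v0 by blast
  then have "u \<in> K - {v0}" using Ecl[OF v0K] noloop[of v0] by auto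
  then have "branch F K v0 (K - {v0})" unfolding branch_def using v0K Ecl by blast
  from pendant_triangle[OF H sgF irr K_def finK this]
  obtain c d d' where c: "c \<in> K" "c \<noteq> d" "c \<noteq> d'" "d \<noteq> d'" "nbrs F d = {d', c}" "nbrs F d' = {d, c}"
    "4 \<le> card (nbrs F c) \<or> (K = {c, d, d'} \<and> nbrs F c = {d, d'})" by blast
  show ?thesis
  proof (cases "4 \<le> card (nbrs F c)")
    case False
    then have K: "K = {c, d, d'}" "nbrs F c = {d, d'}" using c by auto
    moreover have "v0 \<in> K" by (simp add: K_def)
    ultimately consider "v0 = c" | "v0 = d" | "v0 = d'" by blast
    then show ?thesis
    proof cases
      case 1
      have "d \<noteq> d' \<and> nbrs F v0 = {d, d'} \<and> nbrs F d = {v0, d'} \<and> nbrs F d' = {v0, d}"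
        using c(4-6) K(2) 1 by (simp add: insert_commute)
      then show ?thesis by blast
    next
      case 2
      have "d' \<noteq> c \<and> nbrs F v0 = {d', c} \<and> nbrs F d' = {v0, c} \<and> nbrs F c = {v0, d'}"
        using c(3,5,6) K(2) 2 by simp
      then show ?thesis by blast
    next
      case 3
      have "d \<noteq> c \<and> nbrs F v0 = {d, c} \<and> nbrs F d = {v0, c} \<and> nbrs F c = {v0, d}"
        using c(2,5,6) K(2) 3 by (simp add: insert_commute)
      then show ?thesis by blast
    qed
  next
    case c4: True
    have finH: "finite (verts H)" using sH by (simp add: simple_graph_def)
    \<comment> \<open>Condition (ii) concerns components of \<open>H\<close>, not of
      \<open>F\<close>. Maximality forces such a component to be induced on all vertices reachable
      from \<open>c\<close> in \<open>H\<close>.\<close>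
    define Z where "Z = {v. (adj (edges H))\<^sup>*\<^sup>* c v}"
    define C where "C = induced_on (edges H) Z"
    have cl: "w \<in> Z" if "v \<in> Z" "{v, w} \<in> edges H" for v w
      using that by (auto simp: Z_def adj_def intro: rtranclp.rtrancl_into_rtrancl)
    have cH: "c \<in> verts H"
    proof -
      have "{d, c} \<in> F" using c(5) by (auto simp: nbrs_def)
      then have "{d, c} \<in> edges H" using sgF(2) by blast
      then show ?thesis using sH by (auto simp: simple_graph_def)
    qed
    have ZH: "Z \<subseteq> verts H"
    proof
      fix v assume "v \<in> Z"
      then have "(adj (edges H))\<^sup>*\<^sup>* c v" by (simp add: Z_def)
      then show "v \<in> verts H"
      proof (cases rule: rtranclp.cases)
        case (rtrancl_into_rtrancl b)
        then show ?thesis using sH by (auto simp: adj_def simple_graph_def)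
      qed (use cH in simp)
    qed
    have sgH: "graph_on (verts H) (edges H)" using sH by (simp add: graph_on_def simple_graph_def)
    have edgeZ: "e \<subseteq> Z" if e: "e \<in> edges H" "v \<in> e" "v \<in> Z" for e v
    proof -
      obtain u where "e = {v, u}" using graph_on_edgeE[OF sgH e(1,2)] by blast
      then show ?thesis using cl[of v u] e by auto
    qed
    have sC: "simple_graph C" unfolding C_def by (rule simple_induced_on[OF sgH]) (use ZH finH finite_subset in blast)
    have CH: "subgraph C H" using sC ZH by (auto simp: subgraph_def C_def)
    have edgesC: "edges C = {e \<in> edges H. e \<subseteq> Z}" "verts C = Z" by (auto simp: C_def)
    have reachC: "(adj (edges C))\<^sup>*\<^sup>* c v" if "v \<in> Z" for v
    proof -
      have "(adj (edges H))\<^sup>*\<^sup>* c v" using that by (simp add: Z_def)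
      then show ?thesis
      proof (induction rule: rtranclp_induct)
        case (step y z)
        have "y \<in> Z" using step(1) by (simp add: Z_def)
        then have "adj (edges C) y z" using step(2) cl[of y z] by (auto simp: adj_def edgesC)
        then show ?case using step by (metis rtranclp.rtrancl_into_rtrancl)
      qed simp
    qed
    have cZ: "c \<in> Z" by (simp add: Z_def)
    have "connected_graph C" by (rule connected_hub[where c = c]) (use cZ reachC in \<open>auto simp: edgesC\<close>)
    moreover have "D = C" if D: "subgraph D H" "connected_graph D" "subgraph C D" for D
    proof -
      have "verts D \<subseteq> Z"
      proof
        fix v assume v: "v \<in> verts D"
        have "c \<in> verts D" using D(3) cZ by (auto simp: subgraph_def edgesC)
        then have "(adj (edges D))\<^sup>*\<^sup>* c v" using D(2) v unfolding connected_graph_adj by blast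
        then have "(adj (edges H))\<^sup>*\<^sup>* c v" by (rule adj_mono) (use D(1) in \<open>auto simp: subgraph_def\<close>)
        then show "v \<in> Z" by (simp add: Z_def)
      qed
      moreover have "edges D \<subseteq> edges C"
        using D(1) calculation unfolding subgraph_def simple_graph_def edgesC by blast
      ultimately show ?thesis using D(3) by (intro sgraph_eqI) (auto simp: subgraph_def edgesC)
    qed
    ultimately have comp: "component H C" unfolding component_def using CH by blast
    have FZ: "u \<in> Z" if "u \<in> K" for u
    proof -
      have "(adj F)\<^sup>*\<^sup>* c u" using that c(1) adj_sym[of F v0 c] by (auto simp: K_def intro: rtranclp_trans)
      then have "(adj (edges H))\<^sup>*\<^sup>* c u" by (rule adj_mono[OF _ sgF(2)])
      then show ?thesis by (simp add: Z_def)
    qed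
    have nbE: "(\<lambda>u. {c, u}) ` nbrs F c \<subseteq> {e \<in> edges C. c \<in> e}"
      using sgF(2) cl[OF cZ] cZ by (auto simp: in_nb edgesC)
    have injc: "inj_on (\<lambda>u. {c, u}) X" for X by (auto simp: inj_on_def doubleton_eq_iff)
    have "\<not> max_degree_le C 3"
    proof -
      have "finite {e \<in> edges C. c \<in> e}" using finite_edges[OF sC] by simp
      then have "card ((\<lambda>u. {c, u}) ` nbrs F c) \<le> degree C c" unfolding degree_def using nbE card_mono by blast
      then have "4 \<le> degree C c" using c4 card_image[OF injc] by (metis order_trans)
      then show ?thesis using cZ unfolding max_degree_le_def edgesC by fastforce
    qed
    then have one: "B = B'" if "block C B" "has_triangle B" "block C B'" "has_triangle B'" for B B'
      using H comp that unfolding graph_family_def by blast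
    have triB: "\<exists>B. block C B \<and> has_triangle B \<and> {x, y, z} \<subseteq> verts B"
      if t: "x \<in> K" "x \<noteq> y" "x \<noteq> z" "y \<noteq> z" "{x, y} \<in> F" "{x, z} \<in> F" "{y, z} \<in> F" for x y z
    proof -
      define T where "T = induced_on F {x, y, z}"
      have "two_connected T" unfolding T_def by (rule two_connected_triangle) (use t in auto)
      moreover have TC: "subgraph T C"
      proof -
        have "{x, y, z} \<subseteq> Z" using FZ[OF t(1)] cl[of x y] cl[of x z] t sgF(2) by blast
        then show ?thesis using simple_induced_on[OF sgF(1), of "{x, y, z}"] sgF(2) by (auto simp: subgraph_def T_def edgesC)
      qed
      ultimately obtain B where B: "block C B" "subgraph T B" using block_exists[OF sC] by blast
      have "{{x, y}, {y, z}, {x, z}} \<subseteq> edges B" using B(2) t by (auto simp: subgraph_def T_def)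
      then have "has_triangle B" using t unfolding has_triangle_def by auto
      then show ?thesis using B by (auto simp: subgraph_def T_def)
    qed
    have cdd: "{c, d} \<in> F" "{c, d'} \<in> F" "{d, d'} \<in> F" using c(5,6) by (auto simp: nbrs_def insert_commute)
    obtain B where B: "block C B" "has_triangle B" "{c, d, d'} \<subseteq> verts B" using triB[OF c(1-4) cdd] by blast
    have Bs: "subgraph B C" "two_connected B" "simple_graph B" using B(1) by (auto simp: block_def subgraph_def)
    have "subgraph B H" using Bs(1) CH subgraph_trans by blast
    then have degB: "degree B c \<le> 3" using family_degree[OF H _ Bs(2), of c] B(3) by auto
    have "\<exists>e\<in>nbrs F c. {c, e} \<notin> edges B"
    proof (rule ccontr)
      assume "\<not> ?thesis"
      then have "(\<lambda>u. {c, u}) ` nbrs F c \<subseteq> {e \<in> edges B. c \<in> e}" by auto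
      moreover have "finite {e \<in> edges B. c \<in> e}" using finite_edges[OF Bs(3)] by simp
      ultimately have "card ((\<lambda>u. {c, u}) ` nbrs F c) \<le> degree B c" unfolding degree_def using card_mono by blast
      then show False using degB c4 card_image[OF injc, of "nbrs F c"] by linarith
    qed
    then obtain e where e: "e \<in> nbrs F c" "{c, e} \<notin> edges B" by blast
    have ec: "e \<noteq> c" using e noloop by auto
    \<comment> \<open>The vertices reachable from \<open>e\<close> without using \<open>c\<close>
      form a branch \<open>Eb\<close> at \<open>c\<close>, so \<open>pendant_triangle\<close> finds
      a triangle with a vertex \<open>f\<close> in \<open>Eb\<close>.\<close>
    define Fc where "Fc = {f \<in> F. c \<notin> f}"
    define Eb where "Eb = {w. (adj Fc)\<^sup>*\<^sup>* e w}"
    have Ebc: "w \<noteq> c" "w \<in> K" if "w \<in> Eb" for w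
    proof -
      have "(adj Fc)\<^sup>*\<^sup>* e w" using that by (simp add: Eb_def)
      then have "w \<noteq> c \<and> w \<in> K"
      proof (induction rule: rtranclp_induct)
        case base then show ?case using ec e Ecl[OF c(1)] by blast
      next
        case (step y z)
        then show ?case using Ecl[of y z] by (auto simp: adj_def Fc_def in_nb)
      qed
      then show "w \<noteq> c" "w \<in> K" by auto
    qed
    have "branch F K c Eb" unfolding branch_def
    proof (intro conjI ballI)
      show "Eb \<noteq> {}" by (auto simp: Eb_def)
      show "c \<notin> Eb" "Eb \<subseteq> K" "c \<in> K" using Ebc c(1) by auto
      fix w assume w: "w \<in> Eb"
      show "nbrs F w \<subseteq> insert c Eb"
      proof
        fix s assume s: "s \<in> nbrs F w"
        have "s \<in> Eb" if "s \<noteq> c"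
        proof -
          have "adj Fc w s" using s that Ebc(1)[OF w] by (auto simp: adj_def Fc_def in_nb)
          then show ?thesis using w by (auto simp: Eb_def intro: rtranclp.rtrancl_into_rtrancl)
        qed
        then show "s \<in> insert c Eb" by blast
      qed
    qed
    from pendant_triangle[OF H sgF irr K_def finK this]
    obtain c' f f' where f: "c' \<in> K" "f \<in> Eb" "c' \<noteq> f" "c' \<noteq> f'" "f \<noteq> f'" "nbrs F f = {f', c'}" "nbrs F f' = {f, c'}" by blast
    have "{c', f} \<in> F" "{c', f'} \<in> F" "{f, f'} \<in> F" using f(6,7) by (auto simp: nbrs_def insert_commute)
    then obtain B' where B': "block C B'" "has_triangle B'" "{c', f, f'} \<subseteq> verts B'" using triB[OF f(1,3,4,5)] by blast
    have fB: "f \<in> verts B" using one[OF B(1,2) B'(1,2)] B'(3) by auto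
    have "(adj Fc)\<^sup>*\<^sup>* e f" using f(2) by (simp add: Eb_def)
    from rtranclp_chain[OF this] obtain zs where zs: "chain (adj Fc) (e # zs)" "distinct (e # zs)" "last (e # zs) = f" by blast
    have ex: "\<exists>v\<in>set (e # zs). v \<in> verts B" using zs(3) fB last_in_set[of "e # zs"] by auto
    \<comment> \<open>Stopping at the first vertex in \<open>B\<close> makes \<open>c\<close>,
      \<open>ps\<close>, \<open>g\<close> an ear of \<open>B\<close>; if \<open>e\<close> itself
      lies in \<open>B\<close>, the ear is just the edge \<open>ce\<close>.\<close>
    obtain ps g rs where sp: "e # zs = ps @ g # rs" "g \<in> verts B" "\<forall>v\<in>set ps. v \<notin> verts B"
      using split_list_first_prop[OF ex] by blast
    have chedges: "set_mset (path_edges L) \<subseteq> Fc" if "chain (adj Fc) L" for L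
      using that by (induction L rule: path_edges.induct) (auto simp: adj_def)
    have "chain (adj Fc) ((ps @ [g]) @ rs)" using zs(1) sp(1) by simp
    then have pe: "set_mset (path_edges (ps @ [g])) \<subseteq> Fc" using chedges chain_append1 by blast
    have cnot: "c \<notin> set (ps @ [g])"
    proof -
      have "w \<in> Eb" if "w \<in> set (ps @ [g])" for w
      proof -
        have "(adj Fc)\<^sup>*\<^sup>* e w"
        proof (rule path_adj[OF pe])
          show "e \<in> set (ps @ [g])" using sp(1) by (cases ps) auto
        qed (use that in simp)
        then show ?thesis by (simp add: Eb_def)
      qed
      then show ?thesis using Ebc(1) by blast
    qed
    define Q where "Q = c # ps @ [g]"
    have dQ: "distinct Q" using zs(2) cnot unfolding Q_def sp(1) by auto
    have hde: "hd (ps @ [g]) = e" using sp(1) by (cases ps) auto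
    have peQ: "path_edges Q = add_mset {c, e} (path_edges (ps @ [g]))" unfolding Q_def using hde by (subst path_edges_Cons) auto
    define D where "D = \<lparr>verts = verts B \<union> set ps, edges = edges B \<union> set_mset (path_edges Q)\<rparr>"
    have "two_connected D" unfolding D_def Q_def
      by (rule two_connected_ear[OF Bs(2,3)]) (use dQ B(3) sp in \<open>auto simp: Q_def\<close>)
    moreover have psZ: "set (ps @ [g]) \<subseteq> Z"
    proof
      fix w assume w: "w \<in> set (ps @ [g])"
      have "(adj Fc)\<^sup>*\<^sup>* e w"
        by (rule path_adj[OF pe]) (use w sp(1) in \<open>auto simp: Cons_eq_append_conv\<close>)
      then have "w \<in> Eb" by (simp add: Eb_def)
      then show "w \<in> Z" using Ebc(2) FZ by blast
    qed
    have QF: "set_mset (path_edges Q) \<subseteq> F" using peQ pe e(1) by (auto simp: Fc_def in_nb)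
    have QC: "set_mset (path_edges Q) \<subseteq> edges C"
    proof
      fix x assume x: "x \<in> set_mset (path_edges Q)"
      then have "x \<subseteq> set Q" using path_edges_subset by fastforce
      then have "x \<subseteq> Z" using psZ cZ by (auto simp: Q_def)
      then show "x \<in> edges C" using x QF sgF(2) by (auto simp: edgesC)
    qed
    have DC: "subgraph D C" unfolding subgraph_def
    proof (intro conjI)
      show "verts D \<subseteq> verts C" using Bs(1) psZ by (auto simp: D_def subgraph_def edgesC)
      show "edges D \<subseteq> edges C" using Bs(1) QC by (auto simp: D_def subgraph_def)
      show "simple_graph D" unfolding simple_graph_def
      proof (intro conjI ballI)
        show "finite (verts D)" using Bs(3) by (auto simp: D_def simple_graph_def)
        fix x assume x: "x \<in> edges D"
        then have "x \<in> edges B \<or> x \<in> set_mset (path_edges Q)" by (simp add: D_def)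
        then show "x \<subseteq> verts D"
        proof
          assume "x \<in> set_mset (path_edges Q)"
          then have "x \<subseteq> set Q" using path_edges_subset by fastforce
          then show ?thesis using B(3) sp(2) by (auto simp: D_def Q_def)
        qed (use Bs(3) in \<open>auto simp: D_def simple_graph_def\<close>)
        show "card x = 2" using x \<open>edges D \<subseteq> edges C\<close> sC by (auto simp: simple_graph_def)
      qed
    qed
    moreover have "subgraph B D" using Bs(3) by (auto simp: subgraph_def D_def)
    ultimately have "D = B" using B(1) unfolding block_def by blast
    moreover have "{c, e} \<in> edges D" using peQ by (simp add: D_def)
    ultimately have "{c, e} \<in> edges B" by simp
    then show ?thesis using e(2) by blast
  qed
qed

section \<open>The theorem\<close>

definition even_edges :: "'v set set \<Rightarrow> 'v set set" where
  "even_edges E = {e \<in> E. \<forall>v\<in>e. even (deg E v)}"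

lemma nbrs_evF: "nbrs (even_edges E) v = (if even (deg E v) then even_nbrs E v else {})"
  by (auto simp: nbrs_def even_edges_def even_nbrs_def)

lemma graph_on_evF: "graph_on V E \<Longrightarrow> graph_on V (even_edges E)"
  by (auto simp: graph_on_def even_edges_def)

lemma even_edges_mono: "finite E \<Longrightarrow> even_removal E M \<Longrightarrow> even_edges (E - M) \<subseteq> even_edges E"
  using even_removal_even[of E M] by (auto simp: even_edges_def)

lemma irreducible_even_edges:
  assumes sgE: "graph_on V E" and no: "\<not> (\<exists>M. even_reduction E M)"
  shows "irreducible_graph (even_edges E)"
  unfolding irreducible_graph_def
proof (intro conjI allI impI)
  fix v show "card (nbrs (even_edges E) v) \<noteq> 1"
  proof
    assume "card (nbrs (even_edges E) v) = 1"
    then obtain b where "nbrs (even_edges E) v = {b}" by (auto simp: card_1_singleton_iff)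
    then have "even (deg E v)" "even_nbrs E v = {b}" by (auto simp: nbrs_evF split: if_splits)
    then show False using even_reduction_leaf[OF sgE] no by blast
  qed
next
  fix a a' b b'
  assume h: "nbrs (even_edges E) a = {a', b}" "nbrs (even_edges E) a' = {a, b'}" "b \<noteq> a'" "b' \<noteq> a"
  then have "even (deg E a)" "even (deg E a')" "even_nbrs E a = {a', b}" "even_nbrs E a' = {a, b'}"
    by (auto simp: nbrs_evF split: if_splits)
  then show "b = b'" using even_reduction_adjacent[OF sgE, of a a' b b'] h(3,4) no by blast
next
  fix x v v'
  assume h: "card (nbrs (even_edges E) x) = 3" "v \<in> nbrs (even_edges E) x" "v' \<in> nbrs (even_edges E) x" "v \<noteq> v'"
    "card (nbrs (even_edges E) v) \<le> 3" "card (nbrs (even_edges E) v') \<le> 3"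
  have x: "even (deg E x)" "even_nbrs E x = nbrs (even_edges E) x" using h(2) by (auto simp: nbrs_evF split: if_splits)
  have "v \<in> even_nbrs E x" "v' \<in> even_nbrs E x" using h(2,3) unfolding x(2) by blast+
  then have ev: "even (deg E v)" "even (deg E v')" by (simp_all add: in_even_nbrs)
  have "card (even_nbrs E x - {v, v'}) = 1" using h(1-4) x(2) finite_even_nbrs[OF sgE, of x] by (simp add: card_Diff_subset)
  \<comment> \<open>The third neighbour takes the part of the vertex exempted from the degree bound
    in \<open>even_reduction_star3\<close>.\<close>
  then obtain y where y: "even_nbrs E x - {v, v'} = {y}" by (auto simp: card_1_singleton_iff)
  have "even_reduction E (star x (even_nbrs E x))"
  proof (rule even_reduction_star3[OF sgE x(1)])
    show "card (even_nbrs E x) = 3" "y \<in> even_nbrs E x" using h(1) x(2) y by auto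
    fix w assume "w \<in> even_nbrs E x" "w \<noteq> y"
    then have "w = v \<or> w = v'" using y by blast
    then show "card (even_nbrs E w) \<le> 3" using h(5,6) ev by (auto simp: nbrs_evF)
  qed
  then show False using no by blast
qed

lemma family_irreducible:
  assumes sgE: "graph_on V E" and H: "H \<in> \<G>" "even_edges E \<subseteq> edges H"
  shows "tri_isolated E \<or> (\<exists>M. even_reduction E M)"
proof (rule disjCI)
  assume no: "\<not> (\<exists>M. even_reduction E M)"
  show "tri_isolated E" unfolding tri_isolated_def
  proof (intro allI impI)
    fix v assume v: "even (deg E v)"
    show "even_nbrs E v = {} \<or> (\<exists>y z. y \<noteq> z \<and> even_nbrs E v = {y, z} \<and> even_nbrs E y = {v, z} \<and> even_nbrs E z = {v, y})"
    proof (cases "even_nbrs E v = {}")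
      case False
      then have "nbrs (even_edges E) v \<noteq> {}" using v by (simp add: nbrs_evF)
      then obtain y z where yz: "y \<noteq> z" "nbrs (even_edges E) v = {y, z}" "nbrs (even_edges E) y = {v, z}" "nbrs (even_edges E) z = {v, y}"
        using irreducible_triangle[OF H(1) graph_on_evF[OF sgE] H(2) irreducible_even_edges[OF sgE no]] by blast
      then have "even_nbrs E v = {y, z}" "even_nbrs E y = {v, z}" "even_nbrs E z = {v, y}"
        by (auto simp: nbrs_evF split: if_splits)
      then show ?thesis using yz(1) by blast
    qed simp
  qed
qed

lemma family_wheel_free:
  assumes sgE: "graph_on V E" and H: "H \<in> \<G>" "even_edges E \<subseteq> edges H"
  shows "wheel_free E"
  unfolding wheel_free_def
proof (intro allI impI)
  fix t y z u w
  assume h: "distinct [t, y, z, u, w]" "even (deg E t)" "{y, z, u, w} \<subseteq> even_nbrs E t" "z \<in> even_nbrs E y"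
    "u \<in> even_nbrs E y \<union> even_nbrs E z" "w \<in> even_nbrs E y \<union> even_nbrs E z"
  have ev: "even (deg E y)" "even (deg E z)" "even (deg E u)" "even (deg E w)" using h(3) by (auto simp: in_even_nbrs)
  have F: "{a, b} \<in> even_edges E" if "even (deg E a)" "b \<in> even_nbrs E a" for a b
    using that by (auto simp: even_edges_def in_even_nbrs)
  show False
  proof (rule wheel_degree[OF H(1) graph_on_evF[OF sgE] H(2) h(1)])
    show "{t, y} \<in> even_edges E" "{t, z} \<in> even_edges E" "{t, u} \<in> even_edges E" "{t, w} \<in> even_edges E" using F[OF h(2)] h(3) by auto
    show "{y, z} \<in> even_edges E" using F ev h(4) by blast
    show "{y, u} \<in> even_edges E \<or> {z, u} \<in> even_edges E" "{y, w} \<in> even_edges E \<or> {z, w} \<in> even_edges E" using F ev h(5,6) by blast+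
  qed
qed

lemma family_good:
  assumes "graph_on V E" "H \<in> \<G>" "even_edges E \<subseteq> edges H" "\<not> obstructed E"
  shows "half_decomposable V E"
proof (rule reducible_good[where C = "\<lambda>E. even_edges E \<subseteq> edges H"])
  show "even_edges (E - M) \<subseteq> edges H" if "even_edges E \<subseteq> edges H" "even_removal E M" "finite E" for E M :: "'a set set"
    using even_edges_mono[OF that(3,2)] that(1) by blast
  show "wheel_free E" if "even_edges E \<subseteq> edges H" "graph_on V E" for E
    using family_wheel_free[OF that(2) assms(2) that(1)] .
  show "tri_isolated E \<or> (\<exists>M. even_reduction E M)" if "even_edges E \<subseteq> edges H" "graph_on V E" for E
    using family_irreducible[OF that(2) assms(2) that(1)] .
qed (use assms in auto)

section \<open>From path systems to the path number\<close>

lemma path_edges_nth: "set_mset (path_edges xs) = {{xs ! i, xs ! Suc i} | i. Suc i < length xs}"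
proof (induction xs rule: path_edges.induct)
  case (1 x y r)
  have "{{(x # y # r) ! i, (x # y # r) ! Suc i} | i. Suc i < length (x # y # r)}
    = insert {x, y} {{(y # r) ! i, (y # r) ! Suc i} | i. Suc i < length (y # r)}" (is "?A = ?B")
  proof
    show "?A \<subseteq> ?B"
    proof
      fix e assume "e \<in> ?A"
      then obtain i where i: "e = {(x # y # r) ! i, (x # y # r) ! Suc i}" "Suc i < length (x # y # r)" by blast
      show "e \<in> ?B"
      proof (cases i)
        case 0 then show ?thesis using i by simp
      next
        case (Suc j)
        then have "e = {(y # r) ! j, (y # r) ! Suc j}" "Suc j < length (y # r)" using i by auto
        then show ?thesis by blast
      qed
    qed
    show "?B \<subseteq> ?A"
    proof
      fix e assume "e \<in> ?B"
      then consider "e = {x, y}" | i where "e = {(y # r) ! i, (y # r) ! Suc i}" "Suc i < length (y # r)" by blast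
      then show "e \<in> ?A"
      proof cases
        case 1
        then have "e = {(x # y # r) ! 0, (x # y # r) ! Suc 0}" "Suc 0 < length (x # y # r)" by auto
        then show ?thesis by blast
      next
        case 2
        then have "e = {(x # y # r) ! Suc i, (x # y # r) ! Suc (Suc i)}" "Suc (Suc i) < length (x # y # r)" by auto
        then show ?thesis by blast
      qed
    qed
  qed
  then show ?case using 1 by simp
qed auto

text \<open>One-vertex paths cover no edge and may lie outside \<open>verts G\<close>, so they are
  dropped first. Passing from the multiset of lists to a set of graphs can only lower the
  count.\<close>

lemma pn_le:
  assumes G: "simple_graph G" and decomp: "decomp (edges G) n t"
  shows "pn G \<le> n"
proof -
  obtain M0 where M0: "decomposes (edges G) M0" "size M0 = n" "finite (edges G)" using decomp by (auto simp: decomp_def)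
  define M where "M = {#P \<in># M0. 2 \<le> length P#}"
  have d: "decomposes (edges G) M" unfolding M_def by (rule decomposes_nontrivial[OF M0(1)])
  define g where "g P = \<lparr>verts = set P, edges = set_mset (path_edges P)\<rparr>" for P :: "'a list"
  define D where "D = g ` set_mset M"
  have U: "(\<Union>P\<in>set_mset M. set_mset (path_edges P)) = edges G"
  proof -
    have "set_mset (\<Sum>P\<in>#M. path_edges P) = edges G" using d M0(3) by (simp add: decomposes_def)
    moreover have "set_mset (\<Sum>P\<in>#X. path_edges P) = (\<Union>P\<in>set_mset X. set_mset (path_edges P))" for X :: "'a list multiset"
      by (induction X) auto
    ultimately show ?thesis by simp
  qed
  have path: "is_path (g P) \<and> subgraph (g P) G" if P: "P \<in># M" for P
  proof
    have Pd: "distinct P" "P \<noteq> []" "2 \<le> length P" using P d by (auto simp: decomposes_def M_def)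
    show "is_path (g P)" unfolding is_path_def g_def using Pd path_edges_nth[of P] by auto
    have E: "e \<in> edges G" if "e \<in># path_edges P" for e using U P that by blast
    have "set P \<subseteq> verts G"
    proof
      fix v assume "v \<in> set P"
      then obtain e where "e \<in># path_edges P" "v \<in> e" using path_edges_covers[OF _ Pd(3)] by blast
      then show "v \<in> verts G" using E G by (auto simp: simple_graph_def)
    qed
    moreover have "simple_graph (g P)" unfolding simple_graph_def g_def
      using E G path_edges_subset[of _ P] by (auto simp: simple_graph_def)
    ultimately show "subgraph (g P) G" using E by (auto simp: subgraph_def g_def)
  qed
  have "pairwise (\<lambda>P Q. edges P \<inter> edges Q = {}) D" unfolding pairwise_def
  proof (intro ballI impI)
    fix A B assume AB: "A \<in> D" "B \<in> D" "A \<noteq> B"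
    then obtain P Q where PQ: "P \<in># M" "Q \<in># M" "A = g P" "B = g Q" "P \<noteq> Q" by (auto simp: D_def)
    obtain M1 where M1: "M = add_mset P M1" using PQ(1) by (metis insert_DiffM)
    then obtain M2 where M2: "M1 = add_mset Q M2" using PQ(2,5) by (metis insert_DiffM insert_noteq_member)
    have "path_edges P + path_edges Q + (\<Sum>P\<in>#M2. path_edges P) = mset_set (edges G)"
      using d unfolding decomposes_def M1 M2 by (simp add: add.assoc)
    \<comment> \<open>An edge common to two members of the system would have multiplicity at least 2
      in the sum.\<close>
    moreover have "count (mset_set (edges G)) e \<le> 1" for e by (simp add: count_mset_set')
    ultimately have c: "count (path_edges P) e + count (path_edges Q) e \<le> 1" for e
      by (metis add_leE count_union)
    have False if "e \<in># path_edges P" "e \<in># path_edges Q" for e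
      using that c[of e] by (simp flip: count_greater_zero_iff)
    then show "edges A \<inter> edges B = {}" using PQ by (auto simp: g_def)
  qed
  moreover have "(\<Union>P\<in>D. edges P) = edges G" using U by (simp add: D_def g_def)
  ultimately have "path_decomposition G D" unfolding path_decomposition_def using path by (auto simp: D_def)
  then have "pn G \<le> card D" unfolding pn_def by (intro Least_le) blast
  also have "\<dots> \<le> card (set_mset M)" unfolding D_def by (rule card_image_le) simp
  also have "\<dots> \<le> size M" by (metis size_mset_set mset_set_set_mset_msubset size_mset_mono)
  also have "\<dots> \<le> n" using M0(2) size_filter_mset_lesseq[of "\<lambda>P. 2 \<le> length P" M0]
    by (simp add: M_def del: size_filter_mset_lesseq)
  finally show ?thesis .
qed

theorem theorem1p3:
  fixes G :: "'a sgraph"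
  assumes "simple_graph G"
    and "connected_graph G"
    and "\<exists>H\<in>\<G>. subgraph (EV G) H"
  shows "int (pn G) \<le> \<lceil>real (card (verts G)) / 2\<rceil>"
proof -
  define V where "V = verts G"
  define E where "E = edges G"
  have sgE: "graph_on V E" using assms(1) by (auto simp: graph_on_def simple_graph_def V_def E_def)
  obtain H where H: "H \<in> \<G>" "subgraph (EV G) H" using assms(3) by blast
  have "even_edges E \<subseteq> edges (EV G)"
    using sgE unfolding even_edges_def EV_def induced_def degree_def deg_def E_def V_def graph_on_def by auto
  then have F: "even_edges E \<subseteq> edges H" using H(2) by (auto simp: subgraph_def)
  have "\<exists>n t. decomp E n t \<and> 2 * n \<le> card V + 1"
  proof (cases "obstructed E")
    case False
    then have "half_decomposable V E" using family_good[OF sgE H(1) F] by blast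
    then obtain n t where "n \<le> card V div 2" "decomp E n t" unfolding half_decomposable_def by blast
    then show ?thesis by (intro exI[of _ n] exI[of _ t]) auto
  next
    case True
    then obtain T K where TK: "obstruction E T K" by (auto simp: obstructed_def)
    note b = obstructed_atD[OF TK]
    obtain x y z where T: "T = {x, y, z}" "x \<noteq> y" "x \<noteq> z" "y \<noteq> z" using b(2) by (auto simp: card_3_iff)
    have xy: "{x, y} \<in> E" using b(3) T by auto
    have xV: "x \<in> V" using graph_on_edge[OF sgE xy] by blast
    have VK: "V \<subseteq> K"
    proof
      fix v assume "v \<in> V"
      then have "(adj E)\<^sup>*\<^sup>* x v" using assms(2) xV unfolding connected_graph_adj E_def V_def by blast
      then show "v \<in> K"
      proof (induction rule: rtranclp_induct)
        case base then show ?case using b(1) T by auto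
      next
        case (step u w) then show ?case using b(6)[of "{u, w}"] by (auto simp: adj_def)
      qed
    qed
    have evT: "v \<in> T" if "v \<in> V" "even (deg E v)" for v using b(5)[of v] VK that by blast
    note finE = graph_on_finite[OF sgE]
    have par: "even (deg (E - {{x, y}}) v) \<longleftrightarrow> (even (deg E v) \<longleftrightarrow> v \<notin> {x, y})" for v
      using even_dg_Diff[OF finE, of "{{x, y}}" v] xy by (simp add: deg_insert)
    have "half_decomposable V (E - {{x, y}})"
    proof (rule lovasz)
      show "graph_on V (E - {{x, y}})" by (rule graph_on_subset[OF sgE]) auto
      fix u v assume uv: "{u, v} \<in> E - {{x, y}}"
      have V: "u \<noteq> v" "u \<in> V" "v \<in> V" using uv graph_on_edge[OF sgE, of u v] by auto
      \<comment> \<open>Deleting \<open>xy\<close> makes \<open>x\<close> and \<open>y\<close> odd,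
        and outside \<open>T\<close> all degrees are odd already.\<close>
      have "w = z" if "w \<in> V" "even (deg (E - {{x, y}}) w)" for w
        using evT[OF that(1)] that par[of w] T b(4)[of w] by auto
      then show "odd (deg (E - {{x, y}}) u) \<or> odd (deg (E - {{x, y}}) v)" using V by metis
    qed
    then obtain n t where nt: "n \<le> card V div 2" "decomp (E - {{x, y}}) n t" unfolding half_decomposable_def by blast
    obtain t' where "decomp (insert {x, y} (E - {{x, y}})) (Suc n) t'" using decomp_add_path[OF nt(2) T(2)] by auto
    then have decomp: "decomp E (Suc n) t'" using xy by (simp add: insert_absorb)
    \<comment> \<open>By handshaking \<open>card V - 3\<close> is even. The odd order makes rounding
      up exceed rounding down by one, which is just the additional path.\<close>
    have "{v \<in> V. odd (deg E v)} = V - T" using evT b(4) by blast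
    moreover have xz: "{x, z} \<in> E" using b(3) T by auto
    have TV: "T \<subseteq> V" unfolding T(1) using graph_on_edge[OF sgE xy] graph_on_edge[OF sgE xz] by blast
    moreover have finV: "finite V" using sgE by (simp add: graph_on_def)
    ultimately have "even (card V - 3)" "3 \<le> card V"
      using even_card_odd[OF sgE] b(2) card_mono[OF finV TV] by (auto simp: card_Diff_subset finite_subset)
    then have "odd (card V)" by presburger
    then have "2 * Suc n \<le> card V + 1" using nt(1) by presburger
    then show ?thesis using decomp by blast
  qed
  then obtain n t where n: "decomp E n t" "2 * n \<le> card V + 1" by blast
  have "pn G \<le> n" using pn_le[OF assms(1)] n(1) by (simp add: E_def)
  then have "2 * pn G \<le> card V + 1" using n(2) by linarith
  \<comment> \<open>The strict form is what \<open>le_ceiling_iff\<close> asks for.\<close>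
  then have "real (pn G) - 1 < real (card V) / 2" by linarith
  then show ?thesis unfolding V_def[symmetric] by (simp add: le_ceiling_iff)
qed

end
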